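(* Work in ZFC. Let $A\subseteq\mathrm{Ord}$ be a definable proper class of ordinals and let $\mathcal{V}_A=\{V_\beta\mid\beta\in A\}$. If the definition of $A$ is absolute to $V_\beta$ for all $\beta\in A$, then every world $V_\beta$ of $\mathcal{V}_A$ obeys $$\mathrm{S4.3}\subseteq\mathrm{Val}_{\mathcal{V}_A}(V_\beta,\mathcal{L}^\Diamond_{\in,V_\beta})\subseteq\mathrm{Val}_{\mathcal{V}_A}(V_\beta,\mathcal{L}_\in)\subseteq\mathrm{S5}.$$ If $A$ is definable but not necessarily absolute, then every world nevertheless obeys $$\mathrm{S4.3}\subseteq\mathrm{Val}_{\mathcal{V}_A}(V_\beta,\mathcal{L}^\Diamond_{\in,V_\beta})\subseteq\mathrm{Val}_{\mathcal{V}_A}(V_\beta,\mathcal{L}^\Diamond_\in)\subseteq\mathrm{S5}.$$ Furthermore, in each case the lower bound is realized: there is a world $V_\beta$ of $\mathcal{V}_A$ at which the respective chain consists of equalities up to the last language considered, i.e. $\mathrm{S4.3}=\mathrm{Val}_{\mathcal{V}_A}(V_\beta,\mathcal{L}^\Diamond_{\in,V_\beta})=\mathrm{Val}_{\mathcal{V}_A}(V_\beta,\mathcal{L}_\in)$ in the absolute case, and $\mathrm{S4.3}=\mathrm{Val}_{\mathcal{V}_A}(V_\beta,\mathcal{L}^\Diamond_{\in,V_\beta})=\mathrm{Val}_{\mathcal{V}_A}(V_\beta,\mathcal{L}^\Diamond_\in)$ in general.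
   Context: $\mathcal{V}_A$ is the potentialist system whose worlds are the $V_\beta$ for $\beta\in A$, with $V_\beta$ accessing $V_\gamma$ iff $\beta\le\gamma$ ($\beta,\gamma\in A$); $\Diamond\varphi$ at $V_\beta$ means $\varphi$ holds at some world $V_\gamma$ of $\mathcal{V}_A$ with $\gamma\ge\beta$, $\Box\varphi$ at all such; quantifiers range over the current world. $\mathcal{L}_\in$ is the language of set theory, $\mathcal{L}_\in^\Diamond$ adds modal operators, subscript $V_\beta$ means parameters from $V_\beta$ allowed. $\mathrm{Val}_{\mathcal{V}_A}(W,\mathcal{L}')$ is the set of propositional modal formulas all of whose substitution instances by $\mathcal{L}'$-sentences are true at $W$. *)

theory Defs
  imports Main
begin

section \<open>Languages of set theory, with and without modal operators\<close>

datatype (tparams: 'a) tm = Var nat | Par 'a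

datatype (params: 'a) fm =
    FMem "'a tm" "'a tm"
  | FEq "'a tm" "'a tm"
  | FNeg "'a fm"
  | FImp "'a fm" "'a fm"
  | FAll nat "'a fm"
  | FBox "'a fm"

fun fv_tm :: "'a tm \<Rightarrow> nat set" where
  "fv_tm (Var n) = {n}"
| "fv_tm (Par a) = {}"

fun fv :: "'a fm \<Rightarrow> nat set" where
  "fv (FMem t u) = fv_tm t \<union> fv_tm u"
| "fv (FEq t u) = fv_tm t \<union> fv_tm u"
| "fv (FNeg \<phi>) = fv \<phi>"
| "fv (FImp \<phi> \<psi>) = fv \<phi> \<union> fv \<psi>"
| "fv (FAll n \<phi>) = fv \<phi> - {n}"
| "fv (FBox \<phi>) = fv \<phi>"

fun modal_free :: "'a fm \<Rightarrow> bool" where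
  "modal_free (FMem t u) \<longleftrightarrow> True"
| "modal_free (FEq t u) \<longleftrightarrow> True"
| "modal_free (FNeg \<phi>) \<longleftrightarrow> modal_free \<phi>"
| "modal_free (FImp \<phi> \<psi>) \<longleftrightarrow> modal_free \<phi> \<and> modal_free \<psi>"
| "modal_free (FAll n \<phi>) \<longleftrightarrow> modal_free \<phi>"
| "modal_free (FBox \<phi>) \<longleftrightarrow> False"

definition L_in :: "'a fm set" where
  "L_in = {\<phi>. fv \<phi> = {} \<and> params \<phi> = {} \<and> modal_free \<phi>}"

definition L_in_dia :: "'a fm set" where
  "L_in_dia = {\<phi>. fv \<phi> = {} \<and> params \<phi> = {}}"

definition L_in_dia_par :: "'a set \<Rightarrow> 'a fm set" where
  "L_in_dia_par U = {\<phi>. fv \<phi> = {} \<and> params \<phi> \<subseteq> U}"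

fun tval :: "(nat \<Rightarrow> 'a) \<Rightarrow> 'a tm \<Rightarrow> 'a" where
  "tval s (Var n) = s n"
| "tval s (Par a) = a"

text \<open>
  Satisfaction at a world \<open>w\<close> of a Kripke structure with domains \<open>D\<close> and accessibility \<open>R\<close>;
  all worlds interpret membership by the same relation \<open>E\<close>. The diamond is the dual of the box.
\<close>

fun sat :: "('a \<Rightarrow> 'a \<Rightarrow> bool) \<Rightarrow> ('w \<Rightarrow> 'a set) \<Rightarrow> ('w \<Rightarrow> 'w \<Rightarrow> bool) \<Rightarrow>
    'w \<Rightarrow> (nat \<Rightarrow> 'a) \<Rightarrow> 'a fm \<Rightarrow> bool" where
  "sat E D R w s (FMem t u) \<longleftrightarrow> E (tval s t) (tval s u)"
| "sat E D R w s (FEq t u) \<longleftrightarrow> tval s t = tval s u"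
| "sat E D R w s (FNeg \<phi>) \<longleftrightarrow> \<not> sat E D R w s \<phi>"
| "sat E D R w s (FImp \<phi> \<psi>) \<longleftrightarrow> (sat E D R w s \<phi> \<longrightarrow> sat E D R w s \<psi>)"
| "sat E D R w s (FAll n \<phi>) \<longleftrightarrow> (\<forall>x \<in> D w. sat E D R w (s(n := x)) \<phi>)"
| "sat E D R w s (FBox \<phi>) \<longleftrightarrow> (\<forall>u. R w u \<longrightarrow> sat E D R u s \<phi>)"

text \<open>
  Ordinary first-order satisfaction in the structure with domain \<open>U\<close>, only used for modal-free
  formulas (the accessibility relation is then irrelevant).
\<close>

definition fo_sat :: "('a \<Rightarrow> 'a \<Rightarrow> bool) \<Rightarrow> 'a set \<Rightarrow> (nat \<Rightarrow> 'a) \<Rightarrow> 'a fm \<Rightarrow> bool" where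
  "fo_sat E U s \<phi> \<longleftrightarrow> sat E (\<lambda>_::unit. U) (=) () s \<phi>"


section \<open>Models of ZFC\<close>

definition is_empty :: "('a \<Rightarrow> 'a \<Rightarrow> bool) \<Rightarrow> 'a \<Rightarrow> bool" where
  "is_empty E x \<longleftrightarrow> (\<forall>y. \<not> E y x)"

definition sub :: "('a \<Rightarrow> 'a \<Rightarrow> bool) \<Rightarrow> 'a \<Rightarrow> 'a \<Rightarrow> bool" where
  "sub E x y \<longleftrightarrow> (\<forall>z. E z x \<longrightarrow> E z y)"

text \<open>\<open>is_succ E x y\<close>: \<open>y = x \<union> {x}\<close>. \<open>is_pair E p x y\<close>: \<open>p = {{x}, {x, y}}\<close>.\<close>

definition is_succ :: "('a \<Rightarrow> 'a \<Rightarrow> bool) \<Rightarrow> 'a \<Rightarrow> 'a \<Rightarrow> bool" where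
  "is_succ E x y \<longleftrightarrow> (\<forall>z. E z y \<longleftrightarrow> E z x \<or> z = x)"

definition is_pair :: "('a \<Rightarrow> 'a \<Rightarrow> bool) \<Rightarrow> 'a \<Rightarrow> 'a \<Rightarrow> 'a \<Rightarrow> bool" where
  "is_pair E p x y \<longleftrightarrow>
    (\<forall>z. E z p \<longleftrightarrow> (\<forall>u. E u z \<longleftrightarrow> u = x) \<or> (\<forall>u. E u z \<longleftrightarrow> u = x \<or> u = y))"

text \<open>
  The universe of the model is the whole type. In the two schemes the parameters
  of \<open>\<phi>\<close> are supplied by the assignment \<open>s\<close>.
\<close>

locale zfc_model =
  fixes E :: "'a \<Rightarrow> 'a \<Rightarrow> bool"
  assumes extensionality: "\<forall>x y. (\<forall>z. E z x \<longleftrightarrow> E z y) \<longrightarrow> x = y"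
    and foundation: "\<forall>a. (\<exists>x. E x a) \<longrightarrow> (\<exists>x. E x a \<and> \<not> (\<exists>y. E y x \<and> E y a))"
    and pairing: "\<forall>x y. \<exists>a. \<forall>z. E z a \<longleftrightarrow> z = x \<or> z = y"
    and union: "\<forall>a. \<exists>b. \<forall>z. E z b \<longleftrightarrow> (\<exists>x. E x a \<and> E z x)"
    and power_set: "\<forall>a. \<exists>b. \<forall>z. E z b \<longleftrightarrow> sub E z a"
    and infinity: "\<exists>a. (\<exists>e. is_empty E e \<and> E e a) \<and>
      (\<forall>x. E x a \<longrightarrow> (\<exists>y. is_succ E x y \<and> E y a))"
    and separation: "\<forall>\<phi> s a. modal_free \<phi> \<longrightarrow>
      (\<exists>b. \<forall>x. E x b \<longleftrightarrow> E x a \<and> fo_sat E UNIV (s(0 := x)) \<phi>)"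
    and replacement: "\<forall>\<phi> s a. modal_free \<phi> \<longrightarrow>
      (\<forall>x. E x a \<longrightarrow> (\<exists>!y. fo_sat E UNIV (s(0 := x, 1 := y)) \<phi>)) \<longrightarrow>
      (\<exists>b. \<forall>y. E y b \<longleftrightarrow> (\<exists>x. E x a \<and> fo_sat E UNIV (s(0 := x, 1 := y)) \<phi>))"
    and choice: "\<forall>a. (\<forall>x. E x a \<longrightarrow> \<not> is_empty E x) \<longrightarrow>
      (\<forall>x y. E x a \<longrightarrow> E y a \<longrightarrow> x \<noteq> y \<longrightarrow> \<not> (\<exists>z. E z x \<and> E z y)) \<longrightarrow>
      (\<exists>c. \<forall>x. E x a \<longrightarrow> (\<exists>!y. E y x \<and> E y c))"


section \<open>Ordinals and the cumulative hierarchy inside a model\<close>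

definition trans_set :: "('a \<Rightarrow> 'a \<Rightarrow> bool) \<Rightarrow> 'a \<Rightarrow> bool" where
  "trans_set E x \<longleftrightarrow> (\<forall>y. E y x \<longrightarrow> sub E y x)"

definition is_ord :: "('a \<Rightarrow> 'a \<Rightarrow> bool) \<Rightarrow> 'a \<Rightarrow> bool" where
  "is_ord E x \<longleftrightarrow> trans_set E x \<and> (\<forall>y. E y x \<longrightarrow> trans_set E y)"

definition ord_le :: "('a \<Rightarrow> 'a \<Rightarrow> bool) \<Rightarrow> 'a \<Rightarrow> 'a \<Rightarrow> bool" where
  "ord_le E \<alpha> \<beta> \<longleftrightarrow> E \<alpha> \<beta> \<or> \<alpha> = \<beta>"

definition maps :: "('a \<Rightarrow> 'a \<Rightarrow> bool) \<Rightarrow> 'a \<Rightarrow> 'a \<Rightarrow> 'a \<Rightarrow> bool" where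
  "maps E f x y \<longleftrightarrow> (\<exists>p. is_pair E p x y \<and> E p f)"

text \<open>
  The model may be ill-founded from outside, so the recursion defining the hierarchy has to take
  place inside it: \<open>f\<close> is an element of the model which is, in the model, the function
  \<open>\<alpha> \<mapsto> V\<^sub>\<alpha>\<close> on \<open>\<beta> + 1\<close>.
\<close>

definition is_hierarchy :: "('a \<Rightarrow> 'a \<Rightarrow> bool) \<Rightarrow> 'a \<Rightarrow> 'a \<Rightarrow> bool" where
  "is_hierarchy E \<beta> f \<longleftrightarrow>
    (\<forall>p. E p f \<longrightarrow> (\<exists>\<alpha> v. ord_le E \<alpha> \<beta> \<and> is_pair E p \<alpha> v)) \<and>
    (\<forall>\<alpha>. ord_le E \<alpha> \<beta> \<longrightarrow> (\<exists>!v. maps E f \<alpha> v)) \<and>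
    (\<forall>\<alpha> v. maps E f \<alpha> v \<longrightarrow>
      (is_empty E \<alpha> \<longrightarrow> is_empty E v) \<and>
      (\<forall>\<gamma> u. is_succ E \<gamma> \<alpha> \<and> maps E f \<gamma> u \<longrightarrow> (\<forall>x. E x v \<longleftrightarrow> sub E x u)) \<and>
      (\<not> is_empty E \<alpha> \<and> \<not> (\<exists>\<gamma>. is_succ E \<gamma> \<alpha>) \<longrightarrow>
        (\<forall>x. E x v \<longleftrightarrow> (\<exists>\<gamma> u. E \<gamma> \<alpha> \<and> maps E f \<gamma> u \<and> E x u))))"

definition V :: "('a \<Rightarrow> 'a \<Rightarrow> bool) \<Rightarrow> 'a \<Rightarrow> 'a set" where
  "V E \<beta> = {x. \<exists>f v. is_hierarchy E \<beta> f \<and> maps E f \<beta> v \<and> E x v}"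


section \<open>Definable classes and rank potentialism\<close>

definition class_of :: "('a \<Rightarrow> 'a \<Rightarrow> bool) \<Rightarrow> 'a fm \<Rightarrow> 'a set" where
  "class_of E \<delta> = {x. fo_sat E UNIV (\<lambda>_. x) \<delta>}"

text \<open>Definability is without parameters.\<close>

definition class_definition :: "'a fm \<Rightarrow> bool" where
  "class_definition \<delta> \<longleftrightarrow> modal_free \<delta> \<and> params \<delta> = {} \<and> fv \<delta> \<subseteq> {0}"

definition proper_class :: "('a \<Rightarrow> 'a \<Rightarrow> bool) \<Rightarrow> 'a set \<Rightarrow> bool" where
  "proper_class E A \<longleftrightarrow> \<not> (\<exists>a. \<forall>x. E x a \<longleftrightarrow> x \<in> A)"

definition absolute_to :: "('a \<Rightarrow> 'a \<Rightarrow> bool) \<Rightarrow> 'a fm \<Rightarrow> 'a set \<Rightarrow> bool" where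
  "absolute_to E \<delta> U \<longleftrightarrow>
    (\<forall>x \<in> U. fo_sat E U (\<lambda>_. x) \<delta> \<longleftrightarrow> fo_sat E UNIV (\<lambda>_. x) \<delta>)"

text \<open>The world with domain \<open>V E \<beta>\<close> is represented by its index \<open>\<beta>\<close>.\<close>

definition acc :: "('a \<Rightarrow> 'a \<Rightarrow> bool) \<Rightarrow> 'a set \<Rightarrow> 'a \<Rightarrow> 'a \<Rightarrow> bool" where
  "acc E A \<beta> \<gamma> \<longleftrightarrow> \<beta> \<in> A \<and> \<gamma> \<in> A \<and> ord_le E \<beta> \<gamma>"

definition true_at :: "('a \<Rightarrow> 'a \<Rightarrow> bool) \<Rightarrow> 'a set \<Rightarrow> 'a \<Rightarrow> 'a fm \<Rightarrow> bool" where
  "true_at E A \<beta> \<phi> \<longleftrightarrow> (\<forall>s. sat E (V E) (acc E A) \<beta> s \<phi>)"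


section \<open>Propositional modal logic\<close>

datatype pm = PVar nat | PNeg pm | PImp pm pm | PBox pm

definition PDia :: "pm \<Rightarrow> pm" where "PDia p = PNeg (PBox (PNeg p))"
definition PAnd :: "pm \<Rightarrow> pm \<Rightarrow> pm" where "PAnd p q = PNeg (PImp p (PNeg q))"
definition POr :: "pm \<Rightarrow> pm \<Rightarrow> pm" where "POr p q = PImp (PNeg p) q"

text \<open>Propositional evaluation, with variables and boxed formulas as atoms.\<close>

fun peval :: "(pm \<Rightarrow> bool) \<Rightarrow> pm \<Rightarrow> bool" where
  "peval v (PVar n) \<longleftrightarrow> v (PVar n)"
| "peval v (PNeg p) \<longleftrightarrow> \<not> peval v p"
| "peval v (PImp p q) \<longleftrightarrow> (peval v p \<longrightarrow> peval v q)"
| "peval v (PBox p) \<longleftrightarrow> v (PBox p)"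

inductive_set normal_logic :: "pm set \<Rightarrow> pm set" for Ax where
  taut: "(\<And>v. peval v p) \<Longrightarrow> p \<in> normal_logic Ax"
| K: "PImp (PBox (PImp p q)) (PImp (PBox p) (PBox q)) \<in> normal_logic Ax"
| ax: "p \<in> Ax \<Longrightarrow> p \<in> normal_logic Ax"
| mp: "PImp p q \<in> normal_logic Ax \<Longrightarrow> p \<in> normal_logic Ax \<Longrightarrow> q \<in> normal_logic Ax"
| nec: "p \<in> normal_logic Ax \<Longrightarrow> PBox p \<in> normal_logic Ax"

definition ax_T :: "pm set" where
  "ax_T = {PImp (PBox p) p | p. True}"
definition ax_4 :: "pm set" where
  "ax_4 = {PImp (PBox p) (PBox (PBox p)) | p. True}"
definition ax_dot3 :: "pm set" where
  "ax_dot3 = {PImp (PAnd (PDia p) (PDia q))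
      (PDia (POr (PAnd p (PDia q)) (PAnd q (PDia p)))) | p q. True}"
definition ax_5 :: "pm set" where
  "ax_5 = {PImp (PDia p) (PBox (PDia p)) | p. True}"

definition S4_3 :: "pm set" where
  "S4_3 = normal_logic (ax_T \<union> ax_4 \<union> ax_dot3)"

definition S5 :: "pm set" where
  "S5 = normal_logic (ax_T \<union> ax_4 \<union> ax_5)"

fun instantiate :: "(nat \<Rightarrow> 'a fm) \<Rightarrow> pm \<Rightarrow> 'a fm" where
  "instantiate \<sigma> (PVar n) = \<sigma> n"
| "instantiate \<sigma> (PNeg p) = FNeg (instantiate \<sigma> p)"
| "instantiate \<sigma> (PImp p q) = FImp (instantiate \<sigma> p) (instantiate \<sigma> q)"
| "instantiate \<sigma> (PBox p) = FBox (instantiate \<sigma> p)"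

definition Val :: "('a \<Rightarrow> 'a \<Rightarrow> bool) \<Rightarrow> 'a set \<Rightarrow> 'a \<Rightarrow> 'a fm set \<Rightarrow> pm set" where
  "Val E A \<beta> L = {p. \<forall>\<sigma>. (\<forall>n. \<sigma> n \<in> L) \<longrightarrow> true_at E A \<beta> (instantiate \<sigma> p)}"

end

theory Submission
  imports Defs
begin

text \<open>
  The worlds above a given one form a linear preorder, which gives S4.3. For the upper bounds, label a
  world \<open>V\<^sub>\<beta>\<close> by the finite part of the order type of \<open>A \<inter> \<beta>\<close>, cut off at some \<open>m\<close>,
  and by the number of limits of limit elements of \<open>A\<close> up to \<open>\<beta>\<close>, cut off at some \<open>r\<close>. The
  second label never decreases, and between two of its increases every value of the first one recurs.
  So the labels project the worlds onto \<open>r\<close> linearly ordered clusters of \<open>m\<close> points, and these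
  frames refute all nontheorems of S4.3 at the least world, where the second label is \<open>0\<close>. With
  \<open>r = 1\<close> they refute all nontheorems of S5, at any world. The labels are expressible at a world as
  soon as membership in \<open>A\<close> is: either because the definition of \<open>A\<close> is absolute, or by evaluating
  it in the limit of the worlds by means of the modal operators.
\<close>

text \<open>Levels rise only at limits of limits because every position has to recur within a level.
  Up to the next limit of limits there is always a limit of \<open>A\<close> together with each of
  its finite successors. If levels rose at every limit, a world past position 0 could not see
  position 0 again without its level rising.

  The world where a formula has to fail is prescribed. Its level can be made 0, by
  \<open>r = 1\<close> or by taking the least world, but its position is taken as it comes. Hence
  countermodels must be able to fail at every point of their lowest cluster.

  The labels depend only on \<open>A\<close> below \<beta>, which is exactly the part of
  \<open>A\<close> inside the world. So no parameters are needed, although \<beta> is not in the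
  domain and can only act as a bound.

  The model may be ill-founded from outside, even in its natural numbers. Minimal elements and
  recursions are therefore obtained inside it, each time with a formula for the class involved.
  Label values are true natural numbers, and the cut-off also absorbs positions that the model
  considers finite but that are not.\<close>

section \<open>Satisfaction under changes of assignment, frame and variable names\<close>

lemma sat_cong_fv:
  "(\<forall>n\<in>fv \<phi>. s n = s' n) \<Longrightarrow> sat E D R w s \<phi> = sat E D R w s' \<phi>"
proof (induction \<phi> arbitrary: s s' w)
  case (FMem t u) then show ?case by (cases t; cases u) auto
next
  case (FEq t u) then show ?case by (cases t; cases u) auto
next
  case (FAll n \<phi>)
  have "sat E D R w (s(n := x)) \<phi> = sat E D R w (s'(n := x)) \<phi>" for x
    by (rule FAll.IH) (use FAll.prems in auto)
  then show ?case by simp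
next
  case (FImp \<phi>1 \<phi>2)
  have "sat E D R w s \<phi>1 = sat E D R w s' \<phi>1" "sat E D R w s \<phi>2 = sat E D R w s' \<phi>2"
    using FImp.prems by (auto intro!: FImp.IH)
  then show ?case by simp
next
  case (FBox \<phi>)
  have "sat E D R u s \<phi> = sat E D R u s' \<phi>" for u
    by (rule FBox.IH) (use FBox.prems in auto)
  then show ?case by simp
next
  case (FNeg \<phi>)
  have "sat E D R w s \<phi> = sat E D R w s' \<phi>"
    by (rule FNeg.IH) (use FNeg.prems in auto)
  then show ?case by simp
qed

lemma sat_modal_free:
  "modal_free \<phi> \<Longrightarrow> D w = D' w' \<Longrightarrow> sat E D R w s \<phi> = sat E D' R' w' s \<phi>"
  by (induction \<phi> arbitrary: s) auto

fun ren_tm :: "(nat \<Rightarrow> nat) \<Rightarrow> 'a tm \<Rightarrow> 'a tm" where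
  "ren_tm \<pi> (Var n) = Var (\<pi> n)"
| "ren_tm \<pi> (Par a) = Par a"

text \<open>Bound variables are renamed along with free ones, so an injective renaming cannot cause
  capture.\<close>

fun ren :: "(nat \<Rightarrow> nat) \<Rightarrow> 'a fm \<Rightarrow> 'a fm" where
  "ren \<pi> (FMem t u) = FMem (ren_tm \<pi> t) (ren_tm \<pi> u)"
| "ren \<pi> (FEq t u) = FEq (ren_tm \<pi> t) (ren_tm \<pi> u)"
| "ren \<pi> (FNeg \<phi>) = FNeg (ren \<pi> \<phi>)"
| "ren \<pi> (FImp \<phi> \<psi>) = FImp (ren \<pi> \<phi>) (ren \<pi> \<psi>)"
| "ren \<pi> (FAll n \<phi>) = FAll (\<pi> n) (ren \<pi> \<phi>)"
| "ren \<pi> (FBox \<phi>) = FBox (ren \<pi> \<phi>)"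

lemma tval_ren: "tval s (ren_tm \<pi> t) = tval (s \<circ> \<pi>) t"
  by (cases t) auto

lemma sat_ren: "inj \<pi> \<Longrightarrow> sat E D R w s (ren \<pi> \<phi>) = sat E D R w (s \<circ> \<pi>) \<phi>"
proof (induction \<phi> arbitrary: s w)
  case (FAll n \<phi>)
  have *: "s(\<pi> n := x) \<circ> \<pi> = (s \<circ> \<pi>)(n := x)" for x
    using FAll.prems by (auto simp: fun_eq_iff inj_eq)
  show ?case by (simp only: ren.simps sat.simps FAll.IH[OF FAll.prems] *)
qed (auto simp: tval_ren)

lemma fv_tm_ren: "fv_tm (ren_tm \<pi> t) = \<pi> ` fv_tm t"
  by (cases t) auto

lemma fv_ren: "inj \<pi> \<Longrightarrow> fv (ren \<pi> \<phi>) = \<pi> ` fv \<phi>"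
  by (induction \<phi>) (auto simp: fv_tm_ren inj_eq)

lemma tparams_ren: "tparams (ren_tm \<pi> t) = tparams t"
  by (cases t) auto

lemma params_ren: "params (ren \<pi> \<phi>) = params \<phi>"
  by (induction \<phi>) (auto simp: tparams_ren)

lemma modal_free_ren: "modal_free (ren \<pi> \<phi>) = modal_free \<phi>"
  by (induction \<phi>) auto


section \<open>Definable predicates\<close>

text \<open>
  \<open>Dfn \<dots> k P\<close>: some formula with free variables among the first \<open>k\<close> expresses \<open>P\<close> at all worlds
  in \<open>W\<close>, for assignments into the domain of the world. Variables are treated as de Bruijn
  indices: under a quantifier, \<open>s 0\<close> is the bound variable.
\<close>

definition Dfn :: "('a \<Rightarrow> 'a \<Rightarrow> bool) \<Rightarrow> ('w \<Rightarrow> 'a set) \<Rightarrow> ('w \<Rightarrow> 'w \<Rightarrow> bool) \<Rightarrow> 'w set \<Rightarrow>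
    bool \<Rightarrow> 'a set \<Rightarrow> nat \<Rightarrow> ('w \<Rightarrow> (nat \<Rightarrow> 'a) \<Rightarrow> bool) \<Rightarrow> bool" where
  "Dfn E D R W mf U k P \<longleftrightarrow> (\<exists>\<phi>. fv \<phi> \<subseteq> {..<k} \<and> params \<phi> \<subseteq> U \<and> (mf \<longrightarrow> modal_free \<phi>) \<and>
     (\<forall>w\<in>W. \<forall>s. (\<forall>n<k. s n \<in> D w) \<longrightarrow> sat E D R w s \<phi> = P w s))"

definition Trm :: "'a set \<Rightarrow> nat \<Rightarrow> ((nat \<Rightarrow> 'a) \<Rightarrow> 'a) \<Rightarrow> bool" where
  "Trm U k t \<longleftrightarrow> (\<exists>n<k. t = (\<lambda>s. s n)) \<or> (\<exists>c\<in>U. t = (\<lambda>s. c))"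

lemma Trm_var: "n < k \<Longrightarrow> Trm U k (\<lambda>s. s n)"
  unfolding Trm_def by blast

lemma Trm_const: "c \<in> U \<Longrightarrow> Trm U k (\<lambda>s. c)"
  unfolding Trm_def by blast

lemma Trm_shift: "Trm U k t \<Longrightarrow> Trm U (Suc k) (\<lambda>s. t (\<lambda>n. s (Suc n)))"
  unfolding Trm_def by fastforce

lemma Trm_tm:
  assumes "Trm U k t"
  obtains t' where "fv_tm t' \<subseteq> {..<k}" "tparams t' \<subseteq> U" "\<And>s. tval s t' = t s"
proof -
  from assms consider n where "n < k" "t = (\<lambda>s. s n)" | c where "c \<in> U" "t = (\<lambda>s. c)"
    unfolding Trm_def by blast
  then show ?thesis
  proof cases
    case 1 then show ?thesis using that[of "Var n"] by simp
  next
    case 2 then show ?thesis using that[of "Par c"] by simp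
  qed
qed

lemma Dfn_cong:
  assumes "Dfn E D R W mf U k Q"
    and "\<And>w s. w \<in> W \<Longrightarrow> \<forall>n<k. s n \<in> D w \<Longrightarrow> P w s = Q w s"
  shows "Dfn E D R W mf U k P"
  using assms unfolding Dfn_def by (metis (no_types, lifting))

lemma Dfn_mem:
  assumes "Trm U k t" "Trm U k u"
  shows "Dfn E D R W mf U k (\<lambda>w s. E (t s) (u s))"
proof -
  obtain t' where "fv_tm t' \<subseteq> {..<k}" "tparams t' \<subseteq> U" "\<And>s. tval s t' = t s"
    using Trm_tm[OF assms(1)] by blast
  moreover obtain u' where "fv_tm u' \<subseteq> {..<k}" "tparams u' \<subseteq> U" "\<And>s. tval s u' = u s"
    using Trm_tm[OF assms(2)] by blast
  ultimately show ?thesis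
    unfolding Dfn_def by (intro exI[of _ "FMem t' u'"]) auto
qed

lemma Dfn_eq:
  assumes "Trm U k t" "Trm U k u"
  shows "Dfn E D R W mf U k (\<lambda>w s. t s = u s)"
proof -
  obtain t' where "fv_tm t' \<subseteq> {..<k}" "tparams t' \<subseteq> U" "\<And>s. tval s t' = t s"
    using Trm_tm[OF assms(1)] by blast
  moreover obtain u' where "fv_tm u' \<subseteq> {..<k}" "tparams u' \<subseteq> U" "\<And>s. tval s u' = u s"
    using Trm_tm[OF assms(2)] by blast
  ultimately show ?thesis
    unfolding Dfn_def by (intro exI[of _ "FEq t' u'"]) auto
qed

lemma Dfn_not:
  assumes "Dfn E D R W mf U k P"
  shows "Dfn E D R W mf U k (\<lambda>w s. \<not> P w s)"
proof -
  obtain \<phi> where "fv \<phi> \<subseteq> {..<k} \<and> params \<phi> \<subseteq> U \<and> (mf \<longrightarrow> modal_free \<phi>) \<and>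
     (\<forall>w\<in>W. \<forall>s. (\<forall>n<k. s n \<in> D w) \<longrightarrow> sat E D R w s \<phi> = P w s)"
    using assms unfolding Dfn_def by blast
  then show ?thesis unfolding Dfn_def by (intro exI[of _ "FNeg \<phi>"]) auto
qed

lemma Dfn_imp:
  assumes "Dfn E D R W mf U k P" "Dfn E D R W mf U k Q"
  shows "Dfn E D R W mf U k (\<lambda>w s. P w s \<longrightarrow> Q w s)"
proof -
  obtain \<phi> where "fv \<phi> \<subseteq> {..<k} \<and> params \<phi> \<subseteq> U \<and> (mf \<longrightarrow> modal_free \<phi>) \<and>
     (\<forall>w\<in>W. \<forall>s. (\<forall>n<k. s n \<in> D w) \<longrightarrow> sat E D R w s \<phi> = P w s)"
    using assms(1) unfolding Dfn_def by blast
  moreover obtain \<psi> where "fv \<psi> \<subseteq> {..<k} \<and> params \<psi> \<subseteq> U \<and> (mf \<longrightarrow> modal_free \<psi>) \<and>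
     (\<forall>w\<in>W. \<forall>s. (\<forall>n<k. s n \<in> D w) \<longrightarrow> sat E D R w s \<psi> = Q w s)"
    using assms(2) unfolding Dfn_def by blast
  ultimately show ?thesis unfolding Dfn_def by (intro exI[of _ "FImp \<phi> \<psi>"]) auto
qed

lemma Dfn_and:
  assumes "Dfn E D R W mf U k P" "Dfn E D R W mf U k Q"
  shows "Dfn E D R W mf U k (\<lambda>w s. P w s \<and> Q w s)"
  using Dfn_not[OF Dfn_imp[OF assms(1) Dfn_not[OF assms(2)]]] by simp

lemma Dfn_or:
  assumes "Dfn E D R W mf U k P" "Dfn E D R W mf U k Q"
  shows "Dfn E D R W mf U k (\<lambda>w s. P w s \<or> Q w s)"
  using Dfn_imp[OF Dfn_not[OF assms(1)] assms(2)] by (simp add: disj_imp)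

lemma Dfn_iff:
  assumes "Dfn E D R W mf U k P" "Dfn E D R W mf U k Q"
  shows "Dfn E D R W mf U k (\<lambda>w s. P w s \<longleftrightarrow> Q w s)"
  using Dfn_and[OF Dfn_imp[OF assms] Dfn_imp[OF assms(2,1)]] by (simp add: iff_conv_conj_imp)

lemma Dfn_ball:
  assumes "Dfn E D R W mf U (Suc k) (\<lambda>w s. P w (s 0) (\<lambda>n. s (Suc n)))"
  shows "Dfn E D R W mf U k (\<lambda>w s. \<forall>x\<in>D w. P w x s)"
proof -
  obtain \<phi> where \<phi>: "fv \<phi> \<subseteq> {..<Suc k}" "params \<phi> \<subseteq> U" "mf \<longrightarrow> modal_free \<phi>"
    "\<And>w s. w\<in>W \<Longrightarrow> (\<forall>n<Suc k. s n \<in> D w) \<Longrightarrow> sat E D R w s \<phi> = P w (s 0) (\<lambda>n. s (Suc n))"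
    using assms unfolding Dfn_def by blast
  \<comment> \<open>The cycle that sends 0 to \<open>k\<close> and lowers the other indices up to
    \<open>k\<close>: the quantified variable gets the first name not in use, and the others return
    to their slots outside the quantifier.\<close>
  define \<pi> where "\<pi> = (\<lambda>n. if n = 0 then k else if n \<le> k then n - 1 else n)"
  have inj: "inj \<pi>" unfolding inj_def \<pi>_def by auto
  have "sat E D R w (s(k := x)) (ren \<pi> \<phi>) = P w x s"
    if "w \<in> W" "\<forall>n<k. s n \<in> D w" "x \<in> D w" for w s x
  proof -
    have "sat E D R w (s(k := x)) (ren \<pi> \<phi>) = sat E D R w (s(k := x) \<circ> \<pi>) \<phi>"
      by (rule sat_ren[OF inj])
    also have "\<dots> = sat E D R w (case_nat x s) \<phi>"
      using \<phi>(1) by (intro sat_cong_fv) (auto simp: \<pi>_def split: nat.splits)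
    also have "\<dots> = P w x s"
      using \<phi>(4)[of w "case_nat x s"] that by (simp add: less_Suc_eq_0_disj split: nat.splits)
    finally show ?thesis .
  qed
  moreover have "fv (ren \<pi> \<phi>) \<subseteq> {..<Suc k}"
    using \<phi>(1) unfolding fv_ren[OF inj] by (auto simp: \<pi>_def)
  ultimately show ?thesis
    using \<phi> unfolding Dfn_def
    by (intro exI[of _ "FAll k (ren \<pi> \<phi>)"]) (auto simp: params_ren modal_free_ren less_Suc_eq)
qed

lemma Dfn_bex:
  assumes "Dfn E D R W mf U (Suc k) (\<lambda>w s. P w (s 0) (\<lambda>n. s (Suc n)))"
  shows "Dfn E D R W mf U k (\<lambda>w s. \<exists>x\<in>D w. P w x s)"
  using Dfn_not[OF Dfn_ball[OF Dfn_not[OF assms]]] by simp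

text \<open>The formula must be closed, since for \<open>k = 0\<close> no free variable is
  available.\<close>

lemma Dfn_const: "Dfn E D R W mf U k (\<lambda>w s. b)"
proof (cases b)
  case True
  show ?thesis unfolding Dfn_def using True
    by (intro exI[of _ "FAll 0 (FEq (Var 0) (Var 0))"]) auto
next
  case False
  show ?thesis unfolding Dfn_def using False
    by (intro exI[of _ "FNeg (FAll 0 (FEq (Var 0) (Var 0)))"]) auto
qed

lemma Dfn_fin_ball:
  assumes "finite I" "\<And>i. i \<in> I \<Longrightarrow> Dfn E D R W mf U k (P i)"
  shows "Dfn E D R W mf U k (\<lambda>w s. \<forall>i\<in>I. P i w s)"
  using assms
proof (induction I rule: finite_induct)
  case empty then show ?case by (simp add: Dfn_const)
next
  case (insert i I)
  have "Dfn E D R W mf U k (\<lambda>w s. P i w s \<and> (\<forall>i\<in>I. P i w s))"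
    using insert by (intro Dfn_and) auto
  then show ?case by simp
qed

lemma Dfn_fin_bex:
  assumes "finite I" "\<And>i. i \<in> I \<Longrightarrow> Dfn E D R W mf U k (P i)"
  shows "Dfn E D R W mf U k (\<lambda>w s. \<exists>i\<in>I. P i w s)"
  using Dfn_not[OF Dfn_fin_ball[OF assms(1) Dfn_not[OF assms(2)]]] by simp

lemma Dfn_weaken:
  "Dfn E D R W mf U k P \<Longrightarrow> k \<le> k' \<Longrightarrow> Dfn E D R W mf U k' P"
  unfolding Dfn_def by (meson dual_order.trans lessThan_subset_iff order_less_le_trans)

text \<open>Substitution is simulated by quantifying over an equal element, which saves an operation
  on formulas. The witness exists because \<open>s n\<close> lies in the domain.\<close>

lemma Dfn_subst:
  assumes "Dfn E D R W mf U 1 (\<lambda>w s. P w (s 0))" "n < k"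
  shows "Dfn E D R W mf U k (\<lambda>w s. P w (s n))"
proof (rule Dfn_cong)
  show "Dfn E D R W mf U k (\<lambda>w s. \<exists>x\<in>D w. x = s n \<and> P w x)"
    using assms by (intro Dfn_bex Dfn_and Dfn_eq Trm_var Dfn_weaken[OF assms(1)]) auto
qed (use assms in auto)


section \<open>Completeness for finite linear preorders\<close>

text \<open>
  Truth at the point \<open>(j, i)\<close> of the frame that consists of \<open>r\<close> linearly ordered clusters of
  \<open>m\<close> points each.
\<close>

fun fval :: "nat \<Rightarrow> nat \<Rightarrow> (nat \<Rightarrow> nat \<Rightarrow> nat \<Rightarrow> bool) \<Rightarrow> nat \<Rightarrow> nat \<Rightarrow> pm \<Rightarrow> bool" where
  "fval r m v j i (PVar n) \<longleftrightarrow> v j i n"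
| "fval r m v j i (PNeg p) \<longleftrightarrow> \<not> fval r m v j i p"
| "fval r m v j i (PImp p q) \<longleftrightarrow> (fval r m v j i p \<longrightarrow> fval r m v j i q)"
| "fval r m v j i (PBox p) \<longleftrightarrow> (\<forall>j'. j \<le> j' \<longrightarrow> j' < r \<longrightarrow> (\<forall>i'<m. fval r m v j' i' p))"

section \<open>Derivability from assumptions, maximal consistent sets, the canonical
  relation\<close>

fun imps :: "pm list \<Rightarrow> pm \<Rightarrow> pm" where
  "imps [] q = q"
| "imps (p # ps) q = PImp p (imps ps q)"

lemma peval_imps: "peval v (imps ps q) \<longleftrightarrow> ((\<forall>p\<in>set ps. peval v p) \<longrightarrow> peval v q)"
  by (induction ps) auto

fun subf :: "pm \<Rightarrow> pm set" where
  "subf (PVar n) = {PVar n}"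
| "subf (PNeg p) = insert (PNeg p) (subf p)"
| "subf (PImp p q) = insert (PImp p q) (subf p \<union> subf q)"
| "subf (PBox p) = insert (PBox p) (subf p)"

lemma finite_subf: "finite (subf p)" by (induction p) auto

lemma subf_refl: "p \<in> subf p" by (cases p) auto

lemma subf_closed:
  "PNeg q \<in> subf p \<Longrightarrow> q \<in> subf p"
  "PImp q q' \<in> subf p \<Longrightarrow> q \<in> subf p \<and> q' \<in> subf p"
  "PBox q \<in> subf p \<Longrightarrow> q \<in> subf p"
  by (induction p) (auto simp: subf_refl)

context
  fixes Ax :: "pm set"
begin

lemma mp_imps: "imps ps q \<in> normal_logic Ax \<Longrightarrow> \<forall>p\<in>set ps. p \<in> normal_logic Ax \<Longrightarrow> q \<in> normal_logic Ax"
proof (induction ps)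
  case (Cons p ps)
  then have "imps ps q \<in> normal_logic Ax" by (auto intro: normal_logic.mp[of p])
  with Cons show ?case by simp
qed simp

lemma taut_mp:
  "\<forall>p\<in>set ps. p \<in> normal_logic Ax \<Longrightarrow> (\<And>v. \<forall>p\<in>set ps. peval v p \<Longrightarrow> peval v q) \<Longrightarrow> q \<in> normal_logic Ax"
  by (rule mp_imps[OF normal_logic.taut]) (auto simp: peval_imps)

text \<open>Assumptions are packed into nested implications, so necessitation applies to theorems
  only and the deduction theorem \<open>derives_insert\<close> holds.\<close>

definition derives :: "pm set \<Rightarrow> pm \<Rightarrow> bool" where
  "derives S q \<longleftrightarrow> (\<exists>ps. set ps \<subseteq> S \<and> imps ps q \<in> normal_logic Ax)"

definition falsum :: pm where "falsum = PNeg (PImp (PVar 0) (PVar 0))"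

definition mcs :: "pm set \<Rightarrow> bool" where
  "mcs M \<longleftrightarrow> \<not> derives M falsum \<and> (\<forall>p. p \<in> M \<or> PNeg p \<in> M)"

lemma derives_taut:
  assumes "\<forall>q\<in>set qs. derives S q" "\<And>v. \<forall>p\<in>set qs. peval v p \<Longrightarrow> peval v q"
  shows "derives S q"
proof -
  have "\<exists>ps. set ps \<subseteq> S \<and> (\<forall>q\<in>set qs. imps ps q \<in> normal_logic Ax)" using assms(1)
  proof (induction qs)
    case Nil then show ?case by (auto intro: exI[of _ "[]"])
  next
    case (Cons a qs)
    then obtain ps ps' where ps: "set ps \<subseteq> S" "\<forall>q\<in>set qs. imps ps q \<in> normal_logic Ax" "set ps' \<subseteq> S" "imps ps' a \<in> normal_logic Ax"
      unfolding derives_def by auto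
    have "imps (ps @ ps') q \<in> normal_logic Ax" if "q \<in> set (a # qs)" for q
      using that ps by (intro taut_mp[of "[if q \<in> set qs then imps ps q else imps ps' a]"])
        (auto simp: peval_imps split: if_splits)
    with ps show ?case by (intro exI[of _ "ps @ ps'"]) auto
  qed
  then obtain ps where ps: "set ps \<subseteq> S" "\<forall>q\<in>set qs. imps ps q \<in> normal_logic Ax" by blast
  have "imps ps q \<in> normal_logic Ax"
    by (rule taut_mp[of "map (imps ps) qs"]) (use ps assms(2) in \<open>auto simp: peval_imps\<close>)
  with ps show ?thesis unfolding derives_def by blast
qed

lemma derives_in: "p \<in> S \<Longrightarrow> derives S p"
  unfolding derives_def by (intro exI[of _ "[p]"]) (auto intro: normal_logic.taut)

lemma derives_L: "p \<in> normal_logic Ax \<Longrightarrow> derives S p"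
  unfolding derives_def by (intro exI[of _ "[]"]) auto

lemma derives_insert:
  assumes "derives (insert p S) q" shows "derives S (PImp p q)"
proof -
  obtain ps where ps: "set ps \<subseteq> insert p S" "imps ps q \<in> normal_logic Ax" using assms unfolding derives_def by blast
  have "imps (filter (\<lambda>x. x \<noteq> p) ps) (PImp p q) \<in> normal_logic Ax"
    by (rule taut_mp[of "[imps ps q]"]) (use ps in \<open>auto simp: peval_imps\<close>)
  with ps(1) show ?thesis unfolding derives_def
    by (intro exI[of _ "filter (\<lambda>x. x \<noteq> p) ps"]) auto
qed

lemma lindenbaum:
  assumes "\<not> derives S falsum"
  obtains M where "mcs M" "S \<subseteq> M"
proof -
  let ?C = "{X. S \<subseteq> X \<and> \<not> derives X falsum}"
  have "\<exists>M\<in>?C. \<forall>X\<in>?C. M \<subseteq> X \<longrightarrow> X = M"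
  proof (rule subset_Zorn_nonempty)
    show "?C \<noteq> {}" using assms by blast
  next
    fix C assume C: "C \<noteq> {}" "subset.chain ?C C"
    have "\<not> derives (\<Union>C) falsum"
    proof
      assume "derives (\<Union>C) falsum"
      then obtain ps where ps: "set ps \<subseteq> \<Union>C" "imps ps falsum \<in> normal_logic Ax" unfolding derives_def by blast
      \<comment> \<open>The finitely many assumptions of a derivation already lie in one member of
        the chain.\<close>
      obtain X where "X \<in> C" "set ps \<subseteq> X"
        by (rule finite_subset_Union_chain[OF finite_set ps(1) C])
      then have "derives X falsum" using ps(2) unfolding derives_def by (intro exI[of _ ps]) simp
      moreover have "X \<in> ?C" using \<open>X \<in> C\<close> C(2) unfolding subset.chain_def by auto
      ultimately show False by simp
    qed
    moreover obtain X where "X \<in> C" using C(1) by auto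
    then have "S \<subseteq> \<Union>C" using C(2) unfolding subset.chain_def by auto
    ultimately show "\<Union>C \<in> ?C" by simp
  qed
  then obtain M where "M \<in> ?C" and max: "\<forall>X\<in>?C. M \<subseteq> X \<longrightarrow> X = M" ..
  then have M: "S \<subseteq> M" "\<not> derives M falsum" by auto
  have ins: "derives (insert q M) falsum" if "q \<notin> M" for q
    using max[THEN bspec, of "insert q M"] M(1) that by auto
  have "p \<in> M \<or> PNeg p \<in> M" for p
  proof (rule ccontr)
    assume "\<not> ?thesis"
    then have "derives (insert p M) falsum" "derives (insert (PNeg p) M) falsum"
      using ins by auto
    then have "derives M (PImp p falsum)" "derives M (PImp (PNeg p) falsum)"
      by (auto intro: derives_insert)
    then have "derives M falsum"
      by (intro derives_taut[of "[PImp p falsum, PImp (PNeg p) falsum]"]) auto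
    with M(2) show False by simp
  qed
  with M have "mcs M" unfolding mcs_def by simp
  then show ?thesis using that M(1) by blast
qed

lemma mcs_not: assumes "mcs M" shows "PNeg p \<in> M \<longleftrightarrow> p \<notin> M"
proof -
  have "\<not> (PNeg p \<in> M \<and> p \<in> M)"
  proof
    assume "PNeg p \<in> M \<and> p \<in> M"
    then have "derives M falsum"
      by (intro derives_taut[of "[p, PNeg p]"]) (auto intro: derives_in)
    with assms show False unfolding mcs_def by simp
  qed
  with assms show ?thesis unfolding mcs_def by blast
qed

lemma mcs_derives: assumes "mcs M" "derives M p" shows "p \<in> M"
proof (rule ccontr)
  assume "p \<notin> M"
  then have "PNeg p \<in> M" using assms(1) mcs_not by blast
  then have "derives M falsum" using assms(2)
    by (intro derives_taut[of "[p, PNeg p]"]) (auto intro: derives_in)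
  with assms show False unfolding mcs_def by simp
qed

lemma mcs_taut:
  "mcs M \<Longrightarrow> \<forall>p\<in>set ps. p \<in> M \<Longrightarrow> (\<And>v. \<forall>p\<in>set ps. peval v p \<Longrightarrow> peval v q) \<Longrightarrow> q \<in> M"
  by (rule mcs_derives, assumption, rule derives_taut[of ps]) (auto intro: derives_in)

lemma mcs_L: "mcs M \<Longrightarrow> p \<in> normal_logic Ax \<Longrightarrow> p \<in> M"
  by (rule mcs_derives) (auto intro: derives_L)

lemma mcs_mp: "mcs M \<Longrightarrow> PImp p q \<in> M \<Longrightarrow> p \<in> M \<Longrightarrow> q \<in> M"
  by (rule mcs_taut[of M "[PImp p q, p]"]) auto

lemma mcs_imp: assumes "mcs M" shows "PImp p q \<in> M \<longleftrightarrow> (p \<in> M \<longrightarrow> q \<in> M)"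
proof -
  have "PImp p q \<in> M" if "q \<in> M" using assms that by (intro mcs_taut[of M "[q]"]) auto
  moreover have "PImp p q \<in> M" if "PNeg p \<in> M" using assms that by (intro mcs_taut[of M "[PNeg p]"]) auto
  moreover have "q \<in> M" if "PImp p q \<in> M" "p \<in> M" using mcs_mp[OF assms that] .
  ultimately show ?thesis using mcs_not[OF assms, of p] by blast
qed

lemma mcs_and: "mcs M \<Longrightarrow> PAnd p q \<in> M \<longleftrightarrow> p \<in> M \<and> q \<in> M"
  unfolding PAnd_def by (auto simp: mcs_not mcs_imp)

lemma mcs_or: "mcs M \<Longrightarrow> POr p q \<in> M \<longleftrightarrow> p \<in> M \<or> q \<in> M"
  unfolding POr_def by (auto simp: mcs_not mcs_imp)

definition canR :: "pm set \<Rightarrow> pm set \<Rightarrow> bool" where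
  "canR M M' \<longleftrightarrow> (\<forall>p. PBox p \<in> M \<longrightarrow> p \<in> M')"

text \<open>Peeling premises off from the right makes each step one use of K: the induction
  hypothesis is applied to \<open>PImp p q\<close> with the remaining premises.\<close>

lemma box_imps: "imps ps q \<in> normal_logic Ax \<Longrightarrow> mcs M \<Longrightarrow> \<forall>p\<in>set ps. PBox p \<in> M \<Longrightarrow> PBox q \<in> M"
proof (induction ps arbitrary: q rule: rev_induct)
  case Nil then show ?case by (auto intro: mcs_L normal_logic.nec)
next
  case (snoc p ps)
  have "imps ps (PImp p q) \<in> normal_logic Ax"
    by (rule taut_mp[of "[imps (ps @ [p]) q]"]) (use snoc.prems in \<open>auto simp: peval_imps\<close>)
  then have "PBox (PImp p q) \<in> M" using snoc by auto
  then show ?case using snoc.prems mcs_mp[of M] mcs_L[OF \<open>mcs M\<close> normal_logic.K] by (meson in_set_conv_decomp)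
qed

text \<open>If the box is missing, \<open>PNeg q\<close> is consistent with everything boxed in
  \<open>M\<close>, since otherwise \<open>box_imps\<close> would box \<open>q\<close>. A maximal
  consistent extension is then a successor without \<open>q\<close>.\<close>

lemma mcs_box:
  assumes "mcs M" shows "PBox q \<in> M \<longleftrightarrow> (\<forall>M'. mcs M' \<longrightarrow> canR M M' \<longrightarrow> q \<in> M')"
proof
  show "PBox q \<in> M \<Longrightarrow> \<forall>M'. mcs M' \<longrightarrow> canR M M' \<longrightarrow> q \<in> M'" unfolding canR_def by blast
next
  assume *: "\<forall>M'. mcs M' \<longrightarrow> canR M M' \<longrightarrow> q \<in> M'"
  show "PBox q \<in> M"
  proof (rule ccontr)
    assume no: "PBox q \<notin> M"
    let ?S = "{p. PBox p \<in> M}"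
    have "\<not> derives (insert (PNeg q) ?S) falsum"
    proof
      assume "derives (insert (PNeg q) ?S) falsum"
      then have "derives ?S (PImp (PNeg q) falsum)" by (rule derives_insert)
      then have "derives ?S q"
        by (intro derives_taut[of "[PImp (PNeg q) falsum]" ?S q]) (auto simp: falsum_def)
      then show False using no box_imps[OF _ assms] unfolding derives_def by blast
    qed
    then obtain M' where "mcs M'" "insert (PNeg q) ?S \<subseteq> M'" using lindenbaum by blast
    then show False using * mcs_not unfolding canR_def by blast
  qed
qed

lemma mcs_dia:
  assumes "mcs M" shows "PDia q \<in> M \<longleftrightarrow> (\<exists>M'. mcs M' \<and> canR M M' \<and> q \<in> M')"
  unfolding PDia_def using assms mcs_box mcs_not by blast

section \<open>Filtration to finitely many clusters\<close>

text \<open>Counting the members of \<open>C\<close> properly below a set maps the chain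
  isomorphically onto an initial segment of the naturals, so levels serve as cluster numbers without
  gaps.\<close>

lemma chain_levels:
  assumes "finite C" "\<And>c d. c \<in> C \<Longrightarrow> d \<in> C \<Longrightarrow> c \<subseteq> d \<or> d \<subseteq> c"
  obtains lev :: "'b set \<Rightarrow> nat" where "lev ` C = {..<card C}"
    "\<And>c d. c \<in> C \<Longrightarrow> d \<in> C \<Longrightarrow> lev c \<le> lev d \<longleftrightarrow> c \<subseteq> d"
    "\<And>c. c \<in> C \<Longrightarrow> (\<forall>d\<in>C. c \<subseteq> d) \<Longrightarrow> lev c = 0"
proof -
  define lev where "lev c = card {d\<in>C. d \<subset> c}" for c
  have less: "lev c < lev d" if "c \<in> C" "c \<subset> d" for c d
    unfolding lev_def using that assms(1) by (intro psubset_card_mono) auto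
  have iff: "lev c \<le> lev d \<longleftrightarrow> c \<subseteq> d" if cd: "c \<in> C" "d \<in> C" for c d
  proof -
    consider "c = d" | "c \<subset> d" | "d \<subset> c" using assms(2)[OF cd] by blast
    then show ?thesis by cases (use less[OF cd(1), of d] less[OF cd(2), of c] in auto)
  qed
  have "lev c < card C" if "c \<in> C" for c
  proof -
    have "{d\<in>C. d \<subset> c} \<subset> C" using that by blast
    then show ?thesis unfolding lev_def by (rule psubset_card_mono[OF assms(1)])
  qed
  then have sub: "lev ` C \<subseteq> {..<card C}" by auto
  have "inj_on lev C"
  proof (rule inj_onI)
    fix c d assume "c \<in> C" "d \<in> C" "lev c = lev d"
    then show "c = d" using iff[of c d] iff[of d c] by auto
  qed
  then have lev: "lev ` C = {..<card C}"
    using sub by (intro card_subset_eq) (auto simp: card_image)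
  have "lev c = 0" if "\<forall>d\<in>C. c \<subseteq> d" for c
  proof -
    have "{d\<in>C. d \<subset> c} = {}" using that by blast
    then show ?thesis unfolding lev_def by (simp only: card.empty)
  qed
  then show ?thesis using that[OF lev iff] by simp
qed

text \<open>
  The part of the canonical model above a maximal consistent set refuting \<open>p\<close> is filtrated through the
  subformulas of \<open>p\<close>. The clusters of the result are indexed by the sets of boxed formulas true in
  them, which form a chain; repetitions give all clusters the same size.
\<close>

lemma finite_countermodel:
  assumes T: "ax_T \<subseteq> normal_logic Ax" and four: "ax_4 \<subseteq> normal_logic Ax"
    and conn: "\<And>M M1 M2. mcs M \<Longrightarrow> mcs M1 \<Longrightarrow> mcs M2 \<Longrightarrow> canR M M1 \<Longrightarrow> canR M M2 \<Longrightarrow>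
      canR M1 M2 \<or> canR M2 M1"
    and p: "p \<notin> normal_logic Ax"
  obtains r m where "r \<ge> 1" "m \<ge> 1" "\<And>i. i < m \<Longrightarrow> \<exists>v. \<not> fval r m v 0 i p"
    "(\<And>M M'. mcs M \<Longrightarrow> mcs M' \<Longrightarrow> canR M M' \<Longrightarrow> canR M' M) \<Longrightarrow> r = 1"
proof -
  have refl: "canR M M" if "mcs M" for M
  proof -
    have "PImp (PBox q) q \<in> M" for q
      using mcs_L[OF that] T unfolding ax_T_def by blast
    then show ?thesis unfolding canR_def using mcs_mp[OF that] by blast
  qed
  have box4: "PBox (PBox q) \<in> M" if "mcs M" "PBox q \<in> M" for M q
  proof -
    have "PImp (PBox q) (PBox (PBox q)) \<in> M"
      using mcs_L[OF that(1)] four unfolding ax_4_def by blast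
    then show ?thesis using mcs_mp[OF that(1)] that(2) by blast
  qed
  have box_mono: "PBox q \<in> M'" if "mcs M" "canR M M'" "PBox q \<in> M" for M M' q
    using box4[OF that(1,3)] that(2) unfolding canR_def by blast
  have trans: "canR M M''" if "mcs M" "canR M M'" "canR M' M''" for M M' M''
    using box_mono[OF that(1,2)] that(3) unfolding canR_def by blast
  have "\<not> derives {PNeg p} falsum"
  proof
    assume "derives {PNeg p} falsum"
    then have "derives {} (PImp (PNeg p) falsum)" by (auto intro: derives_insert)
    then have "derives {} p"
      by (intro derives_taut[of "[PImp (PNeg p) falsum]" "{}" p]) (auto simp: falsum_def)
    then show False using p unfolding derives_def by auto
  qed
  then obtain M0 where M0: "mcs M0" "PNeg p \<in> M0" using lindenbaum by blast
  define W where "W = {M. mcs M \<and> canR M0 M}"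
  define \<Gamma> where "\<Gamma> = subf p"
  define P where "P = (\<lambda>M. M \<inter> \<Gamma>) ` W"
  \<comment> \<open>Types will be compared by inclusion of their boxed content. This is transitive
    by form and linear by \<open>conn\<close>.\<close>
  define B where "B T = {q. PBox q \<in> T}" for T
  define T0 where "T0 = M0 \<inter> \<Gamma>"
  have M0W: "M0 \<in> W" unfolding W_def using M0 refl by blast
  then have T0P: "T0 \<in> P" unfolding P_def T0_def by blast
  have "P \<subseteq> Pow \<Gamma>" unfolding P_def by blast
  then have finP: "finite P" using finite_subf[of p] unfolding \<Gamma>_def by (meson finite_Pow_iff finite_subset)
  have B_mono: "B (M \<inter> \<Gamma>) \<subseteq> B (M' \<inter> \<Gamma>)" if "M \<in> W" "canR M M'" for M M'
    using that box_mono unfolding B_def W_def by blast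
  \<comment> \<open>Inclusion of boxed content is weak enough to contain the canonical relation, by
    axiom 4, and strong enough to transport \<open>q\<close>: the box passes to \<open>T'\<close>,
    and reflexivity removes it.\<close>
  have box: "PBox q \<in> T \<longleftrightarrow> (\<forall>T'\<in>P. B T \<subseteq> B T' \<longrightarrow> q \<in> T')" if "T \<in> P" "PBox q \<in> \<Gamma>" for T q
  proof -
    obtain M where M: "M \<in> W" "T = M \<inter> \<Gamma>" using \<open>T \<in> P\<close> unfolding P_def by blast
    have q: "q \<in> \<Gamma>" using that(2) subf_closed(3) unfolding \<Gamma>_def by blast
    show ?thesis
    proof
      assume *: "PBox q \<in> T"
      show "\<forall>T'\<in>P. B T \<subseteq> B T' \<longrightarrow> q \<in> T'"
      proof (intro ballI impI)
        fix T' assume "T' \<in> P" "B T \<subseteq> B T'"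
        then obtain M' where M': "M' \<in> W" "T' = M' \<inter> \<Gamma>" unfolding P_def by blast
        have "PBox q \<in> M'" using * \<open>B T \<subseteq> B T'\<close> M' unfolding B_def by blast
        then have "q \<in> M'" using M' refl unfolding W_def canR_def by blast
        then show "q \<in> T'" using M' q by blast
      qed
    next
      assume *: "\<forall>T'\<in>P. B T \<subseteq> B T' \<longrightarrow> q \<in> T'"
      have "q \<in> M'" if "mcs M'" "canR M M'" for M'
      proof -
        have "M' \<in> W" using that M trans M0 unfolding W_def by blast
        then show ?thesis using * B_mono[OF M(1) that(2)] M(2) unfolding P_def by blast
      qed
      then have "PBox q \<in> M" using mcs_box M unfolding W_def by blast
      then show "PBox q \<in> T" using M that(2) by blast
    qed
  qed
  define C where "C = B ` P"
  have finC: "finite C" using finP unfolding C_def by blast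
  have chainC: "c \<subseteq> d \<or> d \<subseteq> c" if cd: "c \<in> C" "d \<in> C" for c d
  proof -
    obtain M1 M2 where "M1 \<in> W" "M2 \<in> W" "c = B (M1 \<inter> \<Gamma>)" "d = B (M2 \<inter> \<Gamma>)"
      using cd unfolding C_def P_def by blast
    then show ?thesis using conn[OF M0(1)] B_mono unfolding W_def by blast
  qed
  obtain lev where lev: "lev ` C = {..<card C}"
    "\<And>c d. c \<in> C \<Longrightarrow> d \<in> C \<Longrightarrow> lev c \<le> lev d \<longleftrightarrow> c \<subseteq> d"
    "\<And>c. c \<in> C \<Longrightarrow> (\<forall>d\<in>C. c \<subseteq> d) \<Longrightarrow> lev c = 0"
    using chain_levels[OF finC chainC] by blast
  have T0min: "B T0 \<subseteq> d" if "d \<in> C" for d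
    using that B_mono[OF M0W] unfolding C_def P_def T0_def W_def by auto
  have BP: "B T \<in> C" if "T \<in> P" for T using that unfolding C_def by blast
  have lev0: "lev (B T0) = 0" using lev(3)[OF BP[OF T0P]] T0min by blast
  obtain h where h: "bij_betw h {0..<card P} P" using ex_bij_betw_nat_finite[OF finP] by blast
  have h_surj: "\<exists>i<card P. h i = T" if "T \<in> P" for T
  proof -
    have "T \<in> h ` {0..<card P}" using h that by (simp add: bij_betw_def)
    then show ?thesis by auto
  qed
  define cl where "cl j = {T\<in>P. lev (B T) = j}" for j
  have fail: "\<exists>v. \<not> fval (card C) (card P) v 0 i1 p" if i1: "i1 < card P" for i1
  proof -
    obtain i0 where i0: "i0 < card P" "h i0 = T0" using h_surj[OF T0P] by blast
    \<comment> \<open>A swap in the enumeration of the types puts \<open>T0\<close>, where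
      \<open>p\<close> fails, at the prescribed index \<open>i1\<close>.\<close>
    define h' where "h' i = (if i = i1 then T0 else if i = i0 then h i1 else h i)" for i
    have h': "T \<in> P \<Longrightarrow> \<exists>i<card P. h' i = T" for T
    proof -
      assume "T \<in> P"
      then obtain i where "i < card P" "h i = T" using h_surj by blast
      then consider "T = T0" | "i = i1" "i \<noteq> i0" | "i \<noteq> i1" "i \<noteq> i0" using i0(2) by metis
      then show ?thesis
      proof cases
        case 1 then show ?thesis using i1 unfolding h'_def by (intro exI[of _ i1]) simp
      next
        case 2 then show ?thesis using i0(1) \<open>h i = T\<close> unfolding h'_def by (intro exI[of _ i0]) simp
      next
        case 3 then show ?thesis using \<open>i < card P\<close> \<open>h i = T\<close> unfolding h'_def by (intro exI[of _ i]) simp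
      qed
    qed
    \<comment> \<open>All indices below \<open>card P\<close> are used in every cluster; those whose
      type belongs elsewhere repeat one fixed type of the cluster.\<close>
    define e where "e j i = (if h' i \<in> cl j then h' i else SOME T. T \<in> cl j)" for j i
    have e_in: "e j i \<in> cl j" if "j < card C" for j i
    proof -
      have "j \<in> lev ` C" using lev(1) that by auto
      then have "\<exists>T. T \<in> cl j" unfolding cl_def C_def by blast
      then show ?thesis unfolding e_def using someI_ex[of "\<lambda>T. T \<in> cl j"] by auto
    qed
    have e_surj: "\<exists>i<card P. e j i = T" if "T \<in> cl j" for j T
    proof -
      have "T \<in> P" using that unfolding cl_def by simp
      then obtain i where "i < card P" "h' i = T" using h' by blast
      then show ?thesis using that unfolding e_def by auto
    qed
    define v where "v j i n \<longleftrightarrow> PVar n \<in> e j i" for j i n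
    have truth: "fval (card C) (card P) v j i q \<longleftrightarrow> q \<in> e j i"
      if "q \<in> \<Gamma>" "j < card C" "i < card P" for q j i
      using that
    proof (induction q arbitrary: j i)
      case (PVar n) then show ?case unfolding v_def by simp
    next
      case (PNeg q)
      obtain M where M: "mcs M" "e j i = M \<inter> \<Gamma>"
        using e_in[OF PNeg.prems(2)] unfolding cl_def P_def W_def by blast
      have "q \<in> \<Gamma>" using PNeg.prems(1) subf_closed(1) unfolding \<Gamma>_def by blast
      then show ?case using PNeg mcs_not[OF M(1)] M(2) by simp
    next
      case (PImp q q')
      obtain M where M: "mcs M" "e j i = M \<inter> \<Gamma>"
        using e_in[OF PImp.prems(2)] unfolding cl_def P_def W_def by blast
      have "q \<in> \<Gamma>" "q' \<in> \<Gamma>" using PImp.prems(1) subf_closed(2) unfolding \<Gamma>_def by blast+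
      then show ?case using PImp mcs_imp[OF M(1)] M(2) by simp
    next
      case (PBox q)
      have q: "q \<in> \<Gamma>" using PBox.prems(1) subf_closed(3) unfolding \<Gamma>_def by blast
      have e: "e j i \<in> P" "lev (B (e j i)) = j" using e_in[OF PBox.prems(2)] unfolding cl_def by auto
      have "fval (card C) (card P) v j i (PBox q) \<longleftrightarrow>
        (\<forall>j'. j \<le> j' \<longrightarrow> j' < card C \<longrightarrow> (\<forall>i'<card P. q \<in> e j' i'))"
        using PBox.IH[OF q] by auto
      also have "\<dots> \<longleftrightarrow> (\<forall>T'\<in>P. B (e j i) \<subseteq> B T' \<longrightarrow> q \<in> T')"
      proof
        assume *: "\<forall>j'. j \<le> j' \<longrightarrow> j' < card C \<longrightarrow> (\<forall>i'<card P. q \<in> e j' i')"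
        show "\<forall>T'\<in>P. B (e j i) \<subseteq> B T' \<longrightarrow> q \<in> T'"
        proof (intro ballI impI)
          fix T' assume T': "T' \<in> P" "B (e j i) \<subseteq> B T'"
          let ?j = "lev (B T')"
          have "?j < card C" using lev(1) BP[OF T'(1)] by blast
          moreover have "j \<le> ?j" using lev(2)[OF BP[OF e(1)] BP[OF T'(1)]] T'(2) e(2) by simp
          moreover obtain i' where "i' < card P" "e ?j i' = T'"
            using e_surj[of T' ?j] T'(1) unfolding cl_def by blast
          ultimately show "q \<in> T'" using * by blast
        qed
      next
        assume *: "\<forall>T'\<in>P. B (e j i) \<subseteq> B T' \<longrightarrow> q \<in> T'"
        show "\<forall>j'. j \<le> j' \<longrightarrow> j' < card C \<longrightarrow> (\<forall>i'<card P. q \<in> e j' i')"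
        proof (intro allI impI)
          fix j' i' assume "j \<le> j'" "j' < card C" "i' < card P"
          have e': "e j' i' \<in> P" "lev (B (e j' i')) = j'" using e_in[OF \<open>j' < card C\<close>] unfolding cl_def by auto
          then have "B (e j i) \<subseteq> B (e j' i')" using lev(2)[OF BP[OF e(1)] BP[OF e'(1)]] e(2) \<open>j \<le> j'\<close> by simp
          then show "q \<in> e j' i'" using * e' by blast
        qed
      qed
      also have "\<dots> \<longleftrightarrow> PBox q \<in> e j i" using box[OF e(1) PBox.prems(1)] by simp
      finally show ?case .
    qed
    have "T0 \<in> cl 0" unfolding cl_def using T0P lev0 by simp
    then have "e 0 i1 = T0" unfolding e_def h'_def by simp
    moreover have "p \<notin> T0" using M0 mcs_not unfolding T0_def by blast
    moreover have "0 < card C" using finC BP[OF T0P] by (auto simp: card_gt_0_iff)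
    moreover have "p \<in> \<Gamma>" unfolding \<Gamma>_def by (rule subf_refl)
    ultimately have "\<not> fval (card C) (card P) v 0 i1 p" using truth[of p 0 i1] i1 by simp
    then show ?thesis by blast
  qed
  show ?thesis
  proof (rule that)
    show "card C \<ge> 1" using finC BP[OF T0P] by (auto simp: Suc_le_eq card_gt_0_iff)
    show "card P \<ge> 1" using finP T0P by (auto simp: Suc_le_eq card_gt_0_iff)
    show "\<exists>v. \<not> fval (card C) (card P) v 0 i p" if "i < card P" for i using fail[OF that] .
    assume sym: "\<And>M M'. mcs M \<Longrightarrow> mcs M' \<Longrightarrow> canR M M' \<Longrightarrow> canR M' M"
    \<comment> \<open>Under symmetry every world sees \<open>M0\<close> again, so its boxed content
      is contained in that of \<open>T0\<close>, which is least anyway.\<close>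
    have "c = B T0" if c: "c \<in> C" for c
    proof -
      obtain M where M: "M \<in> W" "c = B (M \<inter> \<Gamma>)" using c unfolding C_def P_def by blast
      then have "canR M M0" using sym M0 unfolding W_def by blast
      then have "c \<subseteq> B T0" using B_mono M unfolding T0_def by blast
      then show ?thesis using T0min[OF c] by blast
    qed
    then have "C = {B T0}" using BP[OF T0P] by blast
    then show "card C = 1" by simp
  qed
qed

end

section \<open>Countermodels for the two logics\<close>

lemma S4_3_countermodel:
  assumes "p \<notin> S4_3"
  obtains r m where "r \<ge> 1" "m \<ge> 1" "\<And>i. i < m \<Longrightarrow> \<exists>v. \<not> fval r m v 0 i p"
proof -
  let ?Ax = "ax_T \<union> ax_4 \<union> ax_dot3"
  have ax: "?Ax \<subseteq> normal_logic ?Ax" by (auto intro: normal_logic.ax)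
  have conn: "canR M1 M2 \<or> canR M2 M1"
    if m: "mcs ?Ax M" "mcs ?Ax M1" "mcs ?Ax M2" and R: "canR M M1" "canR M M2" for M M1 M2
  proof (rule ccontr)
    assume "\<not> ?thesis"
    then obtain a b where ab: "PBox a \<in> M1" "a \<notin> M2" "PBox b \<in> M2" "b \<notin> M1" unfolding canR_def by blast
    \<comment> \<open>Each formula boxes what the other denies, so a point satisfying one of them
      never sees the other. But .3 yields a point that does.\<close>
    let ?p = "PAnd (PBox a) (PNeg b)" and ?q = "PAnd (PBox b) (PNeg a)"
    have "?p \<in> M1" "?q \<in> M2" using ab m by (auto simp: mcs_and mcs_not)
    then have "PAnd (PDia ?p) (PDia ?q) \<in> M" using m R by (auto simp: mcs_and mcs_dia)
    moreover have "PImp (PAnd (PDia ?p) (PDia ?q))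
      (PDia (POr (PAnd ?p (PDia ?q)) (PAnd ?q (PDia ?p)))) \<in> M"
      by (rule mcs_L[OF m(1)], rule normal_logic.ax) (auto simp: ax_dot3_def)
    ultimately have "PDia (POr (PAnd ?p (PDia ?q)) (PAnd ?q (PDia ?p))) \<in> M" using mcs_mp[OF m(1)] by blast
    then obtain M3 where "mcs ?Ax M3" "POr (PAnd ?p (PDia ?q)) (PAnd ?q (PDia ?p)) \<in> M3"
      using mcs_dia[OF m(1)] by blast
    then show False by (auto simp: mcs_or mcs_and mcs_dia mcs_not canR_def)
  qed
  have TL: "ax_T \<subseteq> normal_logic ?Ax" "ax_4 \<subseteq> normal_logic ?Ax" using ax by auto
  show ?thesis
    by (rule finite_countermodel[of ?Ax p, OF TL conn])
      (use assms that in \<open>auto simp: S4_3_def\<close>)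
qed

lemma S5_countermodel:
  assumes "p \<notin> S5"
  obtains m where "m \<ge> 1" "\<And>i. i < m \<Longrightarrow> \<exists>v. \<not> fval 1 m v 0 i p"
proof -
  let ?Ax = "ax_T \<union> ax_4 \<union> ax_5"
  have ax: "?Ax \<subseteq> normal_logic ?Ax" by (auto intro: normal_logic.ax)
  have eucl: "canR M1 M2"
    if m: "mcs ?Ax M" "mcs ?Ax M1" "mcs ?Ax M2" and R: "canR M M1" "canR M M2" for M M1 M2
    unfolding canR_def
  proof (intro allI impI, rule ccontr)
    fix a assume a: "PBox a \<in> M1" "a \<notin> M2"
    then have "PDia (PNeg a) \<in> M" using m R by (auto simp: mcs_dia mcs_not)
    moreover have "PImp (PDia (PNeg a)) (PBox (PDia (PNeg a))) \<in> M"
      by (rule mcs_L[OF m(1)], rule normal_logic.ax) (auto simp: ax_5_def)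
    ultimately have "PBox (PDia (PNeg a)) \<in> M" using mcs_mp[OF m(1)] by blast
    then have "PDia (PNeg a) \<in> M1" using R unfolding canR_def by blast
    then show False using m a by (auto simp: mcs_dia mcs_not canR_def)
  qed
  have refl: "canR M M" if "mcs ?Ax M" for M
  proof -
    have "PImp (PBox q) q \<in> M" for q
      by (rule mcs_L[OF that], rule normal_logic.ax) (auto simp: ax_T_def)
    then show ?thesis unfolding canR_def using mcs_mp[OF that] by blast
  qed
  \<comment> \<open>\<open>M\<close> sees both \<open>M'\<close> and itself, so euclideanness leads
    from \<open>M'\<close> back to \<open>M\<close>.\<close>
  have sym: "canR M' M" if "mcs ?Ax M" "mcs ?Ax M'" "canR M M'" for M M'
    using eucl[OF that(1,2,1,3) refl[OF that(1)]] .
  have TL: "ax_T \<subseteq> normal_logic ?Ax" "ax_4 \<subseteq> normal_logic ?Ax" using ax by auto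
  have conn: "canR M1 M2 \<or> canR M2 M1"
    if "mcs ?Ax M" "mcs ?Ax M1" "mcs ?Ax M2" "canR M M1" "canR M M2" for M M1 M2
    using eucl[OF that] ..
  show ?thesis
  proof (rule finite_countermodel[of ?Ax p, OF TL conn])
    show "p \<notin> normal_logic ?Ax" using assms unfolding S5_def .
    fix r m
    assume m: "m \<ge> 1" "\<And>i. i < m \<Longrightarrow> \<exists>v. \<not> fval r m v 0 i p"
      and r: "(\<And>M M'. mcs ?Ax M \<Longrightarrow> mcs ?Ax M' \<Longrightarrow> canR M M' \<Longrightarrow> canR M' M) \<Longrightarrow> r = 1"
    have "r = 1" by (rule r) (rule sym)
    then show ?thesis using that[of m] m by simp
  qed
qed

text \<open>The substituted formulas act as propositional atoms with arbitrary truth values at the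
  worlds. Hence the domains, parameters and inner modalities have no influence, and one argument
  gives the lower bound for all languages.\<close>

lemma S4_3_sound:
  assumes refl: "\<And>w. w \<in> W \<Longrightarrow> R w w"
    and trans: "\<And>u v w. R u v \<Longrightarrow> R v w \<Longrightarrow> R u w"
    and conn: "\<And>u v w. R u v \<Longrightarrow> R u w \<Longrightarrow> R v w \<or> R w v"
    and W: "\<And>u v. R u v \<Longrightarrow> v \<in> W"
    and p: "p \<in> S4_3" and w: "w \<in> W"
  shows "sat E D R w s (instantiate \<sigma> p)"
  using p w unfolding S4_3_def
proof (induction arbitrary: w rule: normal_logic.induct)
  case (taut p)
  have "peval (\<lambda>q. sat E D R w s (instantiate \<sigma> q)) q = sat E D R w s (instantiate \<sigma> q)" for q
    by (induction q) auto
  then show ?case using taut by blast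
next
  case (ax p)
  then consider q where "p = PImp (PBox q) q" | q where "p = PImp (PBox q) (PBox (PBox q))"
    | q q' where "p = PImp (PAnd (PDia q) (PDia q')) (PDia (POr (PAnd q (PDia q')) (PAnd q' (PDia q))))"
    unfolding ax_T_def ax_4_def ax_dot3_def by blast
  then show ?case
  proof cases
    case 1 then show ?thesis using refl[OF ax.prems] by simp
  next
    case 2 then show ?thesis using trans by auto
  next
    case 3
    have "\<exists>u. R w u \<and> (sat E D R u s (instantiate \<sigma> q) \<and> (\<exists>v. R u v \<and> sat E D R v s (instantiate \<sigma> q')) \<or>
        sat E D R u s (instantiate \<sigma> q') \<and> (\<exists>v. R u v \<and> sat E D R v s (instantiate \<sigma> q)))"
      if "R w u" "sat E D R u s (instantiate \<sigma> q)" "R w v" "sat E D R v s (instantiate \<sigma> q')" for u v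
      using conn[OF that(1,3)] that by blast
    then show ?thesis unfolding 3 PAnd_def POr_def PDia_def by simp blast
  qed
next
  case (nec p) then show ?case using W by auto
qed auto


section \<open>Set theory in a model of ZFC\<close>

context zfc_model
begin

text \<open>The whole model is viewed as a Kripke structure with a single world. All elements may be
  parameters, and the formulas are modal-free as the axiom schemes demand.\<close>

abbreviation D :: "nat \<Rightarrow> ((nat \<Rightarrow> 'a) \<Rightarrow> bool) \<Rightarrow> bool" where
  "D k P \<equiv> Dfn E (\<lambda>_::unit. UNIV) (=) UNIV True UNIV k (\<lambda>_. P)"

abbreviation T :: "nat \<Rightarrow> ((nat \<Rightarrow> 'a) \<Rightarrow> 'a) \<Rightarrow> bool" where
  "T \<equiv> Trm UNIV"

lemma D_all: "D (Suc k) (\<lambda>s. P (s 0) (\<lambda>n. s (Suc n))) \<Longrightarrow> D k (\<lambda>s. \<forall>x. P x s)"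
  using Dfn_ball[of E "\<lambda>_::unit. UNIV" "(=)" UNIV True UNIV k "\<lambda>_. P"] by simp

lemma D_ex: "D (Suc k) (\<lambda>s. P (s 0) (\<lambda>n. s (Suc n))) \<Longrightarrow> D k (\<lambda>s. \<exists>x. P x s)"
  using Dfn_bex[of E "\<lambda>_::unit. UNIV" "(=)" UNIV True UNIV k "\<lambda>_. P"] by simp

lemma D_ex1:
  assumes "D (Suc k) (\<lambda>s. P (s 0) (\<lambda>n. s (Suc n)))"
    and "D (Suc (Suc k)) (\<lambda>s. P (s 0) (\<lambda>n. s (Suc (Suc n))))"
  shows "D k (\<lambda>s. \<exists>!x. P x s)"
  unfolding Ex1_def
  by (intro D_ex D_all Dfn_and Dfn_imp Dfn_eq Trm_var assms) auto

lemmas D_basic = Dfn_and Dfn_or Dfn_imp Dfn_iff Dfn_not D_all D_ex D_ex1 Dfn_mem Dfn_eq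
  Trm_var Trm_const[OF UNIV_I] Trm_shift

lemma D_subst1:
  assumes "D 1 (\<lambda>s. P (s 0))" "T k t"
  shows "D k (\<lambda>s. P (t s))"
proof -
  have "D k (\<lambda>s. \<exists>x. x = t s \<and> P x)"
    by (intro D_basic Dfn_weaken[OF assms(1)] assms(2)) auto
  then show ?thesis by simp
qed

lemma D_subst2:
  assumes "D 2 (\<lambda>s. P (s 0) (s 1))" "T k t" "T k u"
  shows "D k (\<lambda>s. P (t s) (u s))"
proof -
  have "D (Suc (Suc k)) (\<lambda>s. P (s 0) (s (Suc 0)))"
    using Dfn_weaken[OF assms(1), of "Suc (Suc k)"] by simp
  then have "D k (\<lambda>s. \<exists>y. y = u s \<and> (\<exists>x. x = t s \<and> P x y))"
    by (intro D_basic assms(2,3)) auto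
  then show ?thesis by simp
qed

lemma D_empty: "T k t \<Longrightarrow> D k (\<lambda>s. is_empty E (t s))"
  unfolding is_empty_def by (intro D_basic; simp)

lemma D_sub: "T k t \<Longrightarrow> T k u \<Longrightarrow> D k (\<lambda>s. sub E (t s) (u s))"
  unfolding sub_def by (intro D_basic; simp)

lemma D_succ: "T k t \<Longrightarrow> T k u \<Longrightarrow> D k (\<lambda>s. is_succ E (t s) (u s))"
  unfolding is_succ_def by (intro D_basic; simp)

lemma D_pair: "T k t \<Longrightarrow> T k u \<Longrightarrow> T k v \<Longrightarrow> D k (\<lambda>s. is_pair E (t s) (u s) (v s))"
  unfolding is_pair_def by (intro D_basic; simp)

lemma D_ord: "T k t \<Longrightarrow> D k (\<lambda>s. is_ord E (t s))"
  unfolding is_ord_def trans_set_def by (intro D_basic D_sub; simp)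

lemma D_ord_le: "T k t \<Longrightarrow> T k u \<Longrightarrow> D k (\<lambda>s. ord_le E (t s) (u s))"
  unfolding ord_le_def by (intro D_basic; simp)

lemma D_maps: "T k t \<Longrightarrow> T k u \<Longrightarrow> T k v \<Longrightarrow> D k (\<lambda>s. maps E (t s) (u s) (v s))"
  unfolding maps_def by (intro D_basic D_pair; simp)

lemmas D_intros = D_basic D_empty D_sub D_succ D_pair D_ord D_ord_le D_maps

section \<open>Sets given by definable conditions\<close>

definition small :: "('a \<Rightarrow> bool) \<Rightarrow> bool" where
  "small P \<longleftrightarrow> (\<exists>a. \<forall>x. E x a \<longleftrightarrow> P x)"

definition coll :: "('a \<Rightarrow> bool) \<Rightarrow> 'a" where
  "coll P = (THE a. \<forall>x. E x a \<longleftrightarrow> P x)"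

lemma ext: "(\<And>z. E z x \<longleftrightarrow> E z y) \<Longrightarrow> x = y"
  using extensionality by blast

lemma mem_coll: assumes "small P" shows "E x (coll P) \<longleftrightarrow> P x"
proof -
  obtain a where a: "\<forall>x. E x a \<longleftrightarrow> P x" using assms unfolding small_def ..
  have "coll P = a" unfolding coll_def
    by (rule the_equality) (use a in \<open>auto intro: ext\<close>)
  then show ?thesis using a by simp
qed

lemma sep:
  assumes "D 1 (\<lambda>s. P (s 0))" "\<And>x. P x \<Longrightarrow> E x a"
  shows "small P"
proof -
  obtain \<phi> where \<phi>: "modal_free \<phi>" "\<And>s. sat E (\<lambda>_::unit. UNIV) (=) () s \<phi> = P (s 0)"
    using assms(1) unfolding Dfn_def by auto
  obtain b where "\<forall>x. E x b \<longleftrightarrow> E x a \<and> fo_sat E UNIV ((\<lambda>_. a)(0 := x)) \<phi>"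
    using separation \<phi>(1) by blast
  then have "\<forall>x. E x b \<longleftrightarrow> P x" using assms(2) \<phi>(2) unfolding fo_sat_def by auto
  then show ?thesis unfolding small_def ..
qed

lemma repl:
  assumes "D 2 (\<lambda>s. P (s 0) (s 1))" "\<And>x. E x a \<Longrightarrow> \<exists>!y. P x y"
  shows "small (\<lambda>y. \<exists>x. E x a \<and> P x y)"
proof -
  obtain \<phi> where \<phi>: "modal_free \<phi>" "\<And>s. sat E (\<lambda>_::unit. UNIV) (=) () s \<phi> = P (s 0) (s 1)"
    using assms(1) unfolding Dfn_def by auto
  have eq: "fo_sat E UNIV ((\<lambda>_. a)(0 := x, 1 := y)) \<phi> = P x y" for x y
    using \<phi>(2) unfolding fo_sat_def by simp
  have "(\<forall>x. E x a \<longrightarrow> (\<exists>!y. fo_sat E UNIV ((\<lambda>_. a)(0 := x, 1 := y)) \<phi>)) \<longrightarrow>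
      (\<exists>b. \<forall>y. E y b \<longleftrightarrow> (\<exists>x. E x a \<and> fo_sat E UNIV ((\<lambda>_. a)(0 := x, 1 := y)) \<phi>))"
    using replacement \<phi>(1) by blast
  then show ?thesis unfolding eq small_def using assms(2) by blast
qed

lemma small_Union: "small (\<lambda>z. \<exists>x. E x a \<and> E z x)"
  unfolding small_def using union by blast

lemma small_Un: "small (\<lambda>z. E z x \<or> E z y)"
proof -
  obtain a where a: "\<forall>z. E z a \<longleftrightarrow> z = x \<or> z = y" using pairing by blast
  have "small (\<lambda>z. \<exists>x. E x a \<and> E z x)" by (rule small_Union)
  then show ?thesis using a by (auto simp: small_def)
qed

lemma small_insert: "small (\<lambda>z. E z x \<or> z = y)"
proof -
  obtain a where a: "\<forall>z. E z a \<longleftrightarrow> z = y \<or> z = y" using pairing by blast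
  have "small (\<lambda>z. E z x \<or> E z a)" by (rule small_Un)
  then show ?thesis using a by simp
qed

lemma empty_exists: "\<exists>e. is_empty E e"
  using infinity by blast

lemma is_empty_unique: "is_empty E x \<Longrightarrow> is_empty E y \<Longrightarrow> x = y"
  unfolding is_empty_def by (auto intro: ext)

lemma ord_pair_exists: "\<exists>p. is_pair E p x y"
proof -
  obtain a where a: "\<forall>z. E z a \<longleftrightarrow> z = x \<or> z = x" using pairing by blast
  obtain b where b: "\<forall>z. E z b \<longleftrightarrow> z = x \<or> z = y" using pairing by blast
  obtain p where p: "\<forall>z. E z p \<longleftrightarrow> z = a \<or> z = b" using pairing by blast
  have "z = a \<longleftrightarrow> (\<forall>u. E u z \<longleftrightarrow> u = x)" for z using a ext[of z a] by auto
  moreover have "z = b \<longleftrightarrow> (\<forall>u. E u z \<longleftrightarrow> u = x \<or> u = y)" for z using b ext[of z b] by auto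
  ultimately show ?thesis using p unfolding is_pair_def by auto
qed

lemma is_pair_unique: "is_pair E p x y \<Longrightarrow> is_pair E q x y \<Longrightarrow> p = q"
  unfolding is_pair_def by (rule ext) simp

lemma is_pair_inject:
  assumes "is_pair E p x y" "is_pair E p x' y'"
  shows "x = x' \<and> y = y'"
proof -
  obtain a where a: "\<forall>z. E z a \<longleftrightarrow> z = x \<or> z = x" using pairing by blast
  obtain b where b: "\<forall>z. E z b \<longleftrightarrow> z = x \<or> z = y" using pairing by blast
  obtain b' where b': "\<forall>z. E z b' \<longleftrightarrow> z = x' \<or> z = y'" using pairing by blast
  have "E a p" using assms(1) a unfolding is_pair_def by auto
  then have "x = x'" using assms(2) a unfolding is_pair_def by metis
  moreover have "E b p" using assms(1) b unfolding is_pair_def by auto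
  then have *: "(\<forall>u. E u b \<longleftrightarrow> u = x') \<or> (\<forall>u. E u b \<longleftrightarrow> u = x' \<or> u = y')"
    using assms(2) unfolding is_pair_def by blast
  have "E b' p" using assms(2) b' unfolding is_pair_def by auto
  then have "(\<forall>u. E u b' \<longleftrightarrow> u = x) \<or> (\<forall>u. E u b' \<longleftrightarrow> u = x \<or> u = y)"
    using assms(1) unfolding is_pair_def by blast
  with * b b' \<open>x = x'\<close> have "y = y'" by metis
  ultimately show ?thesis ..
qed

subsection \<open>Ordinals\<close>

lemma not_mem_self: "\<not> E x x"
proof
  assume "E x x"
  obtain a where a: "\<forall>z. E z a \<longleftrightarrow> z = x \<or> z = x" using pairing by blast
  then show False using foundation[rule_format, of a] \<open>E x x\<close> by auto
qed

lemma ord_elem: "is_ord E x \<Longrightarrow> E y x \<Longrightarrow> is_ord E y"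
  unfolding is_ord_def trans_set_def sub_def by blast

lemma ord_trans: "is_ord E z \<Longrightarrow> E x y \<Longrightarrow> E y z \<Longrightarrow> E x z"
  unfolding is_ord_def trans_set_def sub_def by blast

text \<open>\<open>E\<close> need not be well-founded from outside. Least elements come from
  foundation applied to a separated set, so \<open>P\<close> must be definable, here and in every
  ordinal induction.\<close>

lemma ord_least:
  assumes P: "D 1 (\<lambda>s. P (s 0))" and x: "is_ord E x" "P x"
  obtains z where "is_ord E z" "P z" "ord_le E z x" "\<And>y. E y z \<Longrightarrow> \<not> P y"
proof (cases "\<exists>y. E y x \<and> P y")
  case False
  then show ?thesis using that[of x] x unfolding ord_le_def by blast
next
  case True
  have "small (\<lambda>y. E y x \<and> P y)"
    by (rule sep[of _ x], (intro D_basic P; simp), simp)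
  then obtain a where a: "\<forall>y. E y a \<longleftrightarrow> E y x \<and> P y" unfolding small_def ..
  then obtain z where z: "E z a" "\<not> (\<exists>y. E y z \<and> E y a)" using foundation[rule_format, of a] True by blast
  then have "E z x" "P z" using a by auto
  moreover have "\<not> P y" if "E y z" for y using that z(2) a ord_trans[OF x(1) that \<open>E z x\<close>] by blast
  ultimately show ?thesis using that[of z] ord_elem[OF x(1)] unfolding ord_le_def by blast
qed

lemma ord_induct:
  assumes P: "D 1 (\<lambda>s. P (s 0))"
    and step: "\<And>x. is_ord E x \<Longrightarrow> (\<And>y. E y x \<Longrightarrow> P y) \<Longrightarrow> P x"
    and x: "is_ord E x"
  shows "P x"
proof (rule ccontr)
  assume "\<not> P x"
  with ord_least[OF Dfn_not[OF P] x] obtain z where "is_ord E z" "\<not> P z" "\<And>y. E y z \<Longrightarrow> P y" by auto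
  then show False using step by blast
qed

text \<open>Double induction: if \<open>x\<close> and \<open>y\<close> are incomparable but their
  elements are comparable with the other side, then each element of one belongs to the other, and
  extensionality makes them equal.\<close>

lemma ord_linear:
  assumes x: "is_ord E x" and y: "is_ord E y"
  shows "E x y \<or> x = y \<or> E y x"
proof -
  have "\<forall>y. is_ord E y \<longrightarrow> E x y \<or> x = y \<or> E y x"
  proof (rule ord_induct[OF _ _ x])
    show "D 1 (\<lambda>s. \<forall>y. is_ord E y \<longrightarrow> E (s 0) y \<or> s 0 = y \<or> E y (s 0))"
      by (intro D_intros; simp)
    fix x assume x: "is_ord E x"
      and IH: "\<And>z. E z x \<Longrightarrow> \<forall>y. is_ord E y \<longrightarrow> E z y \<or> z = y \<or> E y z"
    show "\<forall>y. is_ord E y \<longrightarrow> E x y \<or> x = y \<or> E y x"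
    proof (intro allI impI)
      fix y assume y: "is_ord E y"
      show "E x y \<or> x = y \<or> E y x"
      proof (rule ord_induct[OF _ _ y])
        show "D 1 (\<lambda>s. E x (s 0) \<or> x = s 0 \<or> E (s 0) x)" by (intro D_intros; simp)
        fix y assume y: "is_ord E y" and IH': "\<And>z. E z y \<Longrightarrow> E x z \<or> x = z \<or> E z x"
        show "E x y \<or> x = y \<or> E y x"
        proof (rule ccontr)
          assume no: "\<not> ?thesis"
          have "E z y" if "E z x" for z
            using IH[OF that] y no ord_trans[OF x _ that] that by blast
          moreover have "E z x" if "E z y" for z
            using IH'[OF that] no ord_trans[OF y _ that] that by blast
          ultimately have "x = y" by (intro ext) blast
          with no show False by blast
        qed
      qed
    qed
  qed
  with y show ?thesis by blast
qed

lemma ord_le_refl: "ord_le E x x" unfolding ord_le_def by simp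

lemma ord_le_trans: "is_ord E z \<Longrightarrow> ord_le E x y \<Longrightarrow> ord_le E y z \<Longrightarrow> ord_le E x z"
  unfolding ord_le_def using ord_trans by blast

lemma ord_less_le_trans: "is_ord E z \<Longrightarrow> E x y \<Longrightarrow> ord_le E y z \<Longrightarrow> E x z"
  unfolding ord_le_def using ord_trans by blast

lemma ord_le_less_trans: "is_ord E z \<Longrightarrow> ord_le E x y \<Longrightarrow> E y z \<Longrightarrow> E x z"
  unfolding ord_le_def using ord_trans by blast

lemma ord_le_linear: "is_ord E x \<Longrightarrow> is_ord E y \<Longrightarrow> ord_le E x y \<or> E y x"
  unfolding ord_le_def using ord_linear by blast

lemma ord_not_le: "is_ord E x \<Longrightarrow> ord_le E x y \<Longrightarrow> \<not> E y x"
  unfolding ord_le_def using ord_trans not_mem_self by blast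

lemma ord_sub: "is_ord E x \<Longrightarrow> is_ord E y \<Longrightarrow> sub E x y \<longleftrightarrow> ord_le E x y"
  using ord_le_linear[of x y] not_mem_self ord_trans[of y] unfolding sub_def ord_le_def by blast

lemma is_succ_exists: "\<exists>y. is_succ E x y"
  using small_insert[of x x] unfolding is_succ_def small_def .

lemma is_succ_unique: "is_succ E x y \<Longrightarrow> is_succ E x z \<Longrightarrow> y = z"
  unfolding is_succ_def by (rule ext) simp

lemma ord_succ: "is_ord E x \<Longrightarrow> is_succ E x y \<Longrightarrow> is_ord E y"
  unfolding is_ord_def trans_set_def is_succ_def sub_def by blast

lemma ord_trans_set: "trans_set E x \<Longrightarrow> (\<And>y. E y x \<Longrightarrow> is_ord E y) \<Longrightarrow> is_ord E x"
  unfolding is_ord_def by blast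

lemma ord_Union:
  assumes "\<And>x. E x a \<Longrightarrow> is_ord E x"
  obtains b where "is_ord E b" "\<And>x. E x b \<longleftrightarrow> (\<exists>y. E y a \<and> E x y)"
proof -
  obtain b where b: "\<And>x. E x b \<longleftrightarrow> (\<exists>y. E y a \<and> E x y)" using union by blast
  have "is_ord E b"
  proof (rule ord_trans_set)
    show "trans_set E b" unfolding trans_set_def sub_def using b assms ord_trans by blast
    show "is_ord E x" if "E x b" for x using that b assms ord_elem by blast
  qed
  then show ?thesis using b that by blast
qed

lemma ord_strict_bound:
  assumes "\<And>x. E x a \<Longrightarrow> is_ord E x"
  obtains b where "is_ord E b" "\<And>x. E x a \<Longrightarrow> E x b"
proof -
  obtain c where c: "is_ord E c" "\<And>x. E x c \<longleftrightarrow> (\<exists>y. E y a \<and> E x y)" using ord_Union assms by blast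
  obtain b where b: "is_succ E c b" using is_succ_exists by blast
  have "E x b" if "E x a" for x
  proof -
    have "sub E x c" using c(2) that unfolding sub_def by blast
    then show ?thesis using ord_sub[OF assms[OF that] c(1)] b unfolding is_succ_def ord_le_def by blast
  qed
  then show ?thesis using that ord_succ[OF c(1) b] by blast
qed

text \<open>The set \<open>I\<close> from infinity may contain other things than ordinals. Without
  limits every ordinal would be 0 or a successor and thus in \<open>I\<close>. The ordinals would
  form a set, and a strict bound of it would be an ordinal belonging to itself.\<close>

lemma limit_exists:
  "\<exists>l. is_ord E l \<and> \<not> is_empty E l \<and> (\<forall>x. E x l \<longrightarrow> (\<exists>y. E y l \<and> E x y))"
proof (rule ccontr)
  assume "\<not> ?thesis"
  then have no: "is_empty E x \<or> (\<exists>y. E y x \<and> (\<forall>z. E z x \<longrightarrow> \<not> E y z))" if "is_ord E x" for x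
    using that by blast
  obtain I where I: "\<exists>e. is_empty E e \<and> E e I" "\<forall>x. E x I \<longrightarrow> (\<exists>y. is_succ E x y \<and> E y I)"
    using infinity by blast
  have all: "E x I" if "is_ord E x" for x
  proof (rule ord_induct[OF _ _ that])
    show "D 1 (\<lambda>s. E (s 0) I)" by (intro D_intros; simp)
    fix x assume x: "is_ord E x" and IH: "\<And>y. E y x \<Longrightarrow> E y I"
    show "E x I"
    proof (cases "is_empty E x")
      case True then show ?thesis using I(1) is_empty_unique by blast
    next
      case False
      then obtain y where y: "E y x" "\<And>z. E z x \<Longrightarrow> \<not> E y z" using no[OF x] by blast
      have "is_succ E y x"
        unfolding is_succ_def
      proof
        fix z show "E z x \<longleftrightarrow> E z y \<or> z = y"
          using y ord_linear[OF ord_elem[OF x], of z y] ord_elem[OF x y(1)] ord_trans[OF x _ y(1)] by blast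
      qed
      then show ?thesis using I(2) IH[OF y(1)] is_succ_unique by blast
    qed
  qed
  have "small (\<lambda>x. is_ord E x)"
    by (rule sep[of _ I]) (use all in \<open>auto intro!: D_intros\<close>)
  then obtain o' where o': "\<And>x. E x o' \<longleftrightarrow> is_ord E x" unfolding small_def by blast
  obtain b where "is_ord E b" "\<And>x. E x o' \<Longrightarrow> E x b" using ord_strict_bound[of o'] o' by blast
  then show False using o' not_mem_self by blast
qed


subsection \<open>Recursion on the ordinals\<close>

text \<open>\<open>G\<close> receives the set of earlier values instead of the function on the
  predecessors, which is enough for the hierarchy, for transitive sets and for increasing sequences.
  Elements of \<open>f\<close> that are not pairs are tolerated, since only \<open>maps\<close> is
  consulted.\<close>

definition attempt :: "('a \<Rightarrow> 'a) \<Rightarrow> 'a \<Rightarrow> 'a \<Rightarrow> bool" where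
  "attempt G \<beta> f \<longleftrightarrow> (\<forall>\<alpha>. ord_le E \<alpha> \<beta> \<longrightarrow> (\<exists>!v. maps E f \<alpha> v)) \<and>
    (\<forall>\<alpha> v. maps E f \<alpha> v \<longrightarrow> ord_le E \<alpha> \<beta> \<and>
      (\<exists>r. (\<forall>y. E y r \<longleftrightarrow> (\<exists>\<gamma>. E \<gamma> \<alpha> \<and> maps E f \<gamma> y)) \<and> v = G r))"

definition reaches :: "('a \<Rightarrow> 'a) \<Rightarrow> 'a \<Rightarrow> 'a \<Rightarrow> bool" where
  "reaches G \<alpha> v \<longleftrightarrow> (\<exists>f. attempt G \<alpha> f \<and> maps E f \<alpha> v)"

lemma D_attempt:
  assumes "D 2 (\<lambda>s. s 1 = G (s 0))" "T k t" "T k u"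
  shows "D k (\<lambda>s. attempt G (t s) (u s))"
  unfolding attempt_def
  by (intro D_intros D_subst2[of "\<lambda>x y. y = G x", OF assms(1)] assms(2,3); simp)

lemma D_reaches:
  assumes "D 2 (\<lambda>s. s 1 = G (s 0))" "T k t" "T k u"
  shows "D k (\<lambda>s. reaches G (t s) (u s))"
  unfolding reaches_def by (intro D_intros D_attempt[OF assms(1)] assms(2,3); simp)

lemma attempt_unique:
  assumes \<beta>: "is_ord E \<beta>" "attempt G \<beta> f" and \<beta>': "is_ord E \<beta>'" "attempt G \<beta>' f'"
    and "is_ord E \<alpha>" "maps E f \<alpha> v" "maps E f' \<alpha> v'"
  shows "v = v'"
proof -
  have "\<forall>v v'. maps E f \<alpha> v \<longrightarrow> maps E f' \<alpha> v' \<longrightarrow> v = v'"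
  proof (rule ord_induct[OF _ _ \<open>is_ord E \<alpha>\<close>])
    show "D 1 (\<lambda>s. \<forall>v v'. maps E f (s 0) v \<longrightarrow> maps E f' (s 0) v' \<longrightarrow> v = v')"
      by (intro D_intros; simp)
    fix \<alpha> assume IH: "\<And>\<gamma>. E \<gamma> \<alpha> \<Longrightarrow> \<forall>v v'. maps E f \<gamma> v \<longrightarrow> maps E f' \<gamma> v' \<longrightarrow> v = v'"
    show "\<forall>v v'. maps E f \<alpha> v \<longrightarrow> maps E f' \<alpha> v' \<longrightarrow> v = v'"
    proof (intro allI impI)
      fix v v' assume v: "maps E f \<alpha> v" and v': "maps E f' \<alpha> v'"
      obtain r where r: "\<And>y. E y r \<longleftrightarrow> (\<exists>\<gamma>. E \<gamma> \<alpha> \<and> maps E f \<gamma> y)" "v = G r" "ord_le E \<alpha> \<beta>"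
        using v \<beta>(2) unfolding attempt_def by blast
      obtain r' where r': "\<And>y. E y r' \<longleftrightarrow> (\<exists>\<gamma>. E \<gamma> \<alpha> \<and> maps E f' \<gamma> y)" "v' = G r'" "ord_le E \<alpha> \<beta>'"
        using v' \<beta>'(2) unfolding attempt_def by blast
      have "maps E f \<gamma> y \<longleftrightarrow> maps E f' \<gamma> y" if "E \<gamma> \<alpha>" for \<gamma> y
      proof -
        have "ord_le E \<gamma> \<beta>" "ord_le E \<gamma> \<beta>'"
          using ord_less_le_trans[OF \<beta>(1) that r(3)] ord_less_le_trans[OF \<beta>'(1) that r'(3)]
          unfolding ord_le_def by auto
        then obtain z z' where "maps E f \<gamma> z" "maps E f' \<gamma> z'"
          using \<beta>(2) \<beta>'(2) unfolding attempt_def by metis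
        then show ?thesis using IH[OF that] by metis
      qed
      then have "r = r'" using r(1) r'(1) by (intro ext) metis
      then show "v = v'" using r r' by simp
    qed
  qed
  then show ?thesis using assms(6,7) by blast
qed

lemma reaches_unique:
  "is_ord E \<alpha> \<Longrightarrow> reaches G \<alpha> v \<Longrightarrow> reaches G \<alpha> v' \<Longrightarrow> v = v'"
  unfolding reaches_def using attempt_unique by blast

lemma attempt_reaches:
  assumes DG: "D 2 (\<lambda>s. s 1 = G (s 0))" and \<beta>: "is_ord E \<beta>" "attempt G \<beta> f" and "maps E f \<alpha> v"
    and ex: "\<exists>v. reaches G \<alpha> v"
  shows "reaches G \<alpha> v"
proof -
  obtain g w where g: "attempt G \<alpha> g" "maps E g \<alpha> w" using ex unfolding reaches_def by blast
  have "ord_le E \<alpha> \<beta>" using \<beta>(2) assms(4) unfolding attempt_def by blast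
  then have "is_ord E \<alpha>" using \<beta>(1) ord_elem unfolding ord_le_def by blast
  then have "v = w" using attempt_unique[OF \<beta> _ g(1) _ assms(4) g(2)] by blast
  then show ?thesis using g unfolding reaches_def by blast
qed

text \<open>Below \<beta> the values exist and are unique, so replacement collects both the set
  \<open>r\<close> of values and the set \<open>g\<close> of pairs. Adding the pair of \<beta> and
  \<open>G r\<close> to \<open>g\<close> gives an attempt at \<beta>.\<close>

lemma reaches_exists:
  assumes DG: "D 2 (\<lambda>s. s 1 = G (s 0))" and "is_ord E \<beta>"
  shows "\<exists>v. reaches G \<beta> v"
proof (rule ord_induct[OF _ _ assms(2)])
  show "D 1 (\<lambda>s. \<exists>v. reaches G (s 0) v)" by (intro D_intros D_reaches[OF DG]; simp)
  fix \<beta> assume \<beta>: "is_ord E \<beta>" and IH: "\<And>\<gamma>. E \<gamma> \<beta> \<Longrightarrow> \<exists>v. reaches G \<gamma> v"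
  have ord: "is_ord E \<gamma>" if "E \<gamma> \<beta>" for \<gamma> using ord_elem[OF \<beta> that] .
  have ex1: "\<exists>!v. reaches G \<gamma> v" if "E \<gamma> \<beta>" for \<gamma>
    using IH[OF that] reaches_unique[OF ord[OF that]] by blast
  have "small (\<lambda>y. \<exists>\<gamma>. E \<gamma> \<beta> \<and> reaches G \<gamma> y)"
    by (rule repl) (intro D_intros D_reaches[OF DG] ex1; simp)+
  then obtain r where r: "\<And>y. E y r \<longleftrightarrow> (\<exists>\<gamma>. E \<gamma> \<beta> \<and> reaches G \<gamma> y)" unfolding small_def by blast
  have "small (\<lambda>p. \<exists>\<gamma>. E \<gamma> \<beta> \<and> (\<exists>v. reaches G \<gamma> v \<and> is_pair E p \<gamma> v))"
  proof (rule repl)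
    show "D 2 (\<lambda>s. \<exists>v. reaches G (s 0) v \<and> is_pair E (s 1) (s 0) v)"
      by (intro D_intros D_reaches[OF DG]; simp)
    fix \<gamma> assume "E \<gamma> \<beta>"
    then obtain v where v: "reaches G \<gamma> v" "\<And>w. reaches G \<gamma> w \<Longrightarrow> w = v" using ex1 by blast
    obtain p where "is_pair E p \<gamma> v" using ord_pair_exists by blast
    then show "\<exists>!p. \<exists>v. reaches G \<gamma> v \<and> is_pair E p \<gamma> v" using v is_pair_unique by metis
  qed
  then obtain g where g: "\<And>p. E p g \<longleftrightarrow> (\<exists>\<gamma>. E \<gamma> \<beta> \<and> (\<exists>v. reaches G \<gamma> v \<and> is_pair E p \<gamma> v))"
    unfolding small_def by blast
  obtain q where q: "is_pair E q \<beta> (G r)" using ord_pair_exists by blast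
  obtain f where f: "\<And>p. E p f \<longleftrightarrow> E p g \<or> p = q" using small_insert[of g q] unfolding small_def by blast
  have maps: "maps E f \<alpha> v \<longleftrightarrow> (E \<alpha> \<beta> \<and> reaches G \<alpha> v) \<or> (\<alpha> = \<beta> \<and> v = G r)" for \<alpha> v
  proof
    assume "maps E f \<alpha> v"
    then obtain p where p: "is_pair E p \<alpha> v" "E p f" unfolding maps_def by blast
    show "(E \<alpha> \<beta> \<and> reaches G \<alpha> v) \<or> (\<alpha> = \<beta> \<and> v = G r)"
    proof (cases "p = q")
      case True then show ?thesis using is_pair_inject p q by blast
    next
      case False
      then obtain \<gamma> w where "E \<gamma> \<beta>" "reaches G \<gamma> w" "is_pair E p \<gamma> w" using p(2) f g by blast
      then show ?thesis using is_pair_inject p(1) by blast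
    qed
  next
    assume *: "(E \<alpha> \<beta> \<and> reaches G \<alpha> v) \<or> (\<alpha> = \<beta> \<and> v = G r)"
    obtain p where "is_pair E p \<alpha> v" using ord_pair_exists by blast
    then show "maps E f \<alpha> v" using * f g is_pair_unique q unfolding maps_def by blast
  qed
  have below: "maps E f \<gamma> y \<longleftrightarrow> reaches G \<gamma> y" if "E \<gamma> \<beta>" for \<gamma> y
    using that maps not_mem_self by blast
  have "attempt G \<beta> f"
    unfolding attempt_def
  proof (intro conjI allI impI)
    fix \<alpha> assume "ord_le E \<alpha> \<beta>"
    then consider "E \<alpha> \<beta>" | "\<alpha> = \<beta>" unfolding ord_le_def by blast
    then show "\<exists>!v. maps E f \<alpha> v"
    proof cases
      case 1 then show ?thesis using below[OF 1] ex1[OF 1] by simp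
    next
      case 2 then show ?thesis using maps not_mem_self by simp
    qed
  next
    fix \<alpha> v assume v: "maps E f \<alpha> v"
    then show "ord_le E \<alpha> \<beta>" using maps unfolding ord_le_def by blast
    consider "E \<alpha> \<beta>" "reaches G \<alpha> v" | "\<alpha> = \<beta>" "v = G r" using v maps by blast
    then show "\<exists>r. (\<forall>y. E y r \<longleftrightarrow> (\<exists>\<gamma>. E \<gamma> \<alpha> \<and> maps E f \<gamma> y)) \<and> v = G r"
    proof cases
      case 2 then show ?thesis using r below by (intro exI[of _ r]) auto
    next
      case 1
      then obtain h where h: "attempt G \<alpha> h" "maps E h \<alpha> v" unfolding reaches_def by blast
      then obtain r' where r': "\<forall>y. E y r' \<longleftrightarrow> (\<exists>\<gamma>. E \<gamma> \<alpha> \<and> maps E h \<gamma> y)" "v = G r'"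
        unfolding attempt_def by blast
      have "maps E h \<gamma> y \<longleftrightarrow> maps E f \<gamma> y" if "E \<gamma> \<alpha>" for \<gamma> y
      proof -
        have \<gamma>: "E \<gamma> \<beta>" using ord_trans[OF \<beta> that 1(1)] .
        have *: "reaches G \<gamma> z" if "maps E h \<gamma> z" for z
          using attempt_reaches[OF DG ord[OF 1(1)] h(1) that IH[OF \<gamma>]] .
        have "ord_le E \<gamma> \<alpha>" using \<open>E \<gamma> \<alpha>\<close> unfolding ord_le_def by blast
        then obtain z where "maps E h \<gamma> z" using h(1) unfolding attempt_def by blast
        then show ?thesis using * below[OF \<gamma>] reaches_unique[OF ord[OF \<gamma>]] by metis
      qed
      then have "(\<exists>\<gamma>. E \<gamma> \<alpha> \<and> maps E h \<gamma> y) \<longleftrightarrow> (\<exists>\<gamma>. E \<gamma> \<alpha> \<and> maps E f \<gamma> y)" for y by blast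
      then show ?thesis using r' by (intro exI[of _ r']) simp
    qed
  qed
  moreover have "maps E f \<beta> (G r)" using maps by blast
  ultimately show "\<exists>v. reaches G \<beta> v" unfolding reaches_def by blast
qed

lemma ordinal_recursion:
  assumes DG: "D 2 (\<lambda>s. s 1 = G (s 0))"
  obtains F where "D 2 (\<lambda>s. s 1 = F (s 0))"
    "\<And>\<alpha>. is_ord E \<alpha> \<Longrightarrow> \<exists>r. (\<forall>y. E y r \<longleftrightarrow> (\<exists>\<gamma>. E \<gamma> \<alpha> \<and> y = F \<gamma>)) \<and> F \<alpha> = G r"
proof -
  obtain e where e: "is_empty E e" using empty_exists by blast
  \<comment> \<open>The value \<open>e\<close> outside the ordinals makes the graph of
    \<open>F\<close> definable on the whole universe.\<close>
  define F where "F \<alpha> = (if is_ord E \<alpha> then THE v. reaches G \<alpha> v else e)" for \<alpha>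
  have F: "v = F \<alpha> \<longleftrightarrow> reaches G \<alpha> v" if "is_ord E \<alpha>" for \<alpha> v
  proof -
    have "\<exists>!v. reaches G \<alpha> v" using reaches_exists[OF DG that] reaches_unique[OF that] by blast
    then have "reaches G \<alpha> (F \<alpha>)" unfolding F_def using that theI'[of "reaches G \<alpha>"] by simp
    then show ?thesis using reaches_unique[OF that] by blast
  qed
  have "D 2 (\<lambda>s. (is_ord E (s 0) \<and> reaches G (s 0) (s 1)) \<or> (\<not> is_ord E (s 0) \<and> s 1 = e))"
    by (intro D_intros D_reaches[OF DG]; simp)
  moreover have "(\<lambda>s. (is_ord E (s 0) \<and> reaches G (s 0) (s 1)) \<or> (\<not> is_ord E (s 0) \<and> s 1 = e)) =
      (\<lambda>s. s (1::nat) = F (s 0))"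
    using F by (auto simp: F_def fun_eq_iff)
  ultimately have "D 2 (\<lambda>s. s 1 = F (s 0))" by simp
  moreover have "\<exists>r. (\<forall>y. E y r \<longleftrightarrow> (\<exists>\<gamma>. E \<gamma> \<alpha> \<and> y = F \<gamma>)) \<and> F \<alpha> = G r" if \<alpha>: "is_ord E \<alpha>" for \<alpha>
  proof -
    obtain f where f: "attempt G \<alpha> f" "maps E f \<alpha> (F \<alpha>)" using F[OF \<alpha>] unfolding reaches_def by blast
    then obtain r where r: "\<forall>y. E y r \<longleftrightarrow> (\<exists>\<gamma>. E \<gamma> \<alpha> \<and> maps E f \<gamma> y)" "F \<alpha> = G r"
      unfolding attempt_def by blast
    have "maps E f \<gamma> y \<longleftrightarrow> y = F \<gamma>" if "E \<gamma> \<alpha>" for \<gamma> y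
    proof -
      have o: "is_ord E \<gamma>" using ord_elem[OF \<alpha> that] .
      have *: "z = F \<gamma>" if "maps E f \<gamma> z" for z
        using attempt_reaches[OF DG \<alpha> f(1) that reaches_exists[OF DG o]] F[OF o] by simp
      have "ord_le E \<gamma> \<alpha>" using \<open>E \<gamma> \<alpha>\<close> unfolding ord_le_def by blast
      then obtain z where "maps E f \<gamma> z" using f(1) unfolding attempt_def by blast
      then show ?thesis using * by blast
    qed
    then have "(\<exists>\<gamma>. E \<gamma> \<alpha> \<and> maps E f \<gamma> y) \<longleftrightarrow> (\<exists>\<gamma>. E \<gamma> \<alpha> \<and> y = F \<gamma>)" for y by blast
    then show ?thesis using r by (intro exI[of _ r]) simp
  qed
  ultimately show ?thesis using that by blast
qed


section \<open>Limits of unbounded definable classes\<close>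

text \<open>A recursion picks elements of \<open>X\<close> above \<open>a\<close> in increasing
  order, and the supremum of the values below a limit \<open>l\<close> is the required limit of
  \<open>X\<close>. The iteration is internal because a sequence indexed by the natural numbers
  outside need not be a set of the model.\<close>

lemma limit_points:
  assumes X: "D 1 (\<lambda>s. X (s 0))" "\<And>x. X x \<Longrightarrow> is_ord E x"
    and unb: "\<And>a. is_ord E a \<Longrightarrow> \<exists>x. X x \<and> E a x" and a: "is_ord E a"
  shows "\<exists>\<theta>. is_ord E \<theta> \<and> E a \<theta> \<and> (\<forall>\<gamma>. E \<gamma> \<theta> \<longrightarrow> (\<exists>x. X x \<and> E \<gamma> x \<and> E x \<theta>))"
proof -
  obtain e where e: "is_empty E e" using empty_exists by blast
  then have e_ord: "is_ord E e" unfolding is_empty_def is_ord_def trans_set_def by blast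
  define Q where "Q r x \<longleftrightarrow> X x \<and> E a x \<and> (\<forall>y. E y r \<longrightarrow> E y x)" for r x
  \<comment> \<open>The default \<open>e\<close> does not occur in the recursion: the earlier values
    have an ordinal bound, and \<open>X\<close> has elements above it.\<close>
  define G where "G r = (if \<exists>x. Q r x then THE x. Q r x \<and> (\<forall>y. E y x \<longrightarrow> \<not> Q r y) else e)" for r
  have DQ: "D k (\<lambda>s. Q (t s) (u s))" if "T k t" "T k u" for k t u
    unfolding Q_def by (intro D_intros D_subst1[of X, OF X(1)] that; simp)
  \<comment> \<open>The graph of \<open>G\<close> without description operator and conditional,
    which formulas do not have.\<close>
  have GQ: "v = G r \<longleftrightarrow> (Q r v \<and> (\<forall>y. E y v \<longrightarrow> \<not> Q r y)) \<or> ((\<not> (\<exists>x. Q r x)) \<and> v = e)" for r v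
  proof (cases "\<exists>x. Q r x")
    case False then show ?thesis unfolding G_def by auto
  next
    case True
    then obtain x where x: "Q r x" by blast
    have o: "Q r y \<Longrightarrow> is_ord E y" for y using X(2) unfolding Q_def by blast
    have "D 1 (\<lambda>s. Q r (s 0))" by (intro DQ D_intros; simp)
    then obtain z where z: "Q r z" "\<And>y. E y z \<Longrightarrow> \<not> Q r y"
      using ord_least[of "Q r", OF _ o[OF x] x] by blast
    have uni: "w = z" if "Q r w" "\<forall>y. E y w \<longrightarrow> \<not> Q r y" for w
      using ord_linear[OF o[OF that(1)] o[OF z(1)]] z that by blast
    have "(THE x. Q r x \<and> (\<forall>y. E y x \<longrightarrow> \<not> Q r y)) = z"
      by (rule the_equality) (use z uni in blast)+
    then have "G r = z" unfolding G_def using True by simp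
    then show ?thesis using z uni True by blast
  qed
  have "D 2 (\<lambda>s. s 1 = G (s 0))"
    unfolding GQ by (intro D_intros DQ; simp)
  then obtain F where F: "D 2 (\<lambda>s. s 1 = F (s 0))"
    "\<And>\<alpha>. is_ord E \<alpha> \<Longrightarrow> \<exists>r. (\<forall>y. E y r \<longleftrightarrow> (\<exists>\<gamma>. E \<gamma> \<alpha> \<and> y = F \<gamma>)) \<and> F \<alpha> = G r"
    using ordinal_recursion[of G] by blast
  have G_ord: "is_ord E (G r)" for r
    using GQ[of "G r" r] X(2) e_ord unfolding Q_def by blast
  have F_ord: "is_ord E (F \<alpha>)" if "is_ord E \<alpha>" for \<alpha>
    using F(2)[OF that] G_ord by metis
  have FX: "X (F \<alpha>) \<and> E a (F \<alpha>) \<and> (\<forall>\<gamma>. E \<gamma> \<alpha> \<longrightarrow> E (F \<gamma>) (F \<alpha>))" if \<alpha>: "is_ord E \<alpha>" for \<alpha>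
  proof -
    obtain r where r: "\<And>y. E y r \<longleftrightarrow> (\<exists>\<gamma>. E \<gamma> \<alpha> \<and> y = F \<gamma>)" "F \<alpha> = G r" using F(2)[OF \<alpha>] by blast
    have "is_ord E y" if "E y r" for y
    proof -
      obtain \<gamma> where "E \<gamma> \<alpha>" "y = F \<gamma>" using \<open>E y r\<close> r(1) by blast
      then show ?thesis using F_ord ord_elem[OF \<alpha>] by simp
    qed
    then obtain b where b: "is_ord E b" "\<And>y. E y r \<Longrightarrow> E y b" using ord_strict_bound[of r] by blast
    obtain c where c: "is_ord E c" "E a c" "E b c \<or> b = c"
      using ord_linear[OF a b(1)] unb[OF a] unb[OF b(1)] X(2) ord_trans by metis
    obtain x where x: "X x" "E c x" using unb[OF c(1)] by blast
    have xo: "is_ord E x" using X(2)[OF x(1)] .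
    have "Q r x" unfolding Q_def using x c b(2) ord_trans[OF xo] by blast
    then have "Q r (F \<alpha>)" using GQ[of "F \<alpha>" r] r(2) by blast
    then show ?thesis unfolding Q_def using r(1) by blast
  qed
  obtain l where l: "is_ord E l" "\<not> is_empty E l" "\<And>x. E x l \<Longrightarrow> \<exists>y. E y l \<and> E x y" using limit_exists by blast
  obtain r where r: "\<And>y. E y r \<longleftrightarrow> (\<exists>\<gamma>. E \<gamma> l \<and> y = F \<gamma>)" using F(2)[OF l(1)] by blast
  have l_ord: "is_ord E \<gamma>" if "E \<gamma> l" for \<gamma> using ord_elem[OF l(1) that] .
  have "is_ord E y" if "E y r" for y using that r F_ord l_ord by metis
  then obtain \<theta> where \<theta>: "is_ord E \<theta>" "\<And>x. E x \<theta> \<longleftrightarrow> (\<exists>y. E y r \<and> E x y)" using ord_Union[of r] by blast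
  have F\<theta>: "E (F \<gamma>) \<theta>" if \<gamma>: "E \<gamma> l" for \<gamma>
  proof -
    obtain \<gamma>' where "E \<gamma>' l" "E \<gamma> \<gamma>'" using l(3)[OF \<gamma>] by blast
    then show ?thesis using \<theta>(2) r FX[OF l_ord] by blast
  qed
  obtain \<gamma>0 where "E \<gamma>0 l" using l(2) unfolding is_empty_def by blast
  then have "E a \<theta>" using ord_trans[OF \<theta>(1) _ F\<theta>] FX[OF l_ord] by blast
  moreover have "\<exists>x. X x \<and> E \<gamma> x \<and> E x \<theta>" if "E \<gamma> \<theta>" for \<gamma>
  proof -
    obtain \<xi> where "E \<xi> l" "E \<gamma> (F \<xi>)" using \<open>E \<gamma> \<theta>\<close> \<theta>(2) r by metis
    then show ?thesis using FX[OF l_ord] F\<theta> by blast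
  qed
  ultimately show ?thesis using \<theta>(1) by blast
qed

subsection \<open>The cumulative hierarchy\<close>

text \<open>The union of the power sets of all earlier stages is a single clause in place of the
  three cases of \<open>is_hierarchy\<close>, and it depends only on the set of earlier stages.
  \<open>mem_VV_succ\<close> and \<open>mem_VV_limit\<close> recover the cases.\<close>

lemma hierarchy_exists:
  "\<exists>F. D 2 (\<lambda>s. s 1 = F (s 0)) \<and>
    (\<forall>\<alpha>. is_ord E \<alpha> \<longrightarrow> (\<forall>x. E x (F \<alpha>) \<longleftrightarrow> (\<exists>\<gamma>. E \<gamma> \<alpha> \<and> sub E x (F \<gamma>))))"
proof -
  define G where "G r = coll (\<lambda>x. \<exists>v. E v r \<and> sub E x v)" for r
  have G: "E x (G r) \<longleftrightarrow> (\<exists>v. E v r \<and> sub E x v)" for x r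
    unfolding G_def
  proof (rule mem_coll)
    obtain b where b: "\<forall>z. E z b \<longleftrightarrow> (\<exists>x. E x r \<and> E z x)" using union by blast
    obtain c where c: "\<forall>z. E z c \<longleftrightarrow> sub E z b" using power_set by blast
    show "small (\<lambda>x. \<exists>v. E v r \<and> sub E x v)"
    proof (rule sep[of _ c])
      show "D 1 (\<lambda>s. \<exists>v. E v r \<and> sub E (s 0) v)" by (intro D_intros; simp)
      show "E x c" if "\<exists>v. E v r \<and> sub E x v" for x using that b c unfolding sub_def by blast
    qed
  qed
  have Gv: "v = G r \<longleftrightarrow> (\<forall>x. E x v \<longleftrightarrow> (\<exists>v. E v r \<and> sub E x v))" for v r
    using G ext[of v "G r"] by auto
  have "D 2 (\<lambda>s. s 1 = G (s 0))"
    unfolding Gv by (intro D_intros; simp)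
  then obtain F where F: "D 2 (\<lambda>s. s 1 = F (s 0))"
    "\<And>\<alpha>. is_ord E \<alpha> \<Longrightarrow> \<exists>r. (\<forall>y. E y r \<longleftrightarrow> (\<exists>\<gamma>. E \<gamma> \<alpha> \<and> y = F \<gamma>)) \<and> F \<alpha> = G r"
    using ordinal_recursion[of G] by blast
  have "E x (F \<alpha>) \<longleftrightarrow> (\<exists>\<gamma>. E \<gamma> \<alpha> \<and> sub E x (F \<gamma>))" if "is_ord E \<alpha>" for x \<alpha>
    using F(2)[OF that] G by metis
  with F(1) show ?thesis by blast
qed

definition VV :: "'a \<Rightarrow> 'a" where
  "VV = (SOME F. D 2 (\<lambda>s. s 1 = F (s 0)) \<and>
    (\<forall>\<alpha>. is_ord E \<alpha> \<longrightarrow> (\<forall>x. E x (F \<alpha>) \<longleftrightarrow> (\<exists>\<gamma>. E \<gamma> \<alpha> \<and> sub E x (F \<gamma>)))))"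

lemma D_VV': "D 2 (\<lambda>s. s 1 = VV (s 0))"
  and mem_VV: "is_ord E \<alpha> \<Longrightarrow> E x (VV \<alpha>) \<longleftrightarrow> (\<exists>\<gamma>. E \<gamma> \<alpha> \<and> sub E x (VV \<gamma>))"
  using someI_ex[OF hierarchy_exists] unfolding VV_def[symmetric] by blast+

lemma D_VV: "T k t \<Longrightarrow> T k u \<Longrightarrow> D k (\<lambda>s. u s = VV (t s))"
  by (rule D_subst2[of "\<lambda>x y. y = VV x", OF D_VV'])

lemma VV_mono: "is_ord E \<beta> \<Longrightarrow> ord_le E \<alpha> \<beta> \<Longrightarrow> E x (VV \<alpha>) \<Longrightarrow> E x (VV \<beta>)"
  using mem_VV[of \<alpha> x] mem_VV[of \<beta> x] ord_elem[of \<beta> \<alpha>] ord_trans[of \<beta>] unfolding ord_le_def by blast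

lemma VV_sub:
  assumes "is_ord E \<beta>" "E x (VV \<beta>)" "E y x" shows "E y (VV \<beta>)"
proof -
  obtain \<gamma> where "E \<gamma> \<beta>" "sub E x (VV \<gamma>)" using mem_VV assms by blast
  then show ?thesis using VV_mono[OF assms(1), of \<gamma> y] assms(3) unfolding sub_def ord_le_def by blast
qed

lemma mem_VV_succ:
  assumes "is_ord E \<alpha>" "is_succ E \<alpha> \<beta>" shows "E x (VV \<beta>) \<longleftrightarrow> sub E x (VV \<alpha>)"
proof -
  have "is_ord E \<beta>" using ord_succ assms by blast
  then have "E x (VV \<beta>) \<longleftrightarrow> (\<exists>\<gamma>. ord_le E \<gamma> \<alpha> \<and> sub E x (VV \<gamma>))"
    using mem_VV[of \<beta> x] assms(2) unfolding is_succ_def ord_le_def by blast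
  then show ?thesis using VV_mono[OF assms(1)] ord_le_refl unfolding sub_def by blast
qed

lemma mem_VV_limit:
  assumes \<alpha>: "is_ord E \<alpha>" and lim: "\<not> (\<exists>\<gamma>. is_succ E \<gamma> \<alpha>)"
  shows "E x (VV \<alpha>) \<longleftrightarrow> (\<exists>\<gamma>. E \<gamma> \<alpha> \<and> E x (VV \<gamma>))"
proof
  assume "E x (VV \<alpha>)"
  then obtain \<gamma> where \<gamma>: "E \<gamma> \<alpha>" "sub E x (VV \<gamma>)" using mem_VV[OF \<alpha>] by blast
  have o: "is_ord E \<gamma>" using ord_elem[OF \<alpha> \<gamma>(1)] .
  obtain \<beta> where \<beta>: "is_succ E \<gamma> \<beta>" using is_succ_exists by blast
  have b: "is_ord E \<beta>" using ord_succ o \<beta> by blast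
  have "\<beta> \<noteq> \<alpha>" using lim \<beta> by blast
  moreover have "\<not> E \<alpha> \<beta>" using \<beta> \<gamma>(1) ord_trans[OF o] not_mem_self unfolding is_succ_def by blast
  ultimately have "E \<beta> \<alpha>" using ord_linear[OF \<alpha> b] by blast
  then show "\<exists>\<gamma>. E \<gamma> \<alpha> \<and> E x (VV \<gamma>)" using mem_VV_succ[OF o \<beta>] \<gamma>(2) by blast
next
  assume "\<exists>\<gamma>. E \<gamma> \<alpha> \<and> E x (VV \<gamma>)"
  then show "E x (VV \<alpha>)" using VV_mono[OF \<alpha>] unfolding ord_le_def by blast
qed

text \<open>Two halves: an internal induction shows that every hierarchy agrees with
  \<open>VV\<close>, and replacement turns \<open>VV\<close> up to \<beta> into a hierarchy.\<close>

lemma mem_V: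
  assumes \<beta>: "is_ord E \<beta>"
  shows "x \<in> V E \<beta> \<longleftrightarrow> E x (VV \<beta>)"
proof -
  have val: "v = VV \<beta>" if f: "is_hierarchy E \<beta> f" and v: "maps E f \<beta> v" for f v
  proof -
    have ex: "ord_le E \<alpha> \<beta> \<Longrightarrow> \<exists>!v. maps E f \<alpha> v" for \<alpha> using f unfolding is_hierarchy_def by blast
    have cl: "(is_empty E \<alpha> \<longrightarrow> is_empty E v) \<and>
      (\<forall>\<gamma> u. is_succ E \<gamma> \<alpha> \<and> maps E f \<gamma> u \<longrightarrow> (\<forall>x. E x v \<longleftrightarrow> sub E x u)) \<and>
      (\<not> is_empty E \<alpha> \<and> \<not> (\<exists>\<gamma>. is_succ E \<gamma> \<alpha>) \<longrightarrow>
        (\<forall>x. E x v \<longleftrightarrow> (\<exists>\<gamma> u. E \<gamma> \<alpha> \<and> maps E f \<gamma> u \<and> E x u)))" if "maps E f \<alpha> v" for \<alpha> v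
      using f that unfolding is_hierarchy_def by blast
    have "\<forall>v. ord_le E \<beta> \<beta> \<longrightarrow> maps E f \<beta> v \<longrightarrow> v = VV \<beta>"
    proof (rule ord_induct[OF _ _ \<beta>, of "\<lambda>\<alpha>. \<forall>v. ord_le E \<alpha> \<beta> \<longrightarrow> maps E f \<alpha> v \<longrightarrow> v = VV \<alpha>"])
      show "D 1 (\<lambda>s. \<forall>v. ord_le E (s 0) \<beta> \<longrightarrow> maps E f (s 0) v \<longrightarrow> v = VV (s 0))"
        by (intro D_VV D_intros; simp)
      fix \<alpha> assume \<alpha>: "is_ord E \<alpha>"
        and IH: "\<And>\<gamma>. E \<gamma> \<alpha> \<Longrightarrow> \<forall>v. ord_le E \<gamma> \<beta> \<longrightarrow> maps E f \<gamma> v \<longrightarrow> v = VV \<gamma>"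
      show "\<forall>v. ord_le E \<alpha> \<beta> \<longrightarrow> maps E f \<alpha> v \<longrightarrow> v = VV \<alpha>"
      proof (intro allI impI)
        fix v assume le: "ord_le E \<alpha> \<beta>" and v: "maps E f \<alpha> v"
        have below: "maps E f \<gamma> u \<longleftrightarrow> u = VV \<gamma>" if "E \<gamma> \<alpha>" for \<gamma> u
        proof -
          have "ord_le E \<gamma> \<beta>" using ord_less_le_trans[OF \<beta> that le] unfolding ord_le_def by blast
          then show ?thesis using IH[OF that] ex[of \<gamma>] by blast
        qed
        have "E x v \<longleftrightarrow> E x (VV \<alpha>)" for x
        proof (cases "is_empty E \<alpha>")
          case True
          then have "is_empty E v" using cl[OF v] by blast
          then show ?thesis using True mem_VV[OF \<alpha>] unfolding is_empty_def by blast
        next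
          case ne: False
          show ?thesis
          proof (cases "\<exists>\<gamma>. is_succ E \<gamma> \<alpha>")
            case True
            then obtain \<gamma> where \<gamma>: "is_succ E \<gamma> \<alpha>" by blast
            then have "E \<gamma> \<alpha>" unfolding is_succ_def by blast
            then have "E x v \<longleftrightarrow> sub E x (VV \<gamma>)" using cl[OF v] \<gamma> below by blast
            then show ?thesis using mem_VV_succ[OF ord_elem[OF \<alpha> \<open>E \<gamma> \<alpha>\<close>] \<gamma>] by blast
          next
            case False
            then have "E x v \<longleftrightarrow> (\<exists>\<gamma> u. E \<gamma> \<alpha> \<and> maps E f \<gamma> u \<and> E x u)" using cl[OF v] ne by blast
            moreover have "(\<exists>\<gamma> u. E \<gamma> \<alpha> \<and> maps E f \<gamma> u \<and> E x u) \<longleftrightarrow> (\<exists>\<gamma>. E \<gamma> \<alpha> \<and> E x (VV \<gamma>))"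
              using below by auto
            ultimately show ?thesis using mem_VV_limit[OF \<alpha> False] by simp
          qed
        qed
        then show "v = VV \<alpha>" by (rule ext)
      qed
    qed
    then show ?thesis using v ord_le_refl by blast
  qed
  obtain b where b: "\<And>z. E z b \<longleftrightarrow> ord_le E z \<beta>"
    using small_insert[of \<beta> \<beta>] unfolding small_def ord_le_def by blast
  have "small (\<lambda>p. \<exists>\<alpha>. E \<alpha> b \<and> (\<exists>v. v = VV \<alpha> \<and> is_pair E p \<alpha> v))"
  proof (rule repl)
    show "D 2 (\<lambda>s. \<exists>v. v = VV (s 0) \<and> is_pair E (s 1) (s 0) v)"
      by (intro D_VV D_intros; simp)
    show "\<exists>!p. \<exists>v. v = VV \<alpha> \<and> is_pair E p \<alpha> v" for \<alpha>
      using ord_pair_exists[of \<alpha> "VV \<alpha>"] is_pair_unique by metis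
  qed
  then obtain f where f: "\<And>p. E p f \<longleftrightarrow> (\<exists>\<alpha>. ord_le E \<alpha> \<beta> \<and> is_pair E p \<alpha> (VV \<alpha>))"
    unfolding small_def b by auto
  have maps: "maps E f \<alpha> v \<longleftrightarrow> ord_le E \<alpha> \<beta> \<and> v = VV \<alpha>" for \<alpha> v
    unfolding maps_def f using is_pair_inject ord_pair_exists by metis
  have "is_hierarchy E \<beta> f"
    unfolding is_hierarchy_def
  proof (intro conjI allI impI)
    show "\<exists>\<alpha> v. ord_le E \<alpha> \<beta> \<and> is_pair E p \<alpha> v" if "E p f" for p using that f by blast
    show "\<exists>!v. maps E f \<alpha> v" if "ord_le E \<alpha> \<beta>" for \<alpha> using that maps by simp
  next
    fix \<alpha> v assume "maps E f \<alpha> v"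
    then have \<alpha>v: "ord_le E \<alpha> \<beta>" "v = VV \<alpha>" using maps by auto
    have \<alpha>: "is_ord E \<alpha>" using \<alpha>v(1) \<beta> ord_elem unfolding ord_le_def by blast
    show "is_empty E v" if "is_empty E \<alpha>" using that mem_VV[OF \<alpha>] \<alpha>v(2) unfolding is_empty_def by blast
    show "E x v \<longleftrightarrow> sub E x u" if "is_succ E \<gamma> \<alpha> \<and> maps E f \<gamma> u" for \<gamma> u x
    proof -
      have "E \<gamma> \<alpha>" "u = VV \<gamma>" using that maps unfolding is_succ_def by auto
      then show ?thesis using mem_VV_succ[OF ord_elem[OF \<alpha>]] that \<alpha>v(2) by blast
    qed
    show "E x v \<longleftrightarrow> (\<exists>\<gamma> u. E \<gamma> \<alpha> \<and> maps E f \<gamma> u \<and> E x u)"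
      if "\<not> is_empty E \<alpha> \<and> \<not> (\<exists>\<gamma>. is_succ E \<gamma> \<alpha>)" for x
    proof -
      have "ord_le E \<gamma> \<beta>" if "E \<gamma> \<alpha>" for \<gamma>
        using ord_less_le_trans[OF \<beta> that \<alpha>v(1)] unfolding ord_le_def by blast
      then have "(\<exists>\<gamma> u. E \<gamma> \<alpha> \<and> maps E f \<gamma> u \<and> E x u) \<longleftrightarrow> (\<exists>\<gamma>. E \<gamma> \<alpha> \<and> E x (VV \<gamma>))"
        using maps by auto
      then show ?thesis using mem_VV_limit[OF \<alpha>] that \<alpha>v(2) by simp
    qed
  qed
  moreover have "maps E f \<beta> (VV \<beta>)" using maps ord_le_refl by blast
  ultimately show ?thesis unfolding V_def using val by blast
qed

lemma ord_mem_VV: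
  assumes "is_ord E \<beta>" "is_ord E x" shows "E x (VV \<beta>) \<longleftrightarrow> E x \<beta>"
proof -
  \<comment> \<open>The value of \<open>VV\<close> is named by a bound \<open>v\<close>, since
    definability is known for the graph of \<open>VV\<close> only.\<close>
  have "\<forall>x. is_ord E x \<longrightarrow> (\<exists>v. v = VV \<beta> \<and> (E x v \<longleftrightarrow> E x \<beta>))"
  proof (rule ord_induct[OF _ _ assms(1)])
    show "D 1 (\<lambda>s. \<forall>x. is_ord E x \<longrightarrow> (\<exists>v. v = VV (s 0) \<and> (E x v \<longleftrightarrow> E x (s 0))))"
      by (intro D_VV D_intros; simp)
    fix \<beta> assume \<beta>: "is_ord E \<beta>"
      and IH: "\<And>\<gamma>. E \<gamma> \<beta> \<Longrightarrow> \<forall>x. is_ord E x \<longrightarrow> (\<exists>v. v = VV \<gamma> \<and> (E x v \<longleftrightarrow> E x \<gamma>))"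
    have "E x (VV \<beta>) \<longleftrightarrow> E x \<beta>" if x: "is_ord E x" for x
    proof -
      have "sub E x (VV \<gamma>) \<longleftrightarrow> sub E x \<gamma>" if "E \<gamma> \<beta>" for \<gamma>
        using IH[OF that] ord_elem[OF x] unfolding sub_def by blast
      then have "E x (VV \<beta>) \<longleftrightarrow> (\<exists>\<gamma>. E \<gamma> \<beta> \<and> ord_le E x \<gamma>)"
        using mem_VV[OF \<beta>] ord_sub[OF x ord_elem[OF \<beta>]] by blast
      then show ?thesis using ord_le_less_trans[OF \<beta>] ord_le_refl by blast
    qed
    then show "\<forall>x. is_ord E x \<longrightarrow> (\<exists>v. v = VV \<beta> \<and> (E x v \<longleftrightarrow> E x \<beta>))" by blast
  qed
  then show ?thesis using assms(2) by blast
qed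

text \<open>Each stage of the recursion adds to \<open>x\<close> the elements of all members of
  earlier stages. A member of the limit stage already occurs at an earlier stage, so its elements
  are in the limit stage.\<close>

lemma transitive_superset: "\<exists>c. sub E x c \<and> trans_set E c"
proof -
  define G where "G r = coll (\<lambda>y. E y x \<or> (\<exists>v. E v r \<and> (\<exists>w. E w v \<and> E y w)))" for r
  have G: "E y (G r) \<longleftrightarrow> E y x \<or> (\<exists>v. E v r \<and> (\<exists>w. E w v \<and> E y w))" for y r
    unfolding G_def
  proof (rule mem_coll)
    obtain b where b: "\<forall>z. E z b \<longleftrightarrow> (\<exists>v. E v r \<and> E z v)" using union by blast
    obtain c where c: "\<forall>z. E z c \<longleftrightarrow> (\<exists>v. E v b \<and> E z v)" using union by blast
    have "(\<exists>v. E v r \<and> (\<exists>w. E w v \<and> E y w)) \<longleftrightarrow> E y c" for y using b c by metis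
    then show "small (\<lambda>y. E y x \<or> (\<exists>v. E v r \<and> (\<exists>w. E w v \<and> E y w)))"
      using small_Un[of x c] by simp
  qed
  have Gv: "v = G r \<longleftrightarrow> (\<forall>y. E y v \<longleftrightarrow> E y x \<or> (\<exists>v. E v r \<and> (\<exists>w. E w v \<and> E y w)))" for v r
    using G ext[of v "G r"] by auto
  have "D 2 (\<lambda>s. s 1 = G (s 0))"
    unfolding Gv by (intro D_intros; simp)
  then obtain F where F:
    "\<And>\<alpha>. is_ord E \<alpha> \<Longrightarrow> \<exists>r. (\<forall>y. E y r \<longleftrightarrow> (\<exists>\<gamma>. E \<gamma> \<alpha> \<and> y = F \<gamma>)) \<and> F \<alpha> = G r"
    using ordinal_recursion[of G] by blast
  have mem: "E y (F \<alpha>) \<longleftrightarrow> E y x \<or> (\<exists>\<gamma>. E \<gamma> \<alpha> \<and> (\<exists>w. E w (F \<gamma>) \<and> E y w))" if "is_ord E \<alpha>" for y \<alpha>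
  proof -
    obtain r where "\<And>y. E y r \<longleftrightarrow> (\<exists>\<gamma>. E \<gamma> \<alpha> \<and> y = F \<gamma>)" "F \<alpha> = G r" using F[OF \<open>is_ord E \<alpha>\<close>] by blast
    then show ?thesis using G by auto
  qed
  obtain l where l: "is_ord E l" "\<not> is_empty E l" "\<And>x. E x l \<Longrightarrow> \<exists>y. E y l \<and> E x y" using limit_exists by blast
  have "sub E x (F l)" unfolding sub_def using mem[OF l(1)] by blast
  moreover have "E z (F l)" if "E y (F l)" "E z y" for y z
  proof -
    obtain \<gamma> where \<gamma>: "E \<gamma> l" "E y (F \<gamma>)"
    proof (cases "E y x")
      case True
      obtain \<gamma> where "E \<gamma> l" using l(2) unfolding is_empty_def by blast
      then show ?thesis using that True mem ord_elem[OF l(1)] by blast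
    next
      case False
      then obtain \<gamma> w where \<gamma>: "E \<gamma> l" "E w (F \<gamma>)" "E y w" using \<open>E y (F l)\<close> mem[OF l(1)] by blast
      obtain \<gamma>' where "E \<gamma>' l" "E \<gamma> \<gamma>'" using l(3)[OF \<gamma>(1)] by blast
      then show ?thesis using that[of \<gamma>'] mem[OF ord_elem[OF l(1)], of \<gamma>' y] \<gamma> by blast
    qed
    then show ?thesis using mem[OF l(1)] \<open>E z y\<close> by blast
  qed
  ultimately show ?thesis unfolding trans_set_def sub_def by blast
qed

text \<open>Needed for \<open>V_cofinal\<close>: since the worlds exhaust the universe, truth in the
  universe can be expressed at a world.\<close>

lemma VV_cover: "\<exists>\<alpha>. is_ord E \<alpha> \<and> E x (VV \<alpha>)"
proof -
  define P where "P x \<longleftrightarrow> (\<exists>\<alpha>. is_ord E \<alpha> \<and> (\<exists>v. v = VV \<alpha> \<and> E x v))" for x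
  have DP: "D k (\<lambda>s. P (t s))" if "T k t" for k t
    unfolding P_def by (intro D_VV D_intros that; simp)
  \<comment> \<open>Taking the least stage gives replacement a unique value.\<close>
  define rk where "rk x \<alpha> \<longleftrightarrow> is_ord E \<alpha> \<and> (\<exists>v. v = VV \<alpha> \<and> E x v) \<and>
    (\<forall>\<gamma>. E \<gamma> \<alpha> \<longrightarrow> \<not> (\<exists>v. v = VV \<gamma> \<and> E x v))" for x \<alpha>
  have Drk: "D k (\<lambda>s. rk (t s) (u s))" if "T k t" "T k u" for k t u
    unfolding rk_def by (intro D_VV D_intros that; simp)
  have step: "P y" if all: "\<And>z. E z y \<Longrightarrow> P z" for y
  proof -
    have "\<exists>!\<alpha>. rk z \<alpha>" if z: "E z y" for z
    proof -
      obtain \<alpha> where \<alpha>: "is_ord E \<alpha>" "E z (VV \<alpha>)" using all[OF z] unfolding P_def by blast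
      have "D 1 (\<lambda>s. \<exists>v. v = VV (s 0) \<and> E z v)" by (intro D_VV D_intros; simp)
      then obtain \<beta> where "rk z \<beta>"
        using ord_least[of "\<lambda>\<alpha>. \<exists>v. v = VV \<alpha> \<and> E z v", OF _ \<alpha>(1)] \<alpha>(2) unfolding rk_def by blast
      moreover have "\<alpha> = \<beta>" if "rk z \<alpha>" "rk z \<beta>" for \<alpha> \<beta>
        using that ord_linear[of \<alpha> \<beta>] unfolding rk_def by blast
      ultimately show ?thesis by blast
    qed
    then have "small (\<lambda>\<alpha>. \<exists>z. E z y \<and> rk z \<alpha>)"
      by (intro repl Drk) (auto intro: Drk D_intros)
    then obtain r where r: "\<And>\<alpha>. E \<alpha> r \<longleftrightarrow> (\<exists>z. E z y \<and> rk z \<alpha>)" unfolding small_def by blast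
    then have "is_ord E \<alpha>" if "E \<alpha> r" for \<alpha> using that unfolding rk_def by blast
    then obtain b where b: "is_ord E b" "\<And>\<alpha>. E \<alpha> r \<Longrightarrow> E \<alpha> b" using ord_strict_bound[of r] by blast
    have "sub E y (VV b)"
      unfolding sub_def
    proof (intro allI impI)
      fix z assume "E z y"
      then obtain \<alpha> where "rk z \<alpha>" using \<open>\<And>z. E z y \<Longrightarrow> \<exists>!\<alpha>. rk z \<alpha>\<close> by blast
      then have "ord_le E \<alpha> b" "E z (VV \<alpha>)" using r b(2) \<open>E z y\<close> unfolding rk_def ord_le_def by blast+
      then show "E z (VV b)" using VV_mono[OF b(1)] by blast
    qed
    moreover obtain c where c: "is_succ E b c" using is_succ_exists by blast
    ultimately show ?thesis using mem_VV_succ[OF b(1) c] ord_succ[OF b(1) c] unfolding P_def by blast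
  qed
  \<comment> \<open>Foundation speaks about sets, so the sets outside the hierarchy are cut down to
    a transitive \<open>c\<close> containing \<open>x\<close>. Transitivity keeps the elements of a
    minimal such set in \<open>c\<close>.\<close>
  obtain s where s: "\<forall>z. E z s \<longleftrightarrow> z = x \<or> z = x" using pairing by blast
  obtain c where c: "sub E s c" "trans_set E c" using transitive_superset by blast
  have "P x"
  proof (rule ccontr)
    assume "\<not> P x"
    have "small (\<lambda>y. E y c \<and> \<not> P y)"
      by (rule sep[of _ c], (intro DP D_intros; simp), simp)
    then obtain a where a: "\<And>y. E y a \<longleftrightarrow> E y c \<and> \<not> P y" unfolding small_def by blast
    have "E x a" using a c(1) s \<open>\<not> P x\<close> unfolding sub_def by blast
    then obtain y where y: "E y a" "\<not> (\<exists>z. E z y \<and> E z a)" using foundation by blast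
    have "P z" if "E z y" for z using y that a c(2) unfolding trans_set_def sub_def by blast
    then show False using step a y(1) by blast
  qed
  then show ?thesis unfolding P_def by blast
qed

end


section \<open>Labelling the worlds\<close>

text \<open>
  \<open>at_pos E A i \<alpha>\<close>: the order type of \<open>A \<inter> \<alpha>\<close> is a limit (or \<open>0\<close>) plus \<open>i\<close>.
  \<open>at_lev E A j \<alpha>\<close>: at least \<open>j\<close> elements of \<open>A\<close> up to \<open>\<alpha>\<close> are limits of limit elements of \<open>A\<close>.
\<close>

definition max_below :: "('a \<Rightarrow> 'a \<Rightarrow> bool) \<Rightarrow> 'a set \<Rightarrow> 'a \<Rightarrow> 'a \<Rightarrow> bool" where
  "max_below E A \<alpha> \<gamma> \<longleftrightarrow> \<gamma> \<in> A \<and> E \<gamma> \<alpha> \<and> (\<forall>\<gamma>'. \<gamma>' \<in> A \<longrightarrow> E \<gamma>' \<alpha> \<longrightarrow> E \<gamma>' \<gamma> \<or> \<gamma>' = \<gamma>)"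

primrec at_pos :: "('a \<Rightarrow> 'a \<Rightarrow> bool) \<Rightarrow> 'a set \<Rightarrow> nat \<Rightarrow> 'a \<Rightarrow> bool" where
  "at_pos E A 0 = (\<lambda>\<alpha>. \<not> (\<exists>\<gamma>. max_below E A \<alpha> \<gamma>))"
| "at_pos E A (Suc i) = (\<lambda>\<alpha>. \<exists>\<gamma>. max_below E A \<alpha> \<gamma> \<and> at_pos E A i \<gamma>)"

definition limlim :: "('a \<Rightarrow> 'a \<Rightarrow> bool) \<Rightarrow> 'a set \<Rightarrow> 'a \<Rightarrow> bool" where
  "limlim E A \<alpha> \<longleftrightarrow> (\<exists>\<gamma>. \<gamma> \<in> A \<and> E \<gamma> \<alpha>) \<and>
    (\<forall>\<gamma>. \<gamma> \<in> A \<longrightarrow> E \<gamma> \<alpha> \<longrightarrow> (\<exists>\<gamma>'. \<gamma>' \<in> A \<and> E \<gamma>' \<alpha> \<and> E \<gamma> \<gamma>' \<and> at_pos E A 0 \<gamma>'))"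

primrec at_lev :: "('a \<Rightarrow> 'a \<Rightarrow> bool) \<Rightarrow> 'a set \<Rightarrow> nat \<Rightarrow> 'a \<Rightarrow> bool" where
  "at_lev E A 0 = (\<lambda>\<alpha>. True)"
| "at_lev E A (Suc j) = (\<lambda>\<alpha>.
    (limlim E A \<alpha> \<and> (\<exists>\<gamma>. \<gamma> \<in> A \<and> E \<gamma> \<alpha> \<and> at_lev E A j \<gamma>)) \<or>
    (\<exists>\<gamma>. \<gamma> \<in> A \<and> E \<gamma> \<alpha> \<and> limlim E A \<gamma> \<and> (\<exists>\<gamma>'. \<gamma>' \<in> A \<and> E \<gamma>' \<gamma> \<and> at_lev E A j \<gamma>')))"

definition pos :: "('a \<Rightarrow> 'a \<Rightarrow> bool) \<Rightarrow> 'a set \<Rightarrow> nat \<Rightarrow> 'a \<Rightarrow> nat" where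
  "pos E A m \<alpha> = (LEAST i. at_pos E A i \<alpha> \<or> m \<le> Suc i)"

definition lev :: "('a \<Rightarrow> 'a \<Rightarrow> bool) \<Rightarrow> 'a set \<Rightarrow> nat \<Rightarrow> 'a \<Rightarrow> nat" where
  "lev E A r \<alpha> = (LEAST j. \<not> at_lev E A (Suc j) \<alpha> \<or> r \<le> Suc j)"

lemma Least_nat_eq_iff:
  assumes "Q (n::nat)"
  shows "(LEAST i. Q i) = k \<longleftrightarrow> Q k \<and> (\<forall>i\<in>{..<k}. \<not> Q i)"
  using assms by (metis LeastI Least_equality lessThan_iff not_less not_less_Least)

text \<open>A fixed label value amounts to finitely many conditions on \<open>at_pos\<close>, which
  can be written as a formula.\<close>

lemma pos_eq_iff: "pos E A m \<alpha> = i \<longleftrightarrow>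
    (at_pos E A i \<alpha> \<or> m \<le> Suc i) \<and> (\<forall>i'\<in>{..<i}. \<not> (at_pos E A i' \<alpha> \<or> m \<le> Suc i'))"
  unfolding pos_def by (rule Least_nat_eq_iff[of _ m]) simp

lemma lev_eq_iff: "lev E A r \<alpha> = j \<longleftrightarrow>
    (\<not> at_lev E A (Suc j) \<alpha> \<or> r \<le> Suc j) \<and> (\<forall>j'\<in>{..<j}. \<not> (\<not> at_lev E A (Suc j') \<alpha> \<or> r \<le> Suc j'))"
  unfolding lev_def by (rule Least_nat_eq_iff[of _ r]) simp

lemma pos_less: "1 \<le> m \<Longrightarrow> pos E A m \<alpha> < m"
  unfolding pos_def using Least_le[of "\<lambda>i. at_pos E A i \<alpha> \<or> m \<le> Suc i" "m - 1"] by simp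

lemma lev_less: "1 \<le> r \<Longrightarrow> lev E A r \<alpha> < r"
  unfolding lev_def using Least_le[of "\<lambda>i. \<not> at_lev E A (Suc i) \<alpha> \<or> r \<le> Suc i" "r - 1"] by simp

context
  fixes E :: "'a \<Rightarrow> 'a \<Rightarrow> bool" and D :: "'w \<Rightarrow> 'a set" and R :: "'w \<Rightarrow> 'w \<Rightarrow> bool"
    and W :: "'w set" and mf :: bool and U A :: "'a set"
  assumes D_A: "Dfn E D R W mf U 1 (\<lambda>w s. s 0 \<in> A)"
    and downward: "\<And>w x \<gamma>. w \<in> W \<Longrightarrow> x \<in> D w \<Longrightarrow> \<gamma> \<in> A \<Longrightarrow> E \<gamma> x \<Longrightarrow> \<gamma> \<in> D w"
begin

text \<open>
  Besides the variables, the index \<open>h w\<close> of the current world can be used as an upper bound, because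
  the elements of \<open>A\<close> below it are those in the domain.
\<close>

definition Bound :: "nat \<Rightarrow> ('w \<Rightarrow> (nat \<Rightarrow> 'a) \<Rightarrow> 'a) \<Rightarrow> bool" where
  "Bound k t \<longleftrightarrow> (\<exists>n<k. t = (\<lambda>w s. s n)) \<or>
    (\<exists>h. t = (\<lambda>w s. h w) \<and> (\<forall>w\<in>W. \<forall>\<gamma>\<in>A. \<gamma> \<in> D w \<longleftrightarrow> E \<gamma> (h w)))"

lemma Bound_var: "n < k \<Longrightarrow> Bound k (\<lambda>w s. s n)"
  unfolding Bound_def by blast

lemma Bound_index:
  "(\<And>w \<gamma>. w \<in> W \<Longrightarrow> \<gamma> \<in> A \<Longrightarrow> \<gamma> \<in> D w \<longleftrightarrow> E \<gamma> (h w)) \<Longrightarrow> Bound k (\<lambda>w s. h w)"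
  unfolding Bound_def by blast

lemma Bound_shift: "Bound k t \<Longrightarrow> Bound (Suc k) (\<lambda>w s. t w (\<lambda>n. s (Suc n)))"
  unfolding Bound_def by fastforce

text \<open>On the right the quantifier is unrestricted, while a formula quantifies over the domain
  of the world. Below a variable the two agree by \<open>downward\<close>, below the index of the
  world by \<open>Bound\<close>. So bounded conditions on \<open>A\<close> have the same truth value
  at a world as in the universe.\<close>

lemma Dfn_ex_below:
  assumes t: "Bound k t" and P: "Dfn E D R W mf U (Suc k) (\<lambda>w s. P w (s 0) (\<lambda>n. s (Suc n)))"
  shows "Dfn E D R W mf U k (\<lambda>w s. \<exists>\<gamma>. \<gamma> \<in> A \<and> E \<gamma> (t w s) \<and> P w \<gamma> s)"
proof -
  have D_A': "Dfn E D R W mf U (Suc k) (\<lambda>w s. s 0 \<in> A)"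
    by (rule Dfn_subst[of _ _ _ _ _ _ "\<lambda>w x. x \<in> A", OF D_A]) simp
  consider n where "n < k" "t = (\<lambda>w s. s n)"
    | h where "t = (\<lambda>w s. h w)" "\<forall>w\<in>W. \<forall>\<gamma>\<in>A. \<gamma> \<in> D w \<longleftrightarrow> E \<gamma> (h w)"
    using t unfolding Bound_def by blast
  then show ?thesis
  proof cases
    case 1
    have *: "Dfn E D R W mf U k (\<lambda>w s. \<exists>\<gamma>\<in>D w. \<gamma> \<in> A \<and> E \<gamma> (s n) \<and> P w \<gamma> s)"
      by (intro Dfn_bex Dfn_and D_A' P Dfn_mem Trm_var) (use 1 in auto)
    have "\<gamma> \<in> D w" if "w \<in> W" "\<forall>n<k. s n \<in> D w" "\<gamma> \<in> A" "E \<gamma> (s n)" for w s \<gamma>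
      using downward[OF that(1) _ that(3,4)] that(2) 1(1) by blast
    then show ?thesis unfolding 1(2) by (intro Dfn_cong[OF *]) blast
  next
    case 2
    have "Dfn E D R W mf U k (\<lambda>w s. \<exists>\<gamma>\<in>D w. \<gamma> \<in> A \<and> P w \<gamma> s)"
      by (intro Dfn_bex Dfn_and D_A' P)
    then show ?thesis
      by (rule Dfn_cong) (use 2 in auto)
  qed
qed

lemma Dfn_nonempty_below: "Bound k t \<Longrightarrow> Dfn E D R W mf U k (\<lambda>w s. \<exists>\<gamma>. \<gamma> \<in> A \<and> E \<gamma> (t w s))"
  using Dfn_ex_below[OF _ Dfn_const, of k t True] by simp

lemma Dfn_all_below:
  assumes t: "Bound k t" and P: "Dfn E D R W mf U (Suc k) (\<lambda>w s. P w (s 0) (\<lambda>n. s (Suc n)))"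
  shows "Dfn E D R W mf U k (\<lambda>w s. \<forall>\<gamma>. \<gamma> \<in> A \<longrightarrow> E \<gamma> (t w s) \<longrightarrow> P w \<gamma> s)"
proof -
  have "(\<lambda>w s. \<forall>\<gamma>. \<gamma> \<in> A \<longrightarrow> E \<gamma> (t w s) \<longrightarrow> P w \<gamma> s) =
      (\<lambda>w s. \<not> (\<exists>\<gamma>. \<gamma> \<in> A \<and> E \<gamma> (t w s) \<and> \<not> P w \<gamma> s))" by auto
  then show ?thesis using Dfn_not[OF Dfn_ex_below[OF t Dfn_not[OF P]]] by simp
qed

lemma Dfn_ex_max_below:
  assumes t: "Bound k t" and P: "Dfn E D R W mf U (Suc k) (\<lambda>w s. P w (s 0) (\<lambda>n. s (Suc n)))"
  shows "Dfn E D R W mf U k (\<lambda>w s. \<exists>\<gamma>. max_below E A (t w s) \<gamma> \<and> P w \<gamma> s)"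
  unfolding max_below_def conj_assoc
  by (intro Dfn_ex_below Dfn_all_below Dfn_and Dfn_or Dfn_mem Dfn_eq Trm_var t P Bound_shift) auto

lemma Dfn_at_pos: "Bound k t \<Longrightarrow> Dfn E D R W mf U k (\<lambda>w s. at_pos E A i (t w s))"
proof (induction i arbitrary: k t)
  case 0
  have "Dfn E D R W mf U k (\<lambda>w s. \<not> (\<exists>\<gamma>. max_below E A (t w s) \<gamma> \<and> True))"
    by (intro Dfn_not Dfn_ex_max_below 0 Dfn_const)
  then show ?case by simp
next
  case (Suc i)
  show ?case unfolding at_pos.simps
    by (intro Dfn_ex_max_below Suc Bound_var) simp
qed

lemma Dfn_limlim: "Bound k t \<Longrightarrow> Dfn E D R W mf U k (\<lambda>w s. limlim E A (t w s))"
  unfolding limlim_def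
  by (intro Dfn_and Dfn_nonempty_below Dfn_all_below Dfn_ex_below Dfn_mem Trm_var Dfn_at_pos Bound_var Bound_shift) auto

lemma Dfn_at_lev: "Bound k t \<Longrightarrow> Dfn E D R W mf U k (\<lambda>w s. at_lev E A j (t w s))"
proof (induction j arbitrary: k t)
  case 0 then show ?case by (simp add: Dfn_const)
next
  case (Suc j)
  show ?case unfolding at_lev.simps
    by (intro Dfn_and Dfn_or Dfn_ex_below Dfn_limlim Suc Bound_var Bound_shift) auto
qed

text \<open>Only \<open>r * m\<close> labels are possible, so any condition on them is a finite
  disjunction.\<close>

lemma Dfn_label:
  assumes "Bound k t" "1 \<le> r" "1 \<le> m"
  shows "Dfn E D R W mf U k (\<lambda>w s. v (lev E A r (t w s)) (pos E A m (t w s)))"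
proof -
  have "Dfn E D R W mf U k (\<lambda>w s. lev E A r (t w s) = j)" for j
    unfolding lev_eq_iff
    by (intro Dfn_and Dfn_or Dfn_not Dfn_fin_ball Dfn_const Dfn_at_lev assms finite_lessThan)
  moreover have "Dfn E D R W mf U k (\<lambda>w s. pos E A m (t w s) = i)" for i
    unfolding pos_eq_iff
    by (intro Dfn_and Dfn_or Dfn_not Dfn_fin_ball Dfn_const Dfn_at_pos assms finite_lessThan)
  ultimately have "Dfn E D R W mf U k (\<lambda>w s. \<exists>j\<in>{..<r}. \<exists>i\<in>{..<m}.
      lev E A r (t w s) = j \<and> pos E A m (t w s) = i \<and> v j i)"
    by (intro Dfn_fin_bex Dfn_and Dfn_const finite_lessThan) auto
  then show ?thesis
    by (rule Dfn_cong) (use lev_less pos_less assms in auto)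
qed

end

section \<open>Which labels occur above a given world\<close>

locale zfc_class = zfc_model +
  fixes A :: "'a set"
  assumes D_A: "D 1 (\<lambda>s. s 0 \<in> A)"
    and A_ord: "\<beta> \<in> A \<Longrightarrow> is_ord E \<beta>"
    and A_unbounded: "is_ord E a \<Longrightarrow> \<exists>\<beta>. \<beta> \<in> A \<and> E a \<beta>"
begin

abbreviation "P i \<equiv> at_pos E A i"
abbreviation "N j \<equiv> at_lev E A j"

text \<open>The definability of the label predicates is used twice: here over the universe, to pick
  least elements of \<open>A\<close> with given properties, and in \<open>not_in_Val\<close> over
  the worlds, to obtain sentences.\<close>

lemma Bound0: "Bound E (\<lambda>_::unit. UNIV) UNIV A 1 (\<lambda>w s. s 0)"
  by (rule Bound_var[OF D_A]) auto

lemma D_at_pos: "D 1 (\<lambda>s. P i (s 0))"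
  by (rule Dfn_at_pos[OF D_A _ Bound0]) auto

lemma D_limlim: "D 1 (\<lambda>s. limlim E A (s 0))"
  by (rule Dfn_limlim[OF D_A _ Bound0]) auto

lemma D_at_lev: "D 1 (\<lambda>s. N j (s 0))"
  by (rule Dfn_at_lev[OF D_A _ Bound0]) auto

lemma A_least:
  assumes Q: "D 1 (\<lambda>s. Q (s 0))" and \<alpha>: "\<alpha> \<in> A" "Q \<alpha>"
  obtains \<beta> where "\<beta> \<in> A" "Q \<beta>" "\<And>\<gamma>. \<gamma> \<in> A \<Longrightarrow> Q \<gamma> \<Longrightarrow> ord_le E \<beta> \<gamma>"
proof -
  have "D 1 (\<lambda>s. s 0 \<in> A \<and> Q (s 0))" by (intro Dfn_and D_A Q)
  then obtain \<beta> where \<beta>: "\<beta> \<in> A" "Q \<beta>" "\<And>\<gamma>. E \<gamma> \<beta> \<Longrightarrow> \<not> (\<gamma> \<in> A \<and> Q \<gamma>)"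
    using ord_least[of "\<lambda>x. x \<in> A \<and> Q x", OF _ A_ord[OF \<alpha>(1)]] \<alpha> by blast
  then show ?thesis using that ord_le_linear[OF A_ord A_ord] by blast
qed

lemma A_next:
  assumes \<alpha>: "\<alpha> \<in> A"
  obtains \<beta> where "\<beta> \<in> A" "max_below E A \<beta> \<alpha>"
proof -
  obtain \<beta>0 where "\<beta>0 \<in> A" "E \<alpha> \<beta>0" using A_unbounded A_ord[OF \<alpha>] by blast
  moreover have "D 1 (\<lambda>s. E \<alpha> (s 0))" by (intro D_intros; simp)
  ultimately obtain \<beta> where \<beta>: "\<beta> \<in> A" "E \<alpha> \<beta>" "\<And>\<gamma>. \<gamma> \<in> A \<Longrightarrow> E \<alpha> \<gamma> \<Longrightarrow> ord_le E \<beta> \<gamma>"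
    using A_least[of "E \<alpha>"] by blast
  have "E \<gamma> \<alpha> \<or> \<gamma> = \<alpha>" if "\<gamma> \<in> A" "E \<gamma> \<beta>" for \<gamma>
    using \<beta>(3)[OF that(1)] ord_linear[OF A_ord[OF that(1)] A_ord[OF \<alpha>]] ord_not_le[OF A_ord[OF \<beta>(1)]] that(2) by blast
  then have "max_below E A \<beta> \<alpha>" unfolding max_below_def using \<alpha> \<beta> by blast
  then show ?thesis using that \<beta>(1) by blast
qed

lemma max_below_unique:
  assumes "max_below E A \<alpha> \<beta>" "max_below E A \<alpha> \<gamma>" shows "\<beta> = \<gamma>"
proof -
  have "\<beta> \<in> A" using assms unfolding max_below_def by blast
  then have "\<not> (E \<beta> \<gamma> \<and> E \<gamma> \<beta>)" using ord_trans[OF A_ord] not_mem_self by blast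
  then show ?thesis using assms unfolding max_below_def by blast
qed

lemma at_pos_unique: "P i \<alpha> \<Longrightarrow> P j \<alpha> \<Longrightarrow> i = j"
proof (induction i arbitrary: j \<alpha>)
  case 0 then show ?case by (cases j) auto
next
  case (Suc i)
  then obtain \<gamma> where \<gamma>: "max_below E A \<alpha> \<gamma>" "P i \<gamma>" by auto
  then obtain j' where j': "j = Suc j'" using Suc.prems(2) by (cases j) auto
  then obtain \<gamma>' where "max_below E A \<alpha> \<gamma>'" "P j' \<gamma>'" using Suc.prems(2) by auto
  then show ?case using Suc.IH \<gamma> max_below_unique j' by metis
qed

text \<open>The limit \<theta> of \<open>X\<close> found in the ordinals need not lie in
  \<open>A\<close>. The first element of \<open>A\<close> from \<theta> on has the same elements of
  \<open>A\<close> below it as \<theta>, so it inherits the limit property.\<close>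

lemma limit_above:
  assumes X: "D 1 (\<lambda>s. X (s 0))" "\<And>x. X x \<Longrightarrow> x \<in> A"
    and unb: "\<And>a. is_ord E a \<Longrightarrow> \<exists>x. X x \<and> E a x" and a: "is_ord E a"
  obtains \<alpha> where "\<alpha> \<in> A" "E a \<alpha>" "\<exists>\<gamma>. \<gamma> \<in> A \<and> E \<gamma> \<alpha>"
    "\<And>\<gamma>. \<gamma> \<in> A \<Longrightarrow> E \<gamma> \<alpha> \<Longrightarrow> \<exists>x. X x \<and> E \<gamma> x \<and> E x \<alpha>"
proof -
  obtain \<theta> where \<theta>: "is_ord E \<theta>" "E a \<theta>" "\<And>\<gamma>. E \<gamma> \<theta> \<Longrightarrow> \<exists>x. X x \<and> E \<gamma> x \<and> E x \<theta>"
    using limit_points[of X, OF X(1) A_ord[OF X(2)] unb a] by blast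
  obtain \<alpha>0 where "\<alpha>0 \<in> A" "E \<theta> \<alpha>0" using A_unbounded[OF \<theta>(1)] by blast
  then have "\<alpha>0 \<in> A" "ord_le E \<theta> \<alpha>0" unfolding ord_le_def by auto
  moreover have "D 1 (\<lambda>s. ord_le E \<theta> (s 0))" by (intro D_intros; simp)
  ultimately obtain \<alpha> where \<alpha>: "\<alpha> \<in> A" "ord_le E \<theta> \<alpha>" "\<And>\<gamma>. \<gamma> \<in> A \<Longrightarrow> ord_le E \<theta> \<gamma> \<Longrightarrow> ord_le E \<alpha> \<gamma>"
    using A_least[of "ord_le E \<theta>"] by blast
  have o: "is_ord E \<alpha>" using A_ord[OF \<alpha>(1)] .
  have lim: "\<exists>x. X x \<and> E \<gamma> x \<and> E x \<alpha>" if "\<gamma> \<in> A" "E \<gamma> \<alpha>" for \<gamma>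
  proof -
    have "E \<gamma> \<theta>"
      using \<alpha>(3)[OF that(1)] ord_le_linear[OF \<theta>(1) A_ord[OF that(1)]] ord_not_le[OF o] that(2) by blast
    then show ?thesis using \<theta>(3) ord_less_le_trans[OF o _ \<alpha>(2)] by blast
  qed
  have "E a \<alpha>" using ord_less_le_trans[OF o \<theta>(2) \<alpha>(2)] .
  moreover obtain x where "X x" "E x \<theta>" using \<theta>(2,3) by blast
  then have "x \<in> A" "E x \<alpha>" using X(2) ord_less_le_trans[OF o _ \<alpha>(2)] by blast+
  ultimately show ?thesis using that[of \<alpha>] \<alpha>(1) lim by blast
qed

lemma limit_unbounded:
  assumes "is_ord E a" shows "\<exists>\<alpha>. (\<alpha> \<in> A \<and> P 0 \<alpha>) \<and> E a \<alpha>"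
proof -
  obtain \<alpha> where \<alpha>: "\<alpha> \<in> A" "E a \<alpha>" "\<And>\<gamma>. \<gamma> \<in> A \<Longrightarrow> E \<gamma> \<alpha> \<Longrightarrow> \<exists>x. x \<in> A \<and> E \<gamma> x \<and> E x \<alpha>"
    using limit_above[of "\<lambda>x. x \<in> A", OF D_A _ A_unbounded assms] by blast
  have "\<not> max_below E A \<alpha> \<gamma>" for \<gamma>
  proof
    assume m: "max_below E A \<alpha> \<gamma>"
    then obtain x where x: "x \<in> A" "E \<gamma> x" "E x \<alpha>" using \<alpha>(3) unfolding max_below_def by blast
    then have "E x \<gamma> \<or> x = \<gamma>" using m unfolding max_below_def by blast
    then show False using x ord_trans[OF A_ord[OF x(1)]] not_mem_self by blast
  qed
  then show ?thesis using \<alpha> by auto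
qed

lemma limlim_unbounded:
  assumes "is_ord E a" shows "\<exists>\<alpha>. \<alpha> \<in> A \<and> limlim E A \<alpha> \<and> E a \<alpha>"
proof -
  have "D 1 (\<lambda>s. s 0 \<in> A \<and> P 0 (s 0))" by (intro Dfn_and D_A D_at_pos)
  then obtain \<alpha> where \<alpha>: "\<alpha> \<in> A" "E a \<alpha>" "\<exists>\<gamma>. \<gamma> \<in> A \<and> E \<gamma> \<alpha>"
    "\<And>\<gamma>. \<gamma> \<in> A \<Longrightarrow> E \<gamma> \<alpha> \<Longrightarrow> \<exists>x. (x \<in> A \<and> P 0 x) \<and> E \<gamma> x \<and> E x \<alpha>"
    using limit_above[of "\<lambda>x. x \<in> A \<and> P 0 x", OF _ _ limit_unbounded assms] by blast
  then have "limlim E A \<alpha>" unfolding limlim_def by blast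
  then show ?thesis using \<alpha> by blast
qed

text \<open>The definition treats \<alpha> itself in a separate disjunct, because the index of a
  world is not in its domain and only elements strictly below can be quantified over. For \<alpha>
  in \<open>A\<close> both disjuncts merge.\<close>

lemma at_lev_Suc:
  assumes "\<alpha> \<in> A"
  shows "N (Suc j) \<alpha> \<longleftrightarrow>
    (\<exists>\<gamma>. \<gamma> \<in> A \<and> ord_le E \<gamma> \<alpha> \<and> limlim E A \<gamma> \<and> (\<exists>\<gamma>'. \<gamma>' \<in> A \<and> E \<gamma>' \<gamma> \<and> N j \<gamma>'))"
  using assms unfolding at_lev.simps ord_le_def by blast

lemma at_lev_mono:
  assumes "\<alpha> \<in> A" "\<beta> \<in> A" "ord_le E \<alpha> \<beta>" "N j \<alpha>" shows "N j \<beta>"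
proof (cases j)
  case (Suc j')
  then show ?thesis
    using assms at_lev_Suc[of \<alpha> j'] at_lev_Suc[of \<beta> j'] ord_le_trans[OF A_ord[OF assms(2)]] by metis
qed simp

lemma at_lev_antimono:
  assumes "\<alpha> \<in> A" "N j \<alpha>" "j' \<le> j" shows "N j' \<alpha>"
proof -
  have down: "N j \<alpha>" if suc: "N (Suc j) \<alpha>" for j
  proof -
    obtain \<gamma> \<gamma>' where "\<gamma> \<in> A" "ord_le E \<gamma> \<alpha>" "\<gamma>' \<in> A" "E \<gamma>' \<gamma>" "N j \<gamma>'"
      using suc at_lev_Suc[OF assms(1)] by blast
    then show ?thesis
      using at_lev_mono[OF \<open>\<gamma>' \<in> A\<close> assms(1)] ord_less_le_trans[OF A_ord[OF assms(1)]] unfolding ord_le_def by blast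
  qed
  show ?thesis using assms(3) by (induction rule: inc_induct) (use assms(2) down in auto)
qed

text \<open>\<open>N (Suc j)\<close> requires an element with \<open>N j\<close> strictly below,
  which the first one does not have. So no level is skipped.\<close>

lemma at_lev_least:
  assumes \<gamma>: "\<gamma> \<in> A" "N j \<gamma>" and least: "\<And>\<xi>. \<xi> \<in> A \<Longrightarrow> N j \<xi> \<Longrightarrow> ord_le E \<gamma> \<xi>"
  shows "\<not> N (Suc j) \<gamma>"
proof
  assume "N (Suc j) \<gamma>"
  then obtain \<xi> \<xi>' where \<xi>: "\<xi> \<in> A" "ord_le E \<xi> \<gamma>" "\<xi>' \<in> A" "E \<xi>' \<xi>" "N j \<xi>'"
    using at_lev_Suc[OF \<gamma>(1)] by blast
  then have "E \<xi>' \<gamma>" using ord_less_le_trans[OF A_ord[OF \<gamma>(1)]] by blast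
  then show False using least \<xi>(3,5) ord_not_le[OF A_ord[OF \<gamma>(1)]] by blast
qed

lemma at_lev_exists: "\<exists>\<alpha>. \<alpha> \<in> A \<and> N j \<alpha>"
proof (induction j)
  case 0
  obtain e where "is_empty E e" using empty_exists by blast
  then have "is_ord E e" unfolding is_empty_def is_ord_def trans_set_def by blast
  then show ?case using A_unbounded by auto
next
  case (Suc j)
  then obtain \<gamma> where \<gamma>: "\<gamma> \<in> A" "N j \<gamma>" by blast
  then obtain \<alpha> where "\<alpha> \<in> A" "limlim E A \<alpha>" "E \<gamma> \<alpha>" using limlim_unbounded[OF A_ord] by blast
  then show ?case using \<gamma> at_lev_Suc[of \<alpha> j] ord_le_refl by blast
qed

declare at_lev.simps(2) [simp del]

lemma lev_mono:
  assumes "\<alpha> \<in> A" "\<beta> \<in> A" "ord_le E \<alpha> \<beta>" shows "lev E A r \<alpha> \<le> lev E A r \<beta>"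
proof -
  have "\<not> N (Suc (lev E A r \<beta>)) \<beta> \<or> r \<le> Suc (lev E A r \<beta>)" using lev_eq_iff by metis
  then have "\<not> N (Suc (lev E A r \<beta>)) \<alpha> \<or> r \<le> Suc (lev E A r \<beta>)" using at_lev_mono[OF assms] by blast
  then show ?thesis unfolding lev_def[of E A r \<alpha>] by (rule Least_le)
qed

lemma lev_eq:
  assumes "\<alpha> \<in> A" "N j \<alpha>" "j < r" "\<not> N (Suc j) \<alpha> \<or> r \<le> Suc j" shows "lev E A r \<alpha> = j"
  unfolding lev_eq_iff using assms at_lev_antimono[OF assms(1,2)] by auto

lemma at_lev_lev: "N (lev E A r \<alpha>) \<alpha>"
proof (cases "lev E A r \<alpha>")
  case (Suc l)
  then show ?thesis using lev_eq_iff[of E A r \<alpha> "Suc l"] by auto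
qed simp

lemma lev_reachable:
  assumes \<beta>: "\<beta> \<in> A" and j: "lev E A r \<beta> \<le> j" "j < r"
  obtains \<gamma> where "\<gamma> \<in> A" "ord_le E \<beta> \<gamma>" "N j \<gamma>" "\<not> N (Suc j) \<gamma> \<or> r \<le> Suc j"
proof (cases "lev E A r \<beta> = j")
  case True
  then show ?thesis using that[OF \<beta> ord_le_refl] lev_eq_iff[of E A r \<beta> j] at_lev_lev[of r \<beta>] by blast
next
  case False
  obtain \<alpha> where "\<alpha> \<in> A" "N j \<alpha>" using at_lev_exists by blast
  then obtain \<gamma> where \<gamma>: "\<gamma> \<in> A" "N j \<gamma>" "\<And>\<xi>. \<xi> \<in> A \<Longrightarrow> N j \<xi> \<Longrightarrow> ord_le E \<gamma> \<xi>"
    using A_least[OF D_at_lev] by blast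
  have "\<not> N (Suc (lev E A r \<beta>)) \<beta>" using lev_eq_iff[of E A r \<beta> "lev E A r \<beta>"] False j by auto
  then have "\<not> N j \<beta>" using at_lev_antimono[OF \<beta>, of j] False j by auto
  then have "ord_le E \<beta> \<gamma>"
    using at_lev_mono[OF \<gamma>(1) \<beta> _ \<gamma>(2)] ord_linear[OF A_ord[OF \<beta>] A_ord[OF \<gamma>(1)]] unfolding ord_le_def by blast
  then show ?thesis using that \<gamma> at_lev_least[OF \<gamma>] by blast
qed

lemma label_reachable:
  assumes \<beta>: "\<beta> \<in> A" and j: "lev E A r \<beta> \<le> j" "j < r" and i: "i < m"
  obtains \<gamma> where "\<gamma> \<in> A" "ord_le E \<beta> \<gamma>" "lev E A r \<gamma> = j" "pos E A m \<gamma> = i"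
proof -
  obtain \<gamma> where \<gamma>: "\<gamma> \<in> A" "ord_le E \<beta> \<gamma>" "N j \<gamma>" "\<not> N (Suc j) \<gamma> \<or> r \<le> Suc j"
    using lev_reachable[OF \<beta> j] by blast
  \<comment> \<open>The window runs from \<gamma> to the first limit of limits \<alpha> above it.
    The level is constant there, and \<alpha> being a limit of limits leaves room for a limit of
    \<open>A\<close> and each of its finite successors.\<close>
  obtain \<alpha>0 where "\<alpha>0 \<in> A" "limlim E A \<alpha>0 \<and> E \<gamma> \<alpha>0" using limlim_unbounded[OF A_ord[OF \<gamma>(1)]] by blast
  moreover have "D 1 (\<lambda>s. limlim E A (s 0) \<and> E \<gamma> (s 0))" by (intro Dfn_and D_limlim D_intros; simp)
  ultimately obtain \<alpha> where \<alpha>: "\<alpha> \<in> A" "limlim E A \<alpha>" "E \<gamma> \<alpha>"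
    "\<And>\<xi>. \<xi> \<in> A \<Longrightarrow> limlim E A \<xi> \<and> E \<gamma> \<xi> \<Longrightarrow> ord_le E \<alpha> \<xi>"
    using A_least[of "\<lambda>x. limlim E A x \<and> E \<gamma> x"] by blast
  have window: "\<exists>\<xi>. \<xi> \<in> A \<and> ord_le E \<gamma> \<xi> \<and> E \<xi> \<alpha> \<and> P i \<xi>" for i
  proof (induction i)
    case 0
    then show ?case using \<alpha>(2,3) \<gamma>(1) unfolding limlim_def ord_le_def by blast
  next
    case (Suc i)
    then obtain \<xi> where \<xi>: "\<xi> \<in> A" "ord_le E \<gamma> \<xi>" "E \<xi> \<alpha>" "P i \<xi>" by blast
    obtain \<zeta> where \<zeta>: "\<zeta> \<in> A" "max_below E A \<zeta> \<xi>" using A_next[OF \<xi>(1)] by blast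
    obtain \<eta> where \<eta>: "\<eta> \<in> A" "E \<eta> \<alpha>" "E \<xi> \<eta>" using \<alpha>(2) \<xi> unfolding limlim_def by blast
    have "\<not> E \<eta> \<zeta>"
      using \<zeta>(2) \<eta> ord_not_le[OF A_ord[OF \<eta>(1)]] unfolding max_below_def ord_le_def by blast
    then have "ord_le E \<zeta> \<eta>" using ord_le_linear[OF A_ord[OF \<zeta>(1)] A_ord[OF \<eta>(1)]] by blast
    then have "E \<zeta> \<alpha>" using ord_le_less_trans[OF A_ord[OF \<alpha>(1)] _ \<eta>(2)] by blast
    moreover have "ord_le E \<gamma> \<zeta>"
      using ord_le_less_trans[OF A_ord[OF \<zeta>(1)] \<xi>(2)] \<zeta>(2) unfolding max_below_def ord_le_def by blast
    moreover have "P (Suc i) \<zeta>" using \<zeta>(2) \<xi>(4) by auto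
    ultimately show ?case using \<zeta>(1) by blast
  qed
  then obtain \<xi> where \<xi>: "\<xi> \<in> A" "ord_le E \<gamma> \<xi>" "E \<xi> \<alpha>" "P i \<xi>" by blast
  \<comment> \<open>By the choice of \<alpha>, a limit of limits up to \<xi> is not above \<gamma>
    and so counts for \<gamma> already.\<close>
  have "\<not> N (Suc j) \<xi> \<or> r \<le> Suc j"
  proof (rule ccontr)
    assume no: "\<not> ?thesis"
    then obtain \<zeta> where \<zeta>: "\<zeta> \<in> A" "ord_le E \<zeta> \<xi>" "limlim E A \<zeta>" "\<exists>\<zeta>'. \<zeta>' \<in> A \<and> E \<zeta>' \<zeta> \<and> N j \<zeta>'"
      using at_lev_Suc[OF \<xi>(1)] by blast
    have "E \<zeta> \<alpha>" using ord_le_less_trans[OF A_ord[OF \<alpha>(1)] \<zeta>(2) \<xi>(3)] .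
    then have "\<not> E \<gamma> \<zeta>" using \<alpha>(4)[OF \<zeta>(1)] \<zeta>(3) ord_not_le[OF A_ord[OF \<alpha>(1)]] by blast
    then have "ord_le E \<zeta> \<gamma>" using ord_le_linear[OF A_ord[OF \<zeta>(1)] A_ord[OF \<gamma>(1)]] by blast
    then have "N (Suc j) \<gamma>" using at_lev_Suc[OF \<gamma>(1)] \<zeta> by blast
    then show False using no \<gamma>(4) by blast
  qed
  then have "lev E A r \<xi> = j" using lev_eq[OF \<xi>(1) at_lev_mono[OF \<gamma>(1) \<xi>(1,2) \<gamma>(3)] j(2)] by blast
  moreover have "\<not> P i' \<xi>" if "i' < i" for i' using at_pos_unique[OF \<xi>(4), of i'] that by blast
  then have "pos E A m \<xi> = i"
    unfolding pos_eq_iff using \<xi>(4) i by (simp del: at_pos.simps)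
  moreover have "ord_le E \<beta> \<xi>" using ord_le_trans[OF A_ord[OF \<xi>(1)] \<gamma>(2) \<xi>(2)] .
  ultimately show ?thesis using that \<xi>(1) by blast
qed

section \<open>From labels to bounds on the validities\<close>

text \<open>Labelling is a bounded morphism into the frame of clusters: \<open>lev_mono\<close>
  gives the forth condition, \<open>label_reachable\<close> the back condition.\<close>

lemma sat_instantiate_label:
  assumes r: "1 \<le> r" and m: "1 \<le> m"
    and \<sigma>: "\<And>n \<beta>. \<beta> \<in> A \<Longrightarrow> sat E (V E) (acc E A) \<beta> s (\<sigma> n) \<longleftrightarrow> v (lev E A r \<beta>) (pos E A m \<beta>) n"
    and \<beta>: "\<beta> \<in> A"
  shows "sat E (V E) (acc E A) \<beta> s (instantiate \<sigma> p) \<longleftrightarrow> fval r m v (lev E A r \<beta>) (pos E A m \<beta>) p"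
  using \<beta>
proof (induction p arbitrary: \<beta>)
  case (PBox p)
  have "sat E (V E) (acc E A) \<beta> s (instantiate \<sigma> (PBox p)) \<longleftrightarrow>
    (\<forall>\<gamma>. \<gamma> \<in> A \<longrightarrow> ord_le E \<beta> \<gamma> \<longrightarrow> fval r m v (lev E A r \<gamma>) (pos E A m \<gamma>) p)"
    using PBox.IH PBox.prems unfolding acc_def by auto
  also have "\<dots> \<longleftrightarrow> fval r m v (lev E A r \<beta>) (pos E A m \<beta>) (PBox p)"
  proof
    assume L: "\<forall>\<gamma>. \<gamma> \<in> A \<longrightarrow> ord_le E \<beta> \<gamma> \<longrightarrow> fval r m v (lev E A r \<gamma>) (pos E A m \<gamma>) p"
    have "fval r m v j i p" if "lev E A r \<beta> \<le> j" "j < r" "i < m" for j i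
      using label_reachable[OF PBox.prems that] L by metis
    then show "fval r m v (lev E A r \<beta>) (pos E A m \<beta>) (PBox p)" by simp
  next
    assume "fval r m v (lev E A r \<beta>) (pos E A m \<beta>) (PBox p)"
    then have "fval r m v (lev E A r \<gamma>) (pos E A m \<gamma>) p" if "\<gamma> \<in> A" "ord_le E \<beta> \<gamma>" for \<gamma>
      using lev_mono[OF PBox.prems that, of r] lev_less[OF r, of E A \<gamma>] pos_less[OF m, of E A \<gamma>] by simp
    then show "\<forall>\<gamma>. \<gamma> \<in> A \<longrightarrow> ord_le E \<beta> \<gamma> \<longrightarrow> fval r m v (lev E A r \<gamma>) (pos E A m \<gamma>) p"
      by blast
  qed
  finally show ?case .
qed (use \<sigma> in auto)

lemma V_downward: "\<beta> \<in> A \<Longrightarrow> x \<in> V E \<beta> \<Longrightarrow> E \<gamma> x \<Longrightarrow> \<gamma> \<in> V E \<beta>"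
  using VV_sub[OF A_ord] mem_V[OF A_ord] by blast

lemma A_mem_V: "\<beta> \<in> A \<Longrightarrow> \<gamma> \<in> A \<Longrightarrow> \<gamma> \<in> V E \<beta> \<longleftrightarrow> E \<gamma> \<beta>"
  using mem_V[OF A_ord] ord_mem_VV[OF A_ord A_ord] by simp

lemma not_in_Val:
  assumes DA: "Dfn E (V E) (acc E A) A mf {} 1 (\<lambda>w s. s 0 \<in> A)"
    and L: "L = {\<phi>. fv \<phi> = {} \<and> params \<phi> = {} \<and> (mf \<longrightarrow> modal_free \<phi>)}"
    and r: "1 \<le> r" and m: "1 \<le> m"
    and \<beta>: "\<beta> \<in> A" "\<not> fval r m v (lev E A r \<beta>) (pos E A m \<beta>) p"
  shows "p \<notin> Val E A \<beta> L"
proof -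
  \<comment> \<open>Worlds are represented by their indices. With the index as bound the label
    formula has no free variable, so it is a sentence.\<close>
  have bound: "Bound E (V E) A A 0 (\<lambda>w s. w)"
    by (rule Bound_index[where h = "\<lambda>w. w", OF DA]) (use V_downward A_mem_V in blast)+
  have "Dfn E (V E) (acc E A) A mf {} 0 (\<lambda>w s. v (lev E A r w) (pos E A m w) n)" for n
    by (rule Dfn_label[OF DA V_downward bound r m, where v = "\<lambda>j i. v j i n"])
  then have "\<exists>\<phi>. \<phi> \<in> L \<and> (\<forall>\<beta>\<in>A. \<forall>s. sat E (V E) (acc E A) \<beta> s \<phi> \<longleftrightarrow> v (lev E A r \<beta>) (pos E A m \<beta>) n)" for n
    unfolding Dfn_def L by simp
  then obtain \<sigma> where \<sigma>: "\<And>n. \<sigma> n \<in> L"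
    "\<And>n \<beta> s. \<beta> \<in> A \<Longrightarrow> sat E (V E) (acc E A) \<beta> s (\<sigma> n) \<longleftrightarrow> v (lev E A r \<beta>) (pos E A m \<beta>) n"
    by metis
  have "\<not> true_at E A \<beta> (instantiate \<sigma> p)"
    unfolding true_at_def using sat_instantiate_label[of r m _ \<sigma> v, OF r m \<sigma>(2) \<beta>(1)] \<beta>(2) by simp
  then show ?thesis unfolding Val_def using \<sigma>(1) by blast
qed

lemma Val_subset_S5:
  assumes DA: "Dfn E (V E) (acc E A) A mf {} 1 (\<lambda>w s. s 0 \<in> A)"
    and L: "L = {\<phi>. fv \<phi> = {} \<and> params \<phi> = {} \<and> (mf \<longrightarrow> modal_free \<phi>)}" and \<beta>: "\<beta> \<in> A"
  shows "Val E A \<beta> L \<subseteq> S5"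
proof (rule subsetI, rule ccontr)
  fix p assume p: "p \<in> Val E A \<beta> L" "p \<notin> S5"
  obtain m where m: "1 \<le> m" "\<And>i. i < m \<Longrightarrow> \<exists>v. \<not> fval 1 m v 0 i p" using S5_countermodel[OF p(2)] by blast
  \<comment> \<open>The position of \<beta> cannot be chosen, so the valuation is chosen to refute
    \<open>p\<close> at that point of the cluster.\<close>
  obtain v where "\<not> fval 1 m v 0 (pos E A m \<beta>) p" using m(2)[OF pos_less[OF m(1), of E A \<beta>]] by blast
  moreover have "lev E A 1 \<beta> = 0" using lev_less[of 1 E A \<beta>] by simp
  ultimately show False using not_in_Val[OF DA L _ m(1) \<beta>, of 1 v p] p(1) by simp
qed

lemma Val_subset_S4_3:
  assumes DA: "Dfn E (V E) (acc E A) A mf {} 1 (\<lambda>w s. s 0 \<in> A)"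
    and L: "L = {\<phi>. fv \<phi> = {} \<and> params \<phi> = {} \<and> (mf \<longrightarrow> modal_free \<phi>)}"
  shows "\<exists>\<beta>\<in>A. Val E A \<beta> L \<subseteq> S4_3"
proof -
  obtain \<alpha> where "\<alpha> \<in> A" using at_lev_exists by blast
  \<comment> \<open>Nothing in \<open>A\<close> lies below the least element, so its level is 0 for
    every \<open>r\<close>. This one world therefore serves all formulas \<open>p\<close>.\<close>
  then obtain \<beta> where \<beta>: "\<beta> \<in> A" "\<And>\<gamma>. \<gamma> \<in> A \<Longrightarrow> ord_le E \<beta> \<gamma>"
    by (rule A_least[of "\<lambda>_. True", OF Dfn_const _ TrueI]) simp
  have "\<not> N (Suc 0) \<beta>"
  proof
    assume "N (Suc 0) \<beta>"
    then obtain \<gamma> where "\<gamma> \<in> A" "E \<gamma> \<beta>" by (auto simp: at_lev.simps)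
    then show False using \<beta> ord_not_le[OF A_ord[OF \<beta>(1)]] by blast
  qed
  then have lev0: "lev E A r \<beta> = 0" for r unfolding lev_eq_iff by simp
  have "Val E A \<beta> L \<subseteq> S4_3"
  proof (rule subsetI, rule ccontr)
    fix p assume p: "p \<in> Val E A \<beta> L" "p \<notin> S4_3"
    obtain r m where m: "1 \<le> r" "1 \<le> m" "\<And>i. i < m \<Longrightarrow> \<exists>v. \<not> fval r m v 0 i p"
      using S4_3_countermodel[OF p(2)] by blast
    obtain v where "\<not> fval r m v 0 (pos E A m \<beta>) p" using m(3)[OF pos_less[OF m(2), of E A \<beta>]] by blast
    then show False using not_in_Val[OF DA L m(1,2) \<beta>(1), of v p] p(1) lev0 by simp
  qed
  then show ?thesis using \<beta>(1) by blast
qed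

lemma S4_3_subset_Val:
  assumes \<beta>: "\<beta> \<in> A" shows "S4_3 \<subseteq> Val E A \<beta> L"
proof
  fix p assume p: "p \<in> S4_3"
  have "sat E (V E) (acc E A) \<beta> s (instantiate \<sigma> p)" for \<sigma> s
  proof (rule S4_3_sound[OF _ _ _ _ p \<beta>])
    show "acc E A w w" if "w \<in> A" for w using that unfolding acc_def ord_le_def by blast
    show "acc E A u w" if "acc E A u v" "acc E A v w" for u v w
      using that ord_le_trans[OF A_ord] unfolding acc_def by blast
    show "acc E A v w \<or> acc E A w v" if "acc E A u v" "acc E A u w" for u v w
      using that ord_linear[OF A_ord A_ord] unfolding acc_def ord_le_def by blast
    show "v \<in> A" if "acc E A u v" for u v using that unfolding acc_def by blast
  qed
  then show "p \<in> Val E A \<beta> L" unfolding Val_def true_at_def by blast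
qed

lemma V_cofinal:
  assumes \<beta>: "\<beta> \<in> A" shows "\<exists>\<gamma>. acc E A \<beta> \<gamma> \<and> x \<in> V E \<gamma>"
proof -
  obtain \<alpha> where \<alpha>: "is_ord E \<alpha>" "E x (VV \<alpha>)" using VV_cover by blast
  obtain \<gamma> where \<gamma>: "\<gamma> \<in> A" "ord_le E \<beta> \<gamma>" "ord_le E \<alpha> \<gamma>"
  proof (cases "E \<alpha> \<beta>")
    case True then show ?thesis using that[OF \<beta> ord_le_refl] unfolding ord_le_def by blast
  next
    case False
    obtain \<gamma> where \<gamma>: "\<gamma> \<in> A" "E \<alpha> \<gamma>" using A_unbounded[OF \<alpha>(1)] by blast
    moreover have "ord_le E \<beta> \<alpha>" using False ord_le_linear[OF A_ord[OF \<beta>] \<alpha>(1)] by blast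
    ultimately show ?thesis
      using that[OF \<gamma>(1)] ord_le_less_trans[OF A_ord[OF \<gamma>(1)]] unfolding ord_le_def by blast
  qed
  then have "x \<in> V E \<gamma>" using VV_mono[OF A_ord[OF \<gamma>(1)] \<gamma>(3) \<alpha>(2)] mem_V[OF A_ord[OF \<gamma>(1)]] by blast
  then show ?thesis using \<gamma> \<beta> unfolding acc_def by blast
qed

lemma V_mono: "acc E A \<beta> \<gamma> \<Longrightarrow> x \<in> V E \<beta> \<Longrightarrow> x \<in> V E \<gamma>"
  unfolding acc_def using VV_mono[OF A_ord] mem_V[OF A_ord] by blast

end

text \<open>The potentialist translation: truth in the limit of the worlds, expressed at a world.\<close>

fun potentialist :: "'a fm \<Rightarrow> 'a fm" where
  "potentialist (FMem t u) = FMem t u"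
| "potentialist (FEq t u) = FEq t u"
| "potentialist (FNeg \<phi>) = FNeg (potentialist \<phi>)"
| "potentialist (FImp \<phi> \<psi>) = FImp (potentialist \<phi>) (potentialist \<psi>)"
| "potentialist (FAll n \<phi>) = FBox (FAll n (potentialist \<phi>))"
| "potentialist (FBox \<phi>) = FBox (potentialist \<phi>)"

lemma fv_potentialist: "fv (potentialist \<phi>) = fv \<phi>" by (induction \<phi>) auto

lemma params_potentialist: "params (potentialist \<phi>) = params \<phi>" by (induction \<phi>) auto

text \<open>The worlds form a chain that exhausts the universe, so a universal quantifier behind a
  box ranges over all sets. \<open>V_mono\<close> keeps the values chosen earlier in the later
  domains.\<close>

lemma (in zfc_class) sat_potentialist:
  "modal_free \<phi> \<Longrightarrow> \<beta> \<in> A \<Longrightarrow> \<forall>n\<in>fv \<phi>. s n \<in> V E \<beta> \<Longrightarrow>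
    sat E (V E) (acc E A) \<beta> s (potentialist \<phi>) = fo_sat E UNIV s \<phi>"
  unfolding fo_sat_def
proof (induction \<phi> arbitrary: s \<beta>)
  case (FAll n \<phi>)
  have "sat E (V E) (acc E A) \<gamma> (s(n := x)) (potentialist \<phi>) = sat E (\<lambda>_::unit. UNIV) (=) () (s(n := x)) \<phi>"
    if "acc E A \<beta> \<gamma>" "x \<in> V E \<gamma>" for \<gamma> x
  proof (rule FAll.IH)
    show "\<gamma> \<in> A" using that(1) unfolding acc_def by blast
  qed (use FAll.prems that V_mono[OF that(1)] in auto)
  then show ?case using V_cofinal[OF FAll.prems(2)]
    by (simp only: potentialist.simps sat.simps) blast
qed auto

text \<open>Mediates between the constant assignments in \<open>class_of\<close> and
  \<open>absolute_to\<close> and the arbitrary ones in \<open>Dfn\<close>.\<close>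

lemma sat_one_var: "fv \<phi> \<subseteq> {0} \<Longrightarrow> sat E D R w s \<phi> = sat E D R w (\<lambda>_. s 0) \<phi>"
  by (rule sat_cong_fv) auto

theorem theorem16:
  fixes E :: "'a \<Rightarrow> 'a \<Rightarrow> bool" and \<delta> :: "'a fm" and A :: "'a set"
  assumes zfc: "zfc_model E"
    and definition_A: "class_definition \<delta>" "A = class_of E \<delta>"
    and ordinals: "\<forall>\<beta> \<in> A. is_ord E \<beta>"
    and proper: "proper_class E A"
  shows "((\<forall>\<beta> \<in> A. absolute_to E \<delta> (V E \<beta>)) \<longrightarrow>
      (\<forall>\<beta> \<in> A. S4_3 \<subseteq> Val E A \<beta> (L_in_dia_par (V E \<beta>)) \<and>
        Val E A \<beta> (L_in_dia_par (V E \<beta>)) \<subseteq> Val E A \<beta> L_in \<and>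
        Val E A \<beta> L_in \<subseteq> S5) \<and>
      (\<exists>\<beta> \<in> A. S4_3 = Val E A \<beta> (L_in_dia_par (V E \<beta>)) \<and>
        Val E A \<beta> (L_in_dia_par (V E \<beta>)) = Val E A \<beta> L_in)) \<and>
    (\<forall>\<beta> \<in> A. S4_3 \<subseteq> Val E A \<beta> (L_in_dia_par (V E \<beta>)) \<and>
      Val E A \<beta> (L_in_dia_par (V E \<beta>)) \<subseteq> Val E A \<beta> L_in_dia \<and>
      Val E A \<beta> L_in_dia \<subseteq> S5) \<and>
    (\<exists>\<beta> \<in> A. S4_3 = Val E A \<beta> (L_in_dia_par (V E \<beta>)) \<and>
      Val E A \<beta> (L_in_dia_par (V E \<beta>)) = Val E A \<beta> L_in_dia)"
proof -
  interpret zfc_model E by (rule zfc)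
  have \<delta>: "modal_free \<delta>" "params \<delta> = {}" "fv \<delta> \<subseteq> {0}"
    using definition_A(1) unfolding class_definition_def by auto
  note at0 = sat_one_var[OF \<delta>(3)]
  have A: "x \<in> A \<longleftrightarrow> fo_sat E UNIV (\<lambda>_. x) \<delta>" for x
    using definition_A(2) unfolding class_of_def by simp
  interpret zfc_class E A
  proof
    show DA: "D 1 (\<lambda>s. s 0 \<in> A)"
      unfolding Dfn_def
    proof (intro exI[of _ \<delta>] conjI ballI allI impI)
      show "sat E (\<lambda>_::unit. UNIV) (=) w s \<delta> \<longleftrightarrow> s 0 \<in> A" for w s
        unfolding A fo_sat_def by (cases w) (simp only: at0[of _ _ _ _ s])
    qed (use \<delta> in auto)
    show "is_ord E \<beta>" if "\<beta> \<in> A" for \<beta> using ordinals that by blast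
    show "\<exists>\<beta>. \<beta> \<in> A \<and> E a \<beta>" if a: "is_ord E a" for a
    proof (rule ccontr)
      assume no: "\<not> ?thesis"
      \<comment> \<open>If no element of \<open>A\<close> were above \<open>a\<close>, then
        \<open>A\<close> would be included in the successor of \<open>a\<close> and hence be a
        set.\<close>
      obtain b where b: "is_succ E a b" using is_succ_exists by blast
      have "E x b" if "x \<in> A" for x
        using no that ord_linear[OF a, of x] ordinals b unfolding is_succ_def by blast
      then have "small (\<lambda>x. x \<in> A)" by (rule sep[of "\<lambda>x. x \<in> A", OF DA])
      then show False using proper unfolding proper_class_def small_def by blast
    qed
  qed
  \<comment> \<open>A smaller language has fewer substitution instances and therefore at least as
    many validities.\<close>
  have chain: "Val E A \<beta> (L_in_dia_par U) \<subseteq> Val E A \<beta> L_in_dia"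
    "Val E A \<beta> (L_in_dia_par U) \<subseteq> Val E A \<beta> L_in" for \<beta> U
    unfolding Val_def L_in_dia_par_def L_in_dia_def L_in_def by auto
  have lower: "S4_3 \<subseteq> Val E A \<beta> L" if "\<beta> \<in> A" for \<beta> L by (rule S4_3_subset_Val[OF that])
  have L_in: "L_in = {\<phi>::'a fm. fv \<phi> = {} \<and> params \<phi> = {} \<and> (True \<longrightarrow> modal_free \<phi>)}"
    and L_in_dia: "L_in_dia = {\<phi>::'a fm. fv \<phi> = {} \<and> params \<phi> = {} \<and> (False \<longrightarrow> modal_free \<phi>)}"
    unfolding L_in_def L_in_dia_def by auto
  have general: "Dfn E (V E) (acc E A) A False {} 1 (\<lambda>w s. s 0 \<in> A)"
    unfolding Dfn_def
  proof (intro exI[of _ "potentialist \<delta>"] conjI ballI allI impI)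
    fix \<beta> and s :: "nat \<Rightarrow> 'a" assume \<beta>: "\<beta> \<in> A" "\<forall>n<1. s n \<in> V E \<beta>"
    then have "sat E (V E) (acc E A) \<beta> s (potentialist \<delta>) = fo_sat E UNIV s \<delta>"
      using \<delta> by (intro sat_potentialist) auto
    also have "\<dots> \<longleftrightarrow> s 0 \<in> A" unfolding A fo_sat_def by (rule at0)
    finally show "sat E (V E) (acc E A) \<beta> s (potentialist \<delta>) \<longleftrightarrow> s 0 \<in> A" .
  qed (use \<delta> in \<open>auto simp: fv_potentialist params_potentialist\<close>)
  have absolute: "Dfn E (V E) (acc E A) A True {} 1 (\<lambda>w s. s 0 \<in> A)"
    if abs: "\<forall>\<beta>\<in>A. absolute_to E \<delta> (V E \<beta>)"
    unfolding Dfn_def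
  proof (intro exI[of _ \<delta>] conjI ballI allI impI)
    fix \<beta> and s :: "nat \<Rightarrow> 'a" assume \<beta>: "\<beta> \<in> A" "\<forall>n<1. s n \<in> V E \<beta>"
    have "sat E (V E) (acc E A) \<beta> s \<delta> = sat E (V E) (acc E A) \<beta> (\<lambda>_. s 0) \<delta>" by (rule at0)
    also have "\<dots> = fo_sat E (V E \<beta>) (\<lambda>_. s 0) \<delta>"
      unfolding fo_sat_def by (rule sat_modal_free[OF \<delta>(1)]) simp
    also have "\<dots> \<longleftrightarrow> s 0 \<in> A" using abs \<beta> A[of "s 0"] unfolding absolute_to_def by simp
    finally show "sat E (V E) (acc E A) \<beta> s \<delta> \<longleftrightarrow> s 0 \<in> A" .
  qed (use \<delta> in auto)
  have realized_general: "\<exists>\<beta>\<in>A. S4_3 = Val E A \<beta> (L_in_dia_par (V E \<beta>)) \<and> Val E A \<beta> (L_in_dia_par (V E \<beta>)) = Val E A \<beta> L_in_dia"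
  proof -
    obtain \<beta> where \<beta>: "\<beta> \<in> A" "Val E A \<beta> L_in_dia \<subseteq> S4_3" using Val_subset_S4_3[OF general L_in_dia] by blast
    then show ?thesis using lower[OF \<beta>(1)] chain(1)[of \<beta> "V E \<beta>"] by blast
  qed
  have realized_absolute: "\<exists>\<beta>\<in>A. S4_3 = Val E A \<beta> (L_in_dia_par (V E \<beta>)) \<and> Val E A \<beta> (L_in_dia_par (V E \<beta>)) = Val E A \<beta> L_in"
    if abs: "\<forall>\<beta>\<in>A. absolute_to E \<delta> (V E \<beta>)"
  proof -
    obtain \<beta> where \<beta>: "\<beta> \<in> A" "Val E A \<beta> L_in \<subseteq> S4_3"
      using Val_subset_S4_3[OF absolute[OF abs] L_in] by blast
    then show ?thesis using lower[OF \<beta>(1)] chain(2)[of \<beta> "V E \<beta>"] by blast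
  qed
  have S5_general: "Val E A \<beta> L_in_dia \<subseteq> S5" if "\<beta> \<in> A" for \<beta>
    by (rule Val_subset_S5[OF general L_in_dia that])
  have S5_absolute: "Val E A \<beta> L_in \<subseteq> S5" if "\<forall>\<beta>\<in>A. absolute_to E \<delta> (V E \<beta>)" "\<beta> \<in> A" for \<beta>
    by (rule Val_subset_S5[OF absolute[OF that(1)] L_in that(2)])
  show ?thesis
    by (intro conjI impI ballI;
      (rule lower chain S5_general S5_absolute realized_general realized_absolute; assumption))
qed

end
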